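(* Let $(X,\phi)$ be a compact metric flow without fixed points. For any $\phi$-invariant Borel probability measure $\mu\in\mathcal{M}_\phi(X)$, $$\underline{h}_\mu(\phi)=\overline{h}_\mu(\phi)=h_\mu(\phi_1),$$ and $\overline{h}_\mu(\phi,x)=\underline{h}_\mu(\phi,x)$ for $\mu$-a.e. $x\in X$.
   Context: A (compact metric) flow $(X,\phi)$ consists of a compact metric space $(X,d)$ and a continuous map $\phi:X\times\mathbb{R}\to X$ such that each $\phi_t:=\phi(\cdot,t)$ is a homeomorphism of $X$ and $\phi_t\circ\phi_s=\phi_{s+t}$ for all $s,t\in\mathbb{R}$. It is without fixed points if there is no $x\in X$ with $\phi_t(x)=x$ for all $t\in\mathbb{R}$. $\mathcal{M}_\phi(X)$ is the set of Borel probability measures $\mu$ on $X$ with $\mu(\phi_t(B))=\mu(B)$ for all Borel $B$ and all $t\in\mathbb{R}$. $h_\mu(\phi_1)$ is the usual (Kolmogorov–Sinai) measure-theoretic entropy of the time-one map $\phi_1$. For a closed interval $I$ containing $0$, a reparametrization on $I$ is a continuous map $\alpha:I\to\mathbb{R}$ that is a homeomorphism onto its image with $\alpha(0)=0$; $Rep(I)$ is the set of these, and $Rep[0,t]=Rep([0,t])$. For $x\in X$, $t\ge 0$, $\epsilon>0$ the reparametrization ball (an open set) is $$B(x,t,\epsilon,\phi)=\{y\in X:\exists\,\alpha\in Rep[0,t]\text{ such that } d(\phi_{\alpha(s)}x,\phi_s y)<\epsilon\ \ \forall\, 0\le s\le t\}.$$ Local entropies (values in $[0,\infty]$, with $-\log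 0=+\infty$): $$\underline{h}_\mu(\phi,x)=\lim_{\epsilon\to0}\liminf_{t\to\infty}-\tfrac1t\log\mu(B(x,t,\epsilon,\phi)),\qquad \overline{h}_\mu(\phi,x)=\lim_{\epsilon\to0}\limsup_{t\to\infty}-\tfrac1t\log\mu(B(x,t,\epsilon,\phi)).$$ Lower and upper measure-theoretic entropies of the flow: $\underline{h}_\mu(\phi)=\int_X\underline{h}_\mu(\phi,x)\,d\mu$ and $\overline{h}_\mu(\phi)=\int_X\overline{h}_\mu(\phi,x)\,d\mu$. *)

theory Defs
  imports "HOL-Probability.Probability"
begin

text \<open>
  The phase space is the whole type \<open>'a\<close>, with its class metric and its Borel sets; the map
  \<open>\<phi>\<^sub>t\<close> is \<open>\<phi> t\<close>.
\<close>

locale compact_metric_flow =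
  fixes \<phi> :: "real \<Rightarrow> 'a::metric_space \<Rightarrow> 'a"
  assumes compact_space: "compact (UNIV :: 'a set)"
    and continuous: "continuous_on UNIV (\<lambda>(x, t). \<phi> t x)"
    and homeo: "\<exists>g. homeomorphism UNIV UNIV (\<phi> t) g"
    and flow_add: "\<phi> t \<circ> \<phi> s = \<phi> (s + t)"

definition no_fixed_points :: "(real \<Rightarrow> 'a \<Rightarrow> 'a) \<Rightarrow> bool" where
  "no_fixed_points \<phi> \<longleftrightarrow> \<not> (\<exists>x. \<forall>t. \<phi> t x = x)"

definition invariant_measures :: "(real \<Rightarrow> 'a::metric_space \<Rightarrow> 'a) \<Rightarrow> 'a measure set" where
  "invariant_measures \<phi> = {\<mu>. sets \<mu> = sets borel \<and> prob_space \<mu> \<and>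
     (\<forall>B\<in>sets borel. \<forall>t. emeasure \<mu> (\<phi> t ` B) = emeasure \<mu> B)}"


section \<open>Kolmogorov--Sinai entropy\<close>

definition finite_measurable_partition :: "'a measure \<Rightarrow> 'a set set \<Rightarrow> bool" where
  "finite_measurable_partition \<mu> P \<longleftrightarrow> finite P \<and> partition_on (space \<mu>) P \<and> P \<subseteq> sets \<mu>"

definition partition_entropy :: "'a measure \<Rightarrow> 'a set set \<Rightarrow> real" where
  "partition_entropy \<mu> P = (\<Sum>A\<in>P. - measure \<mu> A * ln (measure \<mu> A))"
  \<comment> \<open>\<open>ln 0 = 0\<close>, so null cells contribute \<open>0\<close>\<close>

definition pullback_partition :: "'a measure \<Rightarrow> ('a \<Rightarrow> 'a) \<Rightarrow> 'a set set \<Rightarrow> 'a set set" where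
  "pullback_partition \<mu> T P = (\<lambda>A. T -` A \<inter> space \<mu>) ` P - {{}}"

definition dynamical_join :: "'a measure \<Rightarrow> ('a \<Rightarrow> 'a) \<Rightarrow> nat \<Rightarrow> 'a set set \<Rightarrow> 'a set set" where
  "dynamical_join \<mu> T n P = common_refinement ((\<lambda>i. pullback_partition \<mu> (T ^^ i) P) ` {..<n})"

definition ks_entropy_partition :: "'a measure \<Rightarrow> ('a \<Rightarrow> 'a) \<Rightarrow> 'a set set \<Rightarrow> real" where
  "ks_entropy_partition \<mu> T P = lim (\<lambda>n. partition_entropy \<mu> (dynamical_join \<mu> T n P) / real n)"

definition ks_entropy :: "'a measure \<Rightarrow> ('a \<Rightarrow> 'a) \<Rightarrow> ennreal" where
  "ks_entropy \<mu> T =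
     (SUP P\<in>{P. finite_measurable_partition \<mu> P}. ennreal (ks_entropy_partition \<mu> T P))"


section \<open>Reparametrization balls and local entropies\<close>

text \<open>
  Only the restriction of a reparametrization to \<open>I\<close> matters. It need not be increasing.
\<close>

definition Rep :: "real set \<Rightarrow> (real \<Rightarrow> real) set" where
  "Rep I = {\<alpha>. (\<exists>g. homeomorphism I (\<alpha> ` I) \<alpha> g) \<and> \<alpha> 0 = 0}"

definition rep_ball :: "(real \<Rightarrow> 'a::metric_space \<Rightarrow> 'a) \<Rightarrow> 'a \<Rightarrow> real \<Rightarrow> real \<Rightarrow> 'a set" where
  "rep_ball \<phi> x t \<epsilon> = {y. \<exists>\<alpha>\<in>Rep {0..t}. \<forall>s\<in>{0..t}. dist (\<phi> (\<alpha> s) x) (\<phi> s y) < \<epsilon>}"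

text \<open>
  For a probability measure \<open>- ln (measure \<mu> A)\<close> is nonnegative, so the embedding into
  \<^typ>\<open>ennreal\<close> (which truncates negative numbers to \<open>0\<close>) loses nothing.
\<close>

definition neg_log_measure :: "'a measure \<Rightarrow> 'a set \<Rightarrow> ennreal" where
  "neg_log_measure \<mu> A = (if measure \<mu> A = 0 then \<infinity> else ennreal (- ln (measure \<mu> A)))"

definition lower_local_entropy ::
    "'a::metric_space measure \<Rightarrow> (real \<Rightarrow> 'a \<Rightarrow> 'a) \<Rightarrow> 'a \<Rightarrow> ennreal" where
  "lower_local_entropy \<mu> \<phi> x =
     Lim (at_right 0) (\<lambda>\<epsilon>. Liminf at_top (\<lambda>t. neg_log_measure \<mu> (rep_ball \<phi> x t \<epsilon>) / ennreal t))"

definition upper_local_entropy ::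
    "'a::metric_space measure \<Rightarrow> (real \<Rightarrow> 'a \<Rightarrow> 'a) \<Rightarrow> 'a \<Rightarrow> ennreal" where
  "upper_local_entropy \<mu> \<phi> x =
     Lim (at_right 0) (\<lambda>\<epsilon>. Limsup at_top (\<lambda>t. neg_log_measure \<mu> (rep_ball \<phi> x t \<epsilon>) / ennreal t))"

definition lower_flow_entropy :: "'a::metric_space measure \<Rightarrow> (real \<Rightarrow> 'a \<Rightarrow> 'a) \<Rightarrow> ennreal" where
  "lower_flow_entropy \<mu> \<phi> = (\<integral>\<^sup>+ x. lower_local_entropy \<mu> \<phi> x \<partial>\<mu>)"

definition upper_flow_entropy :: "'a::metric_space measure \<Rightarrow> (real \<Rightarrow> 'a \<Rightarrow> 'a) \<Rightarrow> ennreal" where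
  "upper_flow_entropy \<mu> \<phi> = (\<integral>\<^sup>+ x. upper_local_entropy \<mu> \<phi> x \<partial>\<mu>)"

end

theory Submission
  imports Defs
begin

text \<open>
  Write \<open>T = \<phi>\<^sub>1\<close>. Without fixed points there are no arbitrarily short periods, so an orbit that
  \<open>\<epsilon>\<close>-shadows another one up to a reparametrization drifts by at most \<open>\<eta>\<close> per time \<open>S\<close>. Coding the
  drift, a reparametrization ball of length \<open>t\<close> is covered by \<open>exp (\<gamma> * t)\<close> sets of small Bowen
  diameter, for arbitrarily small \<open>\<gamma>\<close>.

  Almost everywhere, the upper rate of Bowen balls is at most the lower rate \<open>h x\<close> of
  reparametrization balls. Where \<open>h \<le> a\<close>, which is a forward invariant set, almost all of a long orbit segment of
  length \<open>n\<close> is packed by blocks whose reparametrization balls have measure at least \<open>exp (- a * l)\<close>,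
  \<open>l\<close> the block length. There are about \<open>exp (a * l)\<close> such blocks up to a small error, hence about
  \<open>exp (a * n)\<close> segments, and the points whose Bowen ball is exponentially lighter than \<open>exp (- a * n)\<close> are
  removed by Borel--Cantelli. The maximal ergodic inequality controls the gaps. As Bowen balls are
  contained in reparametrization balls, all the local rates coincide almost everywhere.

  The integral of the common rate is compared with the entropy of partitions: Fatou's lemma for
  partitions of small diameter gives one inequality, and the Gibbs inequality against a weight on
  names obtained from Bowen balls gives the other one. Neither the Shannon--McMillan--Breiman theorem nor
  ergodicity is involved.
\<close>

section \<open>Flows without fixed points\<close>

text \<open>The obstacle is that a reparametrization ball may contain points whose orbits are far
  apart at equal times, so a lower bound on its measure gives none for a particular Bowen ball
  inside it. Hence the comparison is global: covering numbers bound the measure of the set of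
  centres whose Bowen balls are light. The order of the quantifiers matters. The coding period
  \<open>S\<close> is fixed from \<gamma> before the radius, because the symbols and the time lost
  in one period cost a rate of order \<open>1 / S\<close>, while for any given \<open>S\<close> the
  drift over a period is small once the radius is small. A lower limit supplies good lengths that
  vary from point to point and may come late. This is why orbits are packed with blocks of all
  lengths between two bounds \<open>m\<close> and \<open>M\<close>, and why, for finite
  \<open>M\<close>, a set of small measure has to be discarded and removed afterwards.\<close>

context compact_metric_flow
begin

lemma flow_flow: "\<phi> t (\<phi> s x) = \<phi> (s + t) x"
  using flow_add[of t s] by (metis comp_apply)

text \<open>The flow axioms make \<open>\<phi> 0\<close> idempotent, and an injective idempotent map
  is the identity.\<close>

lemma flow_zero: "\<phi> 0 x = x"
proof -
  obtain g where "homeomorphism UNIV UNIV (\<phi> 0) g"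
    using homeo by blast
  then have "g (\<phi> 0 (\<phi> 0 x)) = \<phi> 0 x" "g (\<phi> 0 x) = x"
    by (auto simp: homeomorphism_def)
  then show ?thesis
    by (simp add: flow_flow)
qed

lemma flow_iterate: "(\<phi> 1 ^^ n) x = \<phi> (real n) x"
  by (induction n) (auto simp: flow_zero flow_flow add.commute)

lemma flow_uniformly_continuous:
  assumes "0 < \<epsilon>"
  obtains \<delta> where "0 < \<delta>"
    "\<And>x y s t. \<bar>s\<bar> \<le> S \<Longrightarrow> \<bar>t\<bar> \<le> S \<Longrightarrow> dist x y < \<delta> \<Longrightarrow> \<bar>s - t\<bar> < \<delta> \<Longrightarrow> dist (\<phi> s x) (\<phi> t y) < \<epsilon>"
proof -
  have "continuous_on (UNIV \<times> {-S..S}) (\<lambda>(x, t). \<phi> t x)"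
    using continuous continuous_on_subset by blast
  moreover have "compact ((UNIV :: 'a set) \<times> {-S..S})"
    by (intro compact_Times compact_space compact_Icc)
  ultimately have "uniformly_continuous_on (UNIV \<times> {-S..S}) (\<lambda>(x, t). \<phi> t x)"
    by (rule compact_uniformly_continuous)
  then obtain d where d: "d > 0"
    "\<And>p q. p \<in> UNIV \<times> {-S..S} \<Longrightarrow> q \<in> UNIV \<times> {-S..S} \<Longrightarrow> dist p q < d \<Longrightarrow>
       dist ((\<lambda>(x, t). \<phi> t x) p) ((\<lambda>(x, t). \<phi> t x) q) < \<epsilon>"
    using assms unfolding uniformly_continuous_on_def by (metis dist_commute)
  show thesis
  proof (rule that[of "d / 2"])
    fix x y :: 'a and s t
    assume *: "\<bar>s\<bar> \<le> S" "\<bar>t\<bar> \<le> S" "dist x y < d / 2" "\<bar>s - t\<bar> < d / 2"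
    have "dist (x, s) (y, t) \<le> dist x y + dist s t"
      unfolding dist_Pair_Pair by (rule sqrt_sum_squares_le_sum) auto
    also have "\<dots> < d"
      using * by (simp add: dist_real_def)
    finally show "dist (\<phi> s x) (\<phi> t y) < \<epsilon>"
      using d(2)[of "(x, s)" "(y, t)"] * by (auto simp: abs_le_iff)
  qed (use d in auto)
qed

text \<open>Moving the base point to \<open>\<phi> t x\<close> leaves only the time
  \<open>s - t\<close>, so the bound is uniform over all times and not just over a compact set of
  them.\<close>

lemma flow_near_identity:
  assumes "0 < \<epsilon>"
  obtains \<eta> where "0 < \<eta>" "\<And>x s t. \<bar>s - t\<bar> \<le> \<eta> \<Longrightarrow> dist (\<phi> s x) (\<phi> t x) < \<epsilon>"
proof -
  obtain \<delta> where \<delta>: "0 < \<delta>"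
    "\<And>x y s t. \<bar>s\<bar> \<le> 1 \<Longrightarrow> \<bar>t\<bar> \<le> 1 \<Longrightarrow> dist x y < \<delta> \<Longrightarrow> \<bar>s - t\<bar> < \<delta> \<Longrightarrow> dist (\<phi> s x) (\<phi> t y) < \<epsilon>"
    using flow_uniformly_continuous[OF assms, of 1] by metis
  show thesis
  proof (rule that[of "min 1 (\<delta> / 2)"])
    fix x :: 'a and s t assume *: "\<bar>s - t\<bar> \<le> min 1 (\<delta> / 2)"
    have "dist (\<phi> (s - t) (\<phi> t x)) (\<phi> 0 (\<phi> t x)) < \<epsilon>"
      using * \<delta>(1) by (intro \<delta>(2)) auto
    then show "dist (\<phi> s x) (\<phi> t x) < \<epsilon>"
      by (simp add: flow_flow flow_zero)
  qed (use \<delta> in auto)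
qed

lemma continuous_on_flow_map: "continuous_on UNIV (\<phi> t)"
proof -
  have "continuous_on UNIV ((\<lambda>(x, t). \<phi> t x) \<circ> (\<lambda>x. (x, t)))"
    by (intro continuous_on_compose continuous_intros continuous_on_subset[OF continuous]) auto
  then show ?thesis
    by (simp add: comp_def)
qed

lemma continuous_on_orbit: "continuous_on UNIV (\<lambda>t. \<phi> t x)"
proof -
  have "continuous_on UNIV ((\<lambda>(x, t). \<phi> t x) \<circ> (\<lambda>t. (x, t)))"
    by (intro continuous_on_compose continuous_intros continuous_on_subset[OF continuous]) auto
  then show ?thesis
    by (simp add: comp_def)
qed

end

locale fixed_point_free_flow = compact_metric_flow +
  assumes no_fixed: "no_fixed_points \<phi>"
begin

lemma periodic_multiple:
  assumes "\<phi> p x = x"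
  shows "\<phi> (real n * p) x = x"
proof (induction n)
  case (Suc n)
  have "\<phi> (real (Suc n) * p) x = \<phi> (real n * p) (\<phi> p x)"
    by (simp add: flow_flow algebra_simps)
  then show ?case
    using assms Suc by simp
qed (simp add: flow_zero)

text \<open>Arbitrarily short periods would accumulate at a fixed point.\<close>

lemma no_short_periods:
  obtains p where "0 < p" "\<And>q x. 0 < q \<Longrightarrow> q < p \<Longrightarrow> \<phi> q x \<noteq> x"
proof (rule ccontr)
  assume "\<not> thesis"
  with that have "\<exists>q x. 0 < q \<and> q < 1 / real (Suc n) \<and> \<phi> q x = x" for n
    by (metis of_nat_0_less_iff zero_less_Suc zero_less_divide_1_iff)
  then obtain q x where qx: "\<And>n. 0 < q n" "\<And>n. q n < 1 / real (Suc n)" "\<And>n. \<phi> (q n) (x n) = x n"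
    by metis
  obtain l r where r: "strict_mono r" "(x \<circ> r) \<longlonglongrightarrow> l"
    using compact_space unfolding compact_def by (metis UNIV_I)
  have q0: "(q \<circ> r) \<longlonglongrightarrow> 0"
  proof (rule real_tendsto_sandwich[OF _ _ tendsto_const])
    show "(\<lambda>n. 1 / real (Suc (r n))) \<longlonglongrightarrow> 0"
      using LIMSEQ_subseq_LIMSEQ[OF LIMSEQ_inverse_real_of_nat r(1)] by (simp add: comp_def inverse_eq_divide)
  qed (use less_imp_le[OF qx(1)] less_imp_le[OF qx(2)] in auto)
  have pos: "\<phi> t l = l" if t: "0 \<le> t" for t
  proof -
    \<comment> \<open>\<open>k n\<close> whole periods fit into \<open>t\<close>. The remainder
      \<open>u n\<close> is at most one period, hence tends to \<open>0\<close>, and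
      \<open>\<phi> t\<close> acts on \<open>x (r n)\<close> as \<open>\<phi> (u n)\<close>.\<close>
    define k where "k n = nat \<lfloor>t / q (r n)\<rfloor>" for n
    define u where "u n = t - real (k n) * q (r n)" for n
    have k: "real (k n) \<le> t / q (r n)" "t / q (r n) < real (k n) + 1" for n
    proof -
      have "0 \<le> t / q (r n)"
        using t qx(1)[of "r n"] by simp
      then show "real (k n) \<le> t / q (r n)" "t / q (r n) < real (k n) + 1"
        unfolding k_def by (auto simp: le_nat_floor)
    qed
    have u: "0 \<le> u n" "u n \<le> q (r n)" for n
      using k[of n] qx(1)[of "r n"] by (auto simp: u_def field_simps)
    have "u \<longlonglongrightarrow> 0"
      using q0 u by (intro real_tendsto_sandwich[of "\<lambda>_. 0" u _ "q \<circ> r"]) auto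
    then have "(\<lambda>n. ((x \<circ> r) n, u n)) \<longlonglongrightarrow> (l, 0)"
      by (intro tendsto_Pair r)
    then have "(\<lambda>n. (\<lambda>(x, t). \<phi> t x) ((x \<circ> r) n, u n)) \<longlonglongrightarrow> (\<lambda>(x, t). \<phi> t x) (l, 0)"
      using continuous by (intro isCont_tendsto_compose[of _ "\<lambda>(x, t). \<phi> t x"]) (auto simp: continuous_on_eq_continuous_at)
    then have 1: "(\<lambda>n. \<phi> (u n) (x (r n))) \<longlonglongrightarrow> l"
      by (simp add: flow_zero)
    have "\<phi> t (x (r n)) = \<phi> (u n) (x (r n))" for n
    proof -
      have "\<phi> t (x (r n)) = \<phi> (u n) (\<phi> (real (k n) * q (r n)) (x (r n)))"
        by (simp add: flow_flow u_def)
      then show ?thesis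
        using periodic_multiple[OF qx(3)] by simp
    qed
    moreover have "(\<lambda>n. \<phi> t ((x \<circ> r) n)) \<longlonglongrightarrow> \<phi> t l"
      using continuous_on_flow_map[of t] r(2)
      by (intro isCont_tendsto_compose[of _ "\<phi> t"]) (auto simp: continuous_on_eq_continuous_at comp_def)
    ultimately show ?thesis
      using 1 LIMSEQ_unique by (metis (no_types, lifting) comp_apply ext)
  qed
  have "\<phi> t l = l" for t
  proof (cases "0 \<le> t")
    case False
    then have "\<phi> (-t) l = l" by (intro pos) simp
    then have "\<phi> t l = \<phi> t (\<phi> (-t) l)" by simp
    then show ?thesis by (simp add: flow_flow flow_zero)
  qed (rule pos)
  then show False
    using no_fixed unfolding no_fixed_points_def by blast
qed

lemma displacement_bound:
  assumes "\<And>x. \<phi> q x \<noteq> x"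
  obtains \<delta> where "0 < \<delta>" "\<And>x. \<delta> \<le> dist (\<phi> q x) x"
proof -
  have "continuous_on UNIV (\<lambda>x. dist (\<phi> q x) x)"
    by (intro continuous_intros continuous_on_flow_map)
  then obtain z where "\<And>x. dist (\<phi> q z) z \<le> dist (\<phi> q x) x"
    using continuous_attains_inf[OF compact_space, of "\<lambda>x. dist (\<phi> q x) x"] by auto
  then show thesis
    using that[of "dist (\<phi> q z) z"] assms by simp
qed

text \<open>
  At the first time the clocks of two close orbits differ by a small \<open>\<eta>\<close>, a point and its image
  under \<open>\<phi>\<^sub>\<eta>\<close> are close, which the absence of short periods excludes.
\<close>

lemma tracking_drift_local:
  assumes "0 < \<eta>"
  obtains \<epsilon> where "0 < \<epsilon>"
    "\<And>x y \<alpha> t s. continuous_on {0..t} \<alpha> \<Longrightarrow> \<alpha> 0 = 0 \<Longrightarrow> t \<le> S \<Longrightarrow>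
       (\<And>s. s \<in> {0..t} \<Longrightarrow> dist (\<phi> (\<alpha> s) x) (\<phi> s y) < \<epsilon>) \<Longrightarrow> s \<in> {0..t} \<Longrightarrow> \<bar>\<alpha> s - s\<bar> < \<eta>"
proof -
  obtain p where p: "0 < p" "\<And>q x. 0 < q \<Longrightarrow> q < p \<Longrightarrow> \<phi> q x \<noteq> x"
    using no_short_periods by metis
  \<comment> \<open>\<open>q \<le> \<eta>\<close> lets the clock difference pass through
    \<open>q\<close> on its way to \<eta>; \<open>q < p\<close> keeps the displacement of
    \<open>\<phi> q\<close> bounded away from zero.\<close>
  define q where "q = min \<eta> (p / 2)"
  have q: "0 < q" "q < p" "q \<le> \<eta>"
    using p(1) assms by (auto simp: q_def)
  obtain \<delta> where \<delta>: "0 < \<delta>" "\<And>x. \<delta> \<le> dist (\<phi> q x) x"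
    using displacement_bound p(2)[OF q(1,2)] by metis
  obtain \<delta>' where \<delta>': "0 < \<delta>'"
    "\<And>x y s t. \<bar>s\<bar> \<le> S \<Longrightarrow> \<bar>t\<bar> \<le> S \<Longrightarrow> dist x y < \<delta>' \<Longrightarrow> \<bar>s - t\<bar> < \<delta>' \<Longrightarrow> dist (\<phi> s x) (\<phi> t y) < \<delta> / 2"
    using flow_uniformly_continuous[of "\<delta> / 2" S] \<delta>(1) by (metis half_gt_zero)
  show thesis
  proof (rule that[of "min \<delta>' (\<delta> / 2)"])
    fix x y :: 'a and \<alpha> t s
    assume cont: "continuous_on {0..t} \<alpha>" and \<alpha>0: "\<alpha> 0 = 0" and t: "t \<le> S" and s: "s \<in> {0..t}"
      and tr: "\<And>s. s \<in> {0..t} \<Longrightarrow> dist (\<phi> (\<alpha> s) x) (\<phi> s y) < min \<delta>' (\<delta> / 2)"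
    have xy: "dist x y < \<delta>'"
      using tr[of 0] s by (simp add: \<alpha>0 flow_zero)
    show "\<bar>\<alpha> s - s\<bar> < \<eta>"
    proof (rule ccontr)
      assume "\<not> \<bar>\<alpha> s - s\<bar> < \<eta>"
      then have "q \<le> \<bar>\<alpha> s - s\<bar>"
        using q by simp
      moreover have "continuous_on {0..s} (\<lambda>s. \<bar>\<alpha> s - s\<bar>)"
        using s by (intro continuous_intros continuous_on_subset[OF cont]) auto
      ultimately obtain r where r: "0 \<le> r" "r \<le> s" "\<bar>\<alpha> r - r\<bar> = q"
        using IVT'[of "\<lambda>s. \<bar>\<alpha> s - s\<bar>" 0 q s] s q(1) \<alpha>0 by auto
      have "dist (\<phi> (\<alpha> r) x) (\<phi> r y) < \<delta> / 2"
        using tr[of r] r s by auto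
      \<comment> \<open>Without time change, \<open>x\<close> and \<open>y\<close> stay close up to
        time \<open>S\<close>. Hence \<open>\<phi> (\<alpha> r) x\<close> and
        \<open>\<phi> r x\<close>, whose times differ by exactly \<open>q\<close>, come closer than
        a displacement by \<open>q\<close> allows.\<close>
      moreover have "dist (\<phi> r x) (\<phi> r y) < \<delta> / 2"
        using xy r s t \<delta>'(1) by (intro \<delta>') auto
      ultimately have near: "dist (\<phi> (\<alpha> r) x) (\<phi> r x) < \<delta>"
        using dist_triangle2[of "\<phi> (\<alpha> r) x" "\<phi> r x" "\<phi> r y"] by simp
      consider "\<alpha> r = r + q" | "r = \<alpha> r + q"
        using r(3) q(1) by linarith
      then show False
      proof cases
        case 1
        then have "\<phi> (\<alpha> r) x = \<phi> q (\<phi> r x)"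
          by (simp add: flow_flow)
        then show False
          using near \<delta>(2)[of "\<phi> r x"] by simp
      next
        case 2
        then have "\<phi> r x = \<phi> q (\<phi> (\<alpha> r) x)"
          by (metis flow_flow)
        then show False
          using near \<delta>(2)[of "\<phi> (\<alpha> r) x"] by (simp add: dist_commute)
      qed
    qed
  qed (use \<delta> \<delta>' in auto)
qed

text \<open>Applied along a shifted orbit, the local estimate controls a tracking of any length.\<close>

lemma tracking_drift:
  assumes "0 < \<eta>"
  shows "\<exists>\<epsilon>>0. \<forall>x y \<alpha> t r s. continuous_on {0..t} \<alpha> \<longrightarrow> \<alpha> 0 = 0 \<longrightarrow>
    (\<forall>s\<in>{0..t}. dist (\<phi> (\<alpha> s) x) (\<phi> s y) < \<epsilon>) \<longrightarrow>
    0 \<le> r \<longrightarrow> r \<le> s \<longrightarrow> s \<le> t \<longrightarrow> s \<le> r + S \<longrightarrow> \<bar>(\<alpha> s - \<alpha> r) - (s - r)\<bar> < \<eta>"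
proof -
  obtain \<epsilon> where \<epsilon>: "0 < \<epsilon>"
    "\<And>x y \<alpha> t s. continuous_on {0..t} \<alpha> \<Longrightarrow> \<alpha> 0 = 0 \<Longrightarrow> t \<le> S \<Longrightarrow>
       (\<And>s. s \<in> {0..t} \<Longrightarrow> dist (\<phi> (\<alpha> s) x) (\<phi> s y) < \<epsilon>) \<Longrightarrow> s \<in> {0..t} \<Longrightarrow> \<bar>\<alpha> s - s\<bar> < \<eta>"
    using tracking_drift_local[OF assms, of S] by blast
  show ?thesis
  proof (intro exI[of _ \<epsilon>] conjI allI impI \<epsilon>(1))
    fix x y :: 'a and \<alpha> t r s
    assume cont: "continuous_on {0..t} \<alpha>" and "\<alpha> 0 = 0" and rs: "0 \<le> r" "r \<le> s" "s \<le> t" "s \<le> r + S"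
      and tr: "\<forall>s\<in>{0..t}. dist (\<phi> (\<alpha> s) x) (\<phi> s y) < \<epsilon>"
    define \<beta> where "\<beta> u = \<alpha> (r + u) - \<alpha> r" for u
    have "\<bar>\<beta> (s - r) - (s - r)\<bar> < \<eta>"
    proof (rule \<epsilon>(2))
      show "continuous_on {0..s - r} \<beta>"
        unfolding \<beta>_def using rs by (intro continuous_intros continuous_on_compose2[OF cont]) auto
      show "dist (\<phi> (\<beta> u) (\<phi> (\<alpha> r) x)) (\<phi> u (\<phi> r y)) < \<epsilon>" if "u \<in> {0..s - r}" for u
        using tr[rule_format, of "r + u"] that rs by (simp add: flow_flow \<beta>_def)
    qed (use rs in \<open>auto simp: \<beta>_def\<close>)
    then show "\<bar>(\<alpha> s - \<alpha> r) - (s - r)\<bar> < \<eta>"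
      by (simp add: \<beta>_def)
  qed
qed

end

section \<open>Covering orbit segments\<close>

definition bowen_ball :: "('a::metric_space \<Rightarrow> 'a) \<Rightarrow> 'a \<Rightarrow> nat \<Rightarrow> real \<Rightarrow> 'a set" where
  "bowen_ball T x n \<epsilon> = {y. \<forall>i<n. dist ((T ^^ i) x) ((T ^^ i) y) < \<epsilon>}"

text \<open>Small Bowen diameter is asked for instead of Bowen balls: such a set lies in the
  \<epsilon>-Bowen ball about each of its points, so a centre can be chosen later
  (\<open>light_centres\<close>), and the property survives the intersections in
  \<open>coverable_concat\<close>.\<close>

definition coverable :: "('a::metric_space \<Rightarrow> 'a) \<Rightarrow> 'a set \<Rightarrow> nat \<Rightarrow> real \<Rightarrow> real \<Rightarrow> bool" where
  "coverable T Y n \<epsilon> c \<longleftrightarrow> (\<exists>\<C>. finite \<C> \<and> real (card \<C>) \<le> c \<and> Y \<subseteq> \<Union>\<C> \<and>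
     (\<forall>F\<in>\<C>. \<forall>y\<in>F. \<forall>y'\<in>F. \<forall>i<n. dist ((T ^^ i) y) ((T ^^ i) y') < \<epsilon>))"

lemma coverableI:
  assumes "finite \<C>" "real (card \<C>) \<le> c" "Y \<subseteq> \<Union>\<C>"
    "\<And>F y y' i. F \<in> \<C> \<Longrightarrow> y \<in> F \<Longrightarrow> y' \<in> F \<Longrightarrow> i < n \<Longrightarrow> dist ((T ^^ i) y) ((T ^^ i) y') < \<epsilon>"
  shows "coverable T Y n \<epsilon> c"
  unfolding coverable_def by (intro exI[of _ \<C>] conjI ballI allI impI assms)

lemma coverable_mono:
  assumes "coverable T Y n \<epsilon> c" "Z \<subseteq> Y" "m \<le> n" "c \<le> d"
  shows "coverable T Z m \<epsilon> d"
proof -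
  obtain \<C> where "finite \<C>" "real (card \<C>) \<le> c" "Y \<subseteq> \<Union>\<C>"
    "\<forall>F\<in>\<C>. \<forall>y\<in>F. \<forall>y'\<in>F. \<forall>i<n. dist ((T ^^ i) y) ((T ^^ i) y') < \<epsilon>"
    using assms(1) unfolding coverable_def by auto
  then show ?thesis
    using assms(2-4) order_trans[of "real (card \<C>)" c d] by (intro coverableI[of \<C>]) auto
qed

lemma coverable_UN:
  assumes "finite I" "\<And>i. i \<in> I \<Longrightarrow> coverable T (Y i) n \<epsilon> (c i)"
  shows "coverable T (\<Union>i\<in>I. Y i) n \<epsilon> (\<Sum>i\<in>I. c i)"
proof -
  have "\<forall>i\<in>I. \<exists>\<C>. finite \<C> \<and> real (card \<C>) \<le> c i \<and> Y i \<subseteq> \<Union>\<C> \<and>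
     (\<forall>F\<in>\<C>. \<forall>y\<in>F. \<forall>y'\<in>F. \<forall>i<n. dist ((T ^^ i) y) ((T ^^ i) y') < \<epsilon>)"
    using assms(2) unfolding coverable_def by blast
  then obtain \<C> where "\<forall>i\<in>I. finite (\<C> i) \<and> real (card (\<C> i)) \<le> c i \<and> Y i \<subseteq> \<Union>(\<C> i) \<and>
     (\<forall>F\<in>\<C> i. \<forall>y\<in>F. \<forall>y'\<in>F. \<forall>k<n. dist ((T ^^ k) y) ((T ^^ k) y') < \<epsilon>)"
    by (rule bchoice[THEN exE])
  then have \<C>: "\<And>i. i \<in> I \<Longrightarrow> finite (\<C> i)" "\<And>i. i \<in> I \<Longrightarrow> real (card (\<C> i)) \<le> c i"
    "\<And>i. i \<in> I \<Longrightarrow> Y i \<subseteq> \<Union>(\<C> i)"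
    "\<And>i. i \<in> I \<Longrightarrow> \<forall>F\<in>\<C> i. \<forall>y\<in>F. \<forall>y'\<in>F. \<forall>k<n. dist ((T ^^ k) y) ((T ^^ k) y') < \<epsilon>"
    by simp_all
  have "real (card (\<Union>i\<in>I. \<C> i)) \<le> (\<Sum>i\<in>I. real (card (\<C> i)))"
    using card_UN_le[OF assms(1), of \<C>] by (metis of_nat_mono of_nat_sum)
  also have "\<dots> \<le> (\<Sum>i\<in>I. c i)"
    using \<C> by (intro sum_mono)
  finally have "real (card (\<Union>i\<in>I. \<C> i)) \<le> (\<Sum>i\<in>I. c i)" .
  then show ?thesis
  proof (rule coverableI[rotated])
    show "(\<Union>i\<in>I. Y i) \<subseteq> \<Union>(\<Union>i\<in>I. \<C> i)"
      using \<C>(3) by blast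
    fix F y y' k assume "F \<in> (\<Union>i\<in>I. \<C> i)" "y \<in> F" "y' \<in> F" "k < n"
    then show "dist ((T ^^ k) y) ((T ^^ k) y') < \<epsilon>"
      using \<C>(4) by blast
  qed (use \<C>(1) assms(1) in auto)
qed

lemma coverable_Un:
  assumes "coverable T Y n \<epsilon> c" "coverable T Z n \<epsilon> d"
  shows "coverable T (Y \<union> Z) n \<epsilon> (c + d)"
  using coverable_UN[of UNIV T "\<lambda>b. if b then Y else Z" n \<epsilon> "\<lambda>b. if b then c else d"] assms
  by (auto simp: UNIV_bool Un_commute add.commute)

text \<open>A piece of the first cover controls the times below \<open>l\<close>, the preimage of a
  piece of the second one the times from \<open>l\<close> on; their intersections number at most the
  product.\<close>

lemma coverable_concat:
  assumes "coverable T Y l \<epsilon> c" "coverable T Z n \<epsilon> d"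
  shows "coverable T (Y \<inter> (T ^^ l) -` Z) (l + n) \<epsilon> (c * d)"
proof -
  obtain \<C> where \<C>: "finite \<C>" "real (card \<C>) \<le> c" "Y \<subseteq> \<Union>\<C>"
    "\<forall>F\<in>\<C>. \<forall>y\<in>F. \<forall>y'\<in>F. \<forall>i<l. dist ((T ^^ i) y) ((T ^^ i) y') < \<epsilon>"
    using assms(1) unfolding coverable_def by auto
  obtain \<D> where \<D>: "finite \<D>" "real (card \<D>) \<le> d" "Z \<subseteq> \<Union>\<D>"
    "\<forall>F\<in>\<D>. \<forall>y\<in>F. \<forall>y'\<in>F. \<forall>i<n. dist ((T ^^ i) y) ((T ^^ i) y') < \<epsilon>"
    using assms(2) unfolding coverable_def by auto
  let ?h = "\<lambda>(F, G). F \<inter> (T ^^ l) -` G"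
  show ?thesis
  proof (rule coverableI)
    show "finite (?h ` (\<C> \<times> \<D>))"
      using \<C> \<D> by simp
    have "real (card (?h ` (\<C> \<times> \<D>))) \<le> real (card (\<C> \<times> \<D>))"
      using card_image_le[of "\<C> \<times> \<D>" ?h] \<C>(1) \<D>(1) by (simp only: of_nat_le_iff finite_cartesian_product)
    also have "\<dots> \<le> c * d"
      using \<C>(2) \<D>(2) by (simp add: card_cartesian_product mult_mono')
    finally show "real (card (?h ` (\<C> \<times> \<D>))) \<le> c * d" .
    show "Y \<inter> (T ^^ l) -` Z \<subseteq> \<Union>(?h ` (\<C> \<times> \<D>))"
      using \<C>(3) \<D>(3) by blast
    fix H y y' i assume "H \<in> ?h ` (\<C> \<times> \<D>)" and y: "y \<in> H" "y' \<in> H" and i: "i < l + n"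
    then obtain F G where FG: "F \<in> \<C>" "G \<in> \<D>" "H = F \<inter> (T ^^ l) -` G"
      by auto
    show "dist ((T ^^ i) y) ((T ^^ i) y') < \<epsilon>"
    proof (cases "i < l")
      case True
      then show ?thesis
        using \<C>(4) FG y by blast
    next
      case False
      then have "(T ^^ i) x = (T ^^ (i - l)) ((T ^^ l) x)" for x
        by (metis add_diff_inverse_nat add.commute comp_apply funpow_add)
      then show ?thesis
        using \<D>(4) FG y i False by auto
    qed
  qed
qed

lemma coverable_0: "coverable T Y 0 \<epsilon> 1"
  by (rule coverableI[of "{UNIV}"]) auto

lemma coverable_power:
  assumes "coverable T UNIV 1 \<epsilon> C"
  shows "coverable T UNIV n \<epsilon> (C ^ n)"
proof (induction n)
  case (Suc n)
  show ?case
    using coverable_concat[OF assms Suc] by simp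
qed (simp add: coverable_0)

text \<open>The fibres of the code \<open>K\<close> form the cover, so counting codes bounds
  covering numbers.\<close>

lemma coverable_code:
  assumes "finite D" "\<And>x. x \<in> Y \<Longrightarrow> K x \<in> D"
    "\<And>x y i. x \<in> Y \<Longrightarrow> y \<in> Y \<Longrightarrow> K x = K y \<Longrightarrow> i < n \<Longrightarrow> dist ((T ^^ i) x) ((T ^^ i) y) < \<epsilon>"
  shows "coverable T Y n \<epsilon> (real (card D))"
proof (rule coverableI[of "(\<lambda>d. {x \<in> Y. K x = d}) ` D"])
  show "real (card ((\<lambda>d. {x \<in> Y. K x = d}) ` D)) \<le> real (card D)"
    using card_image_le[OF assms(1)] by simp
qed (use assms in auto)

lemma coverable_compact:
  fixes T :: "'a::metric_space \<Rightarrow> 'a"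
  assumes "compact (UNIV :: 'a set)" "0 < \<epsilon>"
  obtains C where "1 \<le> C" "coverable T UNIV 1 \<epsilon> C"
proof -
  obtain K where K: "finite K" "(UNIV :: 'a set) \<subseteq> (\<Union>x\<in>K. ball x (\<epsilon> / 2))"
  proof (rule compactE_image[OF assms(1), of UNIV "\<lambda>x. ball x (\<epsilon> / 2)"])
    show "(UNIV :: 'a set) \<subseteq> (\<Union>x\<in>UNIV. ball x (\<epsilon> / 2))"
      using assms(2) by (auto intro!: exI[of _ x for x] simp: UN_iff)
  qed auto
  show thesis
  proof (rule that[of "max 1 (real (card ((\<lambda>x. ball x (\<epsilon> / 2)) ` K)))"])
    show "coverable T UNIV 1 \<epsilon> (max 1 (real (card ((\<lambda>x. ball x (\<epsilon> / 2)) ` K))))"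
    proof (rule coverableI)
      fix F y y' i assume "F \<in> (\<lambda>x. ball x (\<epsilon> / 2)) ` K" "y \<in> F" "y' \<in> F" "i < (1::nat)"
      then show "dist ((T ^^ i) y) ((T ^^ i) y') < \<epsilon>"
        by (auto intro: dist_triangle_half_r)
    qed (use K in auto)
  qed simp
qed

section \<open>Coding of time changes with small drift\<close>

text \<open>The conclusion of \<open>tracking_drift\<close> as a property of the clock alone, with
  natural numbers for the period and the length so that periods can be counted.\<close>

definition drift_bounded :: "real \<Rightarrow> nat \<Rightarrow> nat \<Rightarrow> (real \<Rightarrow> real) \<Rightarrow> bool" where
  "drift_bounded \<eta> S l \<alpha> \<longleftrightarrow> \<alpha> 0 = 0 \<and>
     (\<forall>r s. 0 \<le> r \<longrightarrow> r \<le> s \<longrightarrow> s \<le> real l \<longrightarrow> s \<le> r + real S \<longrightarrow> \<bar>(\<alpha> s - \<alpha> r) - (s - r)\<bar> < \<eta>)"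

lemma drift_boundedD:
  assumes "drift_bounded \<eta> S l \<alpha>" "0 \<le> r" "r \<le> s" "s \<le> real l" "s \<le> r + real S"
  shows "\<bar>(\<alpha> s - \<alpha> r) - (s - r)\<bar> < \<eta>"
  using assms by (auto simp: drift_bounded_def)

lemma drift_bounded_total:
  assumes "drift_bounded \<eta> S l \<alpha>" "j * S \<le> l"
  shows "\<bar>\<alpha> (real (j * S)) - real (j * S)\<bar> \<le> real j * \<eta>"
  using assms(2)
proof (induction j)
  case 0
  then show ?case using assms by (simp add: drift_bounded_def)
next
  case (Suc j)
  have "\<bar>(\<alpha> (real (Suc j * S)) - \<alpha> (real (j * S))) - (real (Suc j * S) - real (j * S))\<bar> < \<eta>"
    using Suc.prems by (intro drift_boundedD[OF assms(1)]) (auto simp del: of_nat_mult of_nat_add)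
  moreover have "\<bar>\<alpha> (real (j * S)) - real (j * S)\<bar> \<le> real j * \<eta>"
    using Suc by simp
  ultimately have "\<bar>\<alpha> (real (Suc j * S)) - real (Suc j * S)\<bar> \<le> real j * \<eta> + \<eta>"
    by linarith
  then show ?case
    by (simp add: algebra_simps)
qed

text \<open>
  The code lists the increments, between consecutive multiples of \<open>S\<close>, of the displacement
  \<open>\<alpha> s - s\<close> rounded to multiples of \<open>\<eta>\<close>; they lie in \<open>{-1, 0, 1}\<close>.
\<close>

lemma drift_code:
  assumes "0 < \<eta>" "0 < S"
  shows "\<exists>(code :: (real \<Rightarrow> real) \<Rightarrow> nat \<Rightarrow> int) D. finite D \<and> card D = 3 ^ (l div S) \<and>
    (\<forall>\<alpha>. drift_bounded \<eta> S l \<alpha> \<longrightarrow> code \<alpha> \<in> D) \<and>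
    (\<forall>\<alpha> \<beta> s. drift_bounded \<eta> S l \<alpha> \<longrightarrow> drift_bounded \<eta> S l \<beta> \<longrightarrow> code \<alpha> = code \<beta> \<longrightarrow>
       0 \<le> s \<longrightarrow> s \<le> real l \<longrightarrow> \<bar>\<alpha> s - \<beta> s\<bar> < 3 * \<eta>)"
proof -
  define m where "m = l div S"
  define K where "K \<alpha> j = \<lfloor>(\<alpha> (real (j * S)) - real (j * S)) / \<eta>\<rfloor>" for \<alpha> and j :: nat
  define code where "code \<alpha> = (\<lambda>j\<in>{..<m}. K \<alpha> (Suc j) - K \<alpha> j)" for \<alpha>
  define D where "D = (PiE {..<m} (\<lambda>_. {-1, 0, 1 :: int}))"
  have mS: "j * S \<le> l" if "j \<le> m" for j
    using that unfolding m_def by (metis div_times_less_eq_dividend mult_le_mono1 order_trans)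
  show ?thesis
  proof (intro exI[of _ code] exI[of _ D] conjI allI impI)
    show "finite D"
      by (auto simp: D_def intro!: finite_PiE)
    show "card D = 3 ^ (l div S)"
      by (simp add: D_def card_PiE m_def eval_nat_numeral)
    show "code \<alpha> \<in> D" if \<alpha>: "drift_bounded \<eta> S l \<alpha>" for \<alpha>
    proof -
      have "\<bar>K \<alpha> (Suc j) - K \<alpha> j\<bar> \<le> 1" if "j < m" for j
      proof -
        define u where "u = (\<alpha> (real (Suc j * S)) - real (Suc j * S)) / \<eta>"
        define v where "v = (\<alpha> (real (j * S)) - real (j * S)) / \<eta>"
        have "\<bar>(\<alpha> (real (Suc j * S)) - \<alpha> (real (j * S))) - (real (Suc j * S) - real (j * S))\<bar> < \<eta>"
          using mS[of "Suc j"] that by (intro drift_boundedD[OF \<alpha>]) (auto simp del: of_nat_mult of_nat_add)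
        moreover have "(u - v) * \<eta> = (\<alpha> (real (Suc j * S)) - \<alpha> (real (j * S))) - (real (Suc j * S) - real (j * S))"
          using assms(1) by (simp add: u_def v_def field_simps)
        ultimately have "\<bar>(u - v) * \<eta>\<bar> < \<eta>"
          by simp
        then have "\<bar>u - v\<bar> < 1"
          using assms(1) by (simp add: abs_mult)
        then have "\<bar>\<lfloor>u\<rfloor> - \<lfloor>v\<rfloor>\<bar> \<le> 1"
          by linarith
        then show ?thesis
          by (simp only: K_def u_def v_def)
      qed
      then show ?thesis
        by (force simp: code_def D_def abs_le_iff)
    qed
    fix \<alpha> \<beta> s
    assume \<alpha>: "drift_bounded \<eta> S l \<alpha>" and \<beta>: "drift_bounded \<eta> S l \<beta>" and eq: "code \<alpha> = code \<beta>"
      and s: "0 \<le> s" "s \<le> real l"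
    \<comment> \<open>Both displacements start at \<open>0\<close>, so equal increments give equal
      rounded displacements at every multiple of \<open>S\<close>.\<close>
    have K: "K \<alpha> j = K \<beta> j" if "j \<le> m" for j
      using that
    proof (induction j)
      case 0
      then show ?case using \<alpha> \<beta> by (simp add: K_def drift_bounded_def)
    next
      case (Suc j)
      then have "code \<alpha> j = K \<alpha> (Suc j) - K \<alpha> j" "code \<beta> j = K \<beta> (Suc j) - K \<beta> j"
        by (auto simp: code_def)
      then show ?case
        using Suc eq by simp
    qed
    define j where "j = nat \<lfloor>s / real S\<rfloor>"
    have j: "real (j * S) \<le> s" "s \<le> real (j * S) + real S"
    proof -
      have "real j \<le> s / real S" "s / real S \<le> real j + 1"
        using s assms of_nat_floor[of "s / real S"] unfolding j_def by auto
      then show "real (j * S) \<le> s" "s \<le> real (j * S) + real S"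
        using assms by (auto simp: field_simps)
    qed
    have "real (j * S) \<le> real l"
      using j s by linarith
    then have "j * S \<le> l"
      by (metis of_nat_le_iff)
    then have "j \<le> m"
      using assms unfolding m_def by (simp add: less_eq_div_iff_mult_less_eq)
    then have "\<lfloor>(\<alpha> (real (j * S)) - real (j * S)) / \<eta>\<rfloor> = \<lfloor>(\<beta> (real (j * S)) - real (j * S)) / \<eta>\<rfloor>"
      using K by (simp add: K_def)
    then have "\<bar>(\<alpha> (real (j * S)) - real (j * S)) / \<eta> - (\<beta> (real (j * S)) - real (j * S)) / \<eta>\<bar> < 1"
      by linarith
    moreover have "(\<alpha> (real (j * S)) - real (j * S)) / \<eta> - (\<beta> (real (j * S)) - real (j * S)) / \<eta> =
        (\<alpha> (real (j * S)) - \<beta> (real (j * S))) / \<eta>"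
      by (simp add: diff_divide_distrib)
    ultimately have "\<bar>\<alpha> (real (j * S)) - \<beta> (real (j * S))\<bar> < \<eta>"
      using assms(1) by (simp add: abs_divide)
    moreover have "\<bar>(\<alpha> s - \<alpha> (real (j * S))) - (s - real (j * S))\<bar> < \<eta>"
      using j s by (intro drift_boundedD[OF \<alpha>]) auto
    moreover have "\<bar>(\<beta> s - \<beta> (real (j * S))) - (s - real (j * S))\<bar> < \<eta>"
      using j s by (intro drift_boundedD[OF \<beta>]) auto
    \<comment> \<open>One \<eta> comes from the rounding at \<open>j * S\<close>, the other two from
      the drift of each clock since then.\<close>
    ultimately show "\<bar>\<alpha> s - \<beta> s\<bar> < 3 * \<eta>"
      by linarith
  qed
qed

text \<open>A continuous injection on a compact set has a continuous inverse on its image.\<close>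

lemma Rep_Icc:
  fixes t :: real
  shows "\<alpha> \<in> Rep {0..t} \<longleftrightarrow> continuous_on {0..t} \<alpha> \<and> inj_on \<alpha> {0..t} \<and> \<alpha> 0 = 0"
proof -
  have "(\<exists>g. homeomorphism {0..t} (\<alpha> ` {0..t}) \<alpha> g) \<longleftrightarrow> continuous_on {0..t} \<alpha> \<and> inj_on \<alpha> {0..t}"
    using homeomorphism_compact[of "{0..t}" \<alpha> "\<alpha> ` {0..t}"]
    by (auto simp: homeomorphism_def intro: inj_on_inverseI)
  then show ?thesis
    by (auto simp: Rep_def)
qed

lemma rep_ball_mono:
  assumes "t' \<le> t" "\<epsilon> \<le> \<epsilon>'"
  shows "rep_ball \<phi> x t \<epsilon> \<subseteq> rep_ball \<phi> x t' \<epsilon>'"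
proof
  fix y assume "y \<in> rep_ball \<phi> x t \<epsilon>"
  then obtain \<alpha> where \<alpha>: "\<alpha> \<in> Rep {0..t}" "\<forall>s\<in>{0..t}. dist (\<phi> (\<alpha> s) x) (\<phi> s y) < \<epsilon>"
    by (auto simp: rep_ball_def)
  have "\<alpha> \<in> Rep {0..t'}"
    using \<alpha>(1) assms(1) unfolding Rep_Icc
    by (meson atLeastatMost_subset_iff continuous_on_subset inj_on_subset order_refl)
  then show "y \<in> rep_ball \<phi> x t' \<epsilon>'"
    using \<alpha>(2) assms by (force simp: rep_ball_def)
qed

context fixed_point_free_flow
begin

text \<open>
  The common point \<open>w\<close> of the two balls drives both orbits with its own clock, so the centre \<open>x\<close>
  is determined, up to a small error, by \<open>z\<close> and the codes of the two time changes. The time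
  lost to drift at the end of the block is covered separately.
\<close>

lemma rep_ball_overlap_coverable:
  assumes "0 < \<epsilon>'" "0 < \<gamma>"
  obtains \<epsilon> l0 where "0 < \<epsilon>" "\<And>l z. l0 \<le> l \<Longrightarrow>
    coverable (\<phi> 1) {x. rep_ball \<phi> x (real l) \<epsilon> \<inter> rep_ball \<phi> z (real l) \<epsilon> \<noteq> {}} l \<epsilon>' (exp (\<gamma> * real l))"
proof -
  obtain C where C: "1 \<le> C" "coverable (\<phi> 1) UNIV 1 \<epsilon>' C"
    using coverable_compact[OF compact_space assms(1)] by metis
  \<comment> \<open>Per period the cover pays \<open>3 * 3\<close> for the two codes and
    \<open>C\<close> for one lost time unit. With this \<open>S\<close> the cost of all
    \<open>l div S\<close> periods is at most \<open>exp (\<gamma> * l / 2)\<close>; the other half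
    of the exponent is left for one further factor \<open>C\<close>, which \<open>l0\<close> takes
    care of.\<close>
  obtain S :: nat where S: "max 2 (2 * ln (9 * C) / \<gamma>) \<le> real S"
    using real_arch_simple by blast
  have "0 < S"
    using S by (intro Nat.gr0I) auto
  obtain \<eta>0 where \<eta>0: "0 < \<eta>0" "\<And>x s t. \<bar>s - t\<bar> \<le> \<eta>0 \<Longrightarrow> dist (\<phi> s x) (\<phi> t x) < \<epsilon>' / 8"
    using flow_near_identity[of "\<epsilon>' / 8"] assms(1) by auto
  \<comment> \<open>The bound \<open>1\<close> limits the lost time to one unit per period; the
    bound \<open>\<eta>0 / 3\<close> fits the accuracy \<open>3 * \<eta>\<close> of
    \<open>drift_code\<close>.\<close>
  define \<eta> where "\<eta> = min 1 (\<eta>0 / 3)"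
  have \<eta>: "0 < \<eta>" "\<eta> \<le> 1" "3 * \<eta> \<le> \<eta>0"
    using \<eta>0(1) by (auto simp: \<eta>_def)
  obtain \<epsilon>1 where "0 < \<epsilon>1" "\<forall>x y \<alpha> t r s. continuous_on {0..t} \<alpha> \<longrightarrow> \<alpha> 0 = 0 \<longrightarrow>
      (\<forall>s\<in>{0..t}. dist (\<phi> (\<alpha> s) x) (\<phi> s y) < \<epsilon>1) \<longrightarrow>
      0 \<le> r \<longrightarrow> r \<le> s \<longrightarrow> s \<le> t \<longrightarrow> s \<le> r + real S \<longrightarrow> \<bar>(\<alpha> s - \<alpha> r) - (s - r)\<bar> < \<eta>"
    using tracking_drift[OF \<eta>(1), of "real S"] by (elim exE conjE)
  note \<epsilon>1 = this(1) this(2)[rule_format]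
  define \<epsilon> where "\<epsilon> = min \<epsilon>1 (\<epsilon>' / 8)"
  obtain l0 :: nat where l0: "2 * ln C / \<gamma> \<le> real l0"
    using real_arch_simple by blast
  show thesis
  proof (rule that[of \<epsilon> l0])
    show "0 < \<epsilon>"
      using \<epsilon>1(1) assms(1) by (simp add: \<epsilon>_def)
    fix l :: nat and z :: 'a
    assume l: "l0 \<le> l"
    define m where "m = l div S"
    define V where "V = {x. rep_ball \<phi> x (real l) \<epsilon> \<inter> rep_ball \<phi> z (real l) \<epsilon> \<noteq> {}}"
    have "\<forall>x\<in>V. \<exists>w \<alpha> \<beta>. (continuous_on {0..real l} \<alpha> \<and> drift_bounded \<eta> S l \<alpha>) \<and> drift_bounded \<eta> S l \<beta> \<and>
        (\<forall>s\<in>{0..real l}. dist (\<phi> (\<alpha> s) x) (\<phi> s w) < \<epsilon>' / 8 \<and> dist (\<phi> (\<beta> s) z) (\<phi> s w) < \<epsilon>' / 8)"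
    proof
      fix x assume "x \<in> V"
      then obtain w where w: "w \<in> rep_ball \<phi> x (real l) \<epsilon>" "w \<in> rep_ball \<phi> z (real l) \<epsilon>"
        by (auto simp: V_def)
      obtain \<alpha> where \<alpha>: "\<alpha> \<in> Rep {0..real l}" "\<forall>s\<in>{0..real l}. dist (\<phi> (\<alpha> s) x) (\<phi> s w) < \<epsilon>"
        using w(1) by (auto simp: rep_ball_def)
      obtain \<beta> where \<beta>: "\<beta> \<in> Rep {0..real l}" "\<forall>s\<in>{0..real l}. dist (\<phi> (\<beta> s) z) (\<phi> s w) < \<epsilon>"
        using w(2) by (auto simp: rep_ball_def)
      have w: "continuous_on {0..real l} \<alpha>" "\<alpha> 0 = 0" "continuous_on {0..real l} \<beta>" "\<beta> 0 = 0"
        using \<alpha>(1) \<beta>(1) by (auto simp: Rep_Icc)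
      then have w': "\<And>s. s \<in> {0..real l} \<Longrightarrow> dist (\<phi> (\<alpha> s) x) (\<phi> s w) < \<epsilon>1"
        "\<And>s. s \<in> {0..real l} \<Longrightarrow> dist (\<phi> (\<beta> s) z) (\<phi> s w) < \<epsilon>1"
        using \<alpha>(2) \<beta>(2) by (auto simp: \<epsilon>_def)
      have "drift_bounded \<eta> S l \<alpha>"
        unfolding drift_bounded_def using w(2) \<epsilon>1(2)[OF w(1,2) w'(1)] by blast
      moreover have "drift_bounded \<eta> S l \<beta>"
        unfolding drift_bounded_def using w(4) \<epsilon>1(2)[OF w(3,4) w'(2)] by blast
      ultimately show "\<exists>w \<alpha> \<beta>. (continuous_on {0..real l} \<alpha> \<and> drift_bounded \<eta> S l \<alpha>) \<and> drift_bounded \<eta> S l \<beta> \<and>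
          (\<forall>s\<in>{0..real l}. dist (\<phi> (\<alpha> s) x) (\<phi> s w) < \<epsilon>' / 8 \<and> dist (\<phi> (\<beta> s) z) (\<phi> s w) < \<epsilon>' / 8)"
        using w \<alpha>(2) \<beta>(2) by (intro exI[of _ w] exI[of _ \<alpha>] exI[of _ \<beta>]) (auto simp: \<epsilon>_def)
    qed
    then obtain w \<alpha> \<beta> where "\<forall>x\<in>V. (continuous_on {0..real l} (\<alpha> x) \<and> drift_bounded \<eta> S l (\<alpha> x)) \<and>
        drift_bounded \<eta> S l (\<beta> x) \<and> (\<forall>s\<in>{0..real l}. dist (\<phi> (\<alpha> x s) x) (\<phi> s (w x)) < \<epsilon>' / 8 \<and>
          dist (\<phi> (\<beta> x s) z) (\<phi> s (w x)) < \<epsilon>' / 8)"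
      unfolding bchoice_iff by (elim exE)
    then have w:
      "\<And>x. x \<in> V \<Longrightarrow> continuous_on {0..real l} (\<alpha> x)"
      "\<And>x. x \<in> V \<Longrightarrow> drift_bounded \<eta> S l (\<alpha> x)" "\<And>x. x \<in> V \<Longrightarrow> drift_bounded \<eta> S l (\<beta> x)"
      "\<And>x s. x \<in> V \<Longrightarrow> s \<in> {0..real l} \<Longrightarrow> dist (\<phi> (\<alpha> x s) x) (\<phi> s (w x)) < \<epsilon>' / 8"
      "\<And>x s. x \<in> V \<Longrightarrow> s \<in> {0..real l} \<Longrightarrow> dist (\<phi> (\<beta> x s) z) (\<phi> s (w x)) < \<epsilon>' / 8"
      by simp_all
    obtain code :: "(real \<Rightarrow> real) \<Rightarrow> nat \<Rightarrow> int" and D where "finite D \<and> card D = 3 ^ (l div S) \<and>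
      (\<forall>\<alpha>. drift_bounded \<eta> S l \<alpha> \<longrightarrow> code \<alpha> \<in> D) \<and>
      (\<forall>\<alpha> \<beta> s. drift_bounded \<eta> S l \<alpha> \<longrightarrow> drift_bounded \<eta> S l \<beta> \<longrightarrow> code \<alpha> = code \<beta> \<longrightarrow>
         0 \<le> s \<longrightarrow> s \<le> real l \<longrightarrow> \<bar>\<alpha> s - \<beta> s\<bar> < 3 * \<eta>)"
      using drift_code[OF \<eta>(1) \<open>0 < S\<close>, of l] by (elim exE)
    then have D: "finite D" "card D = 3 ^ m" "\<And>\<alpha>. drift_bounded \<eta> S l \<alpha> \<Longrightarrow> code \<alpha> \<in> D"
      "\<And>\<alpha> \<beta> s. drift_bounded \<eta> S l \<alpha> \<Longrightarrow> drift_bounded \<eta> S l \<beta> \<Longrightarrow> code \<alpha> = code \<beta> \<Longrightarrow>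
         0 \<le> s \<Longrightarrow> s \<le> real l \<Longrightarrow> \<bar>\<alpha> s - \<beta> s\<bar> < 3 * \<eta>"
      by (simp_all add: m_def)
    \<comment> \<open>At time \<open>l\<close> the clock of \<open>x\<close> shows at least
      \<open>l - (m + 1)\<close>, since the \<open>m\<close> full periods and the incomplete last
      one lose at most one unit each. Thus it passes through every integer below this bound, and
      these are the times that the codes control.\<close>
    have "coverable (\<phi> 1) V (l - (m + 1)) \<epsilon>' (real (card (D \<times> D)))"
    proof (rule coverable_code[where K = "\<lambda>x. (code (\<alpha> x), code (\<beta> x))"])
      fix x y i
      assume x: "x \<in> V" and y: "y \<in> V" and "(code (\<alpha> x), code (\<beta> x)) = (code (\<alpha> y), code (\<beta> y))"
        and i: "i < l - (m + 1)"
      then have c: "code (\<alpha> x) = code (\<alpha> y)" "code (\<beta> x) = code (\<beta> y)"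
        by auto
      have "\<bar>\<alpha> x (real l) - real l\<bar> \<le> real m + 1"
      proof -
        have "m * S \<le> l"
          by (simp add: m_def)
        moreover have "l \<le> m * S + S"
          unfolding m_def using \<open>0 < S\<close> dividend_less_div_times[of S l] by linarith
        ultimately have m: "real (m * S) \<le> real l" "real l \<le> real (m * S) + real S"
          by (simp only: of_nat_le_iff of_nat_add[symmetric])+
        have "\<bar>(\<alpha> x (real l) - \<alpha> x (real (m * S))) - (real l - real (m * S))\<bar> < \<eta>"
          using m by (intro drift_boundedD[OF w(2)[OF x]]) auto
        moreover have "\<bar>\<alpha> x (real (m * S)) - real (m * S)\<bar> \<le> real m * \<eta>"
          using \<open>m * S \<le> l\<close> by (intro drift_bounded_total[OF w(2)[OF x]])
        moreover have "real m * \<eta> \<le> real m"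
          using \<eta> by (simp add: mult_left_le)
        ultimately show ?thesis
          using \<eta> by linarith
      qed
      then have "real i \<le> \<alpha> x (real l)"
        using i by linarith
      moreover have "\<alpha> x 0 = 0"
        using w(2)[OF x] by (simp add: drift_bounded_def)
      ultimately obtain s where s: "0 \<le> s" "s \<le> real l" "\<alpha> x s = real i"
        using IVT'[of "\<alpha> x" 0 "real i" "real l"] w(1)[OF x] by auto
      have sI: "s \<in> {0..real l}"
        using s by simp
      note a = w(4)[OF x sI] w(4)[OF y sI] w(5)[OF x sI] w(5)[OF y sI]
      have "\<bar>\<alpha> y s - \<alpha> x s\<bar> \<le> \<eta>0" "\<bar>\<beta> x s - \<beta> y s\<bar> \<le> \<eta>0"
        using D(4)[OF w(2)[OF y] w(2)[OF x] c(1)[symmetric] s(1,2)]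
          D(4)[OF w(3)[OF x] w(3)[OF y] c(2) s(1,2)] \<eta>(3) by linarith+
      then have b: "dist (\<phi> (\<alpha> y s) y) (\<phi> (\<alpha> x s) y) < \<epsilon>' / 8" "dist (\<phi> (\<beta> x s) z) (\<phi> (\<beta> y s) z) < \<epsilon>' / 8"
        using \<eta>0(2) by auto
      \<comment> \<open>The chain runs from \<open>x\<close> over \<open>w x\<close> to
        \<open>z\<close>, along the orbit of \<open>z\<close>, then over \<open>w y\<close> to
        \<open>y\<close> and along the orbit of \<open>y\<close>: six steps of
        \<open>\<epsilon>' / 8\<close>.\<close>
      have "dist (\<phi> (\<alpha> x s) x) (\<phi> (\<beta> x s) z) < \<epsilon>' / 4"
        using dist_triangle2[of "\<phi> (\<alpha> x s) x" "\<phi> (\<beta> x s) z" "\<phi> s (w x)"] a by linarith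
      moreover have "dist (\<phi> (\<alpha> y s) y) (\<phi> (\<beta> y s) z) < \<epsilon>' / 4"
        using dist_triangle2[of "\<phi> (\<alpha> y s) y" "\<phi> (\<beta> y s) z" "\<phi> s (w y)"] a by linarith
      moreover have "dist (\<phi> (\<alpha> x s) x) (\<phi> (\<beta> y s) z) \<le> dist (\<phi> (\<alpha> x s) x) (\<phi> (\<beta> x s) z) + dist (\<phi> (\<beta> x s) z) (\<phi> (\<beta> y s) z)"
        by (rule dist_triangle)
      moreover have "dist (\<phi> (\<alpha> x s) x) (\<phi> (\<alpha> y s) y) \<le> dist (\<phi> (\<alpha> x s) x) (\<phi> (\<beta> y s) z) + dist (\<phi> (\<alpha> y s) y) (\<phi> (\<beta> y s) z)"
        by (rule dist_triangle2)
      moreover have "dist (\<phi> (\<alpha> x s) x) (\<phi> (\<alpha> x s) y) \<le> dist (\<phi> (\<alpha> x s) x) (\<phi> (\<alpha> y s) y) + dist (\<phi> (\<alpha> y s) y) (\<phi> (\<alpha> x s) y)"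
        by (rule dist_triangle)
      ultimately have "dist (\<phi> (\<alpha> x s) x) (\<phi> (\<alpha> x s) y) < \<epsilon>'"
        using b assms(1) by linarith
      then show "dist ((\<phi> 1 ^^ i) x) ((\<phi> 1 ^^ i) y) < \<epsilon>'"
        by (simp add: flow_iterate s)
    qed (use D w in auto)
    \<comment> \<open>The last \<open>m + 1\<close> time units get the trivial cover, at a factor
      \<open>C\<close> each.\<close>
    then have "coverable (\<phi> 1) (V \<inter> (\<phi> 1 ^^ (l - (m + 1))) -` UNIV) ((l - (m + 1)) + (m + 1)) \<epsilon>'
        (real (card (D \<times> D)) * C ^ (m + 1))"
      using coverable_concat coverable_power[OF C(2)] by blast
    then show "coverable (\<phi> 1) V l \<epsilon>' (exp (\<gamma> * real l))"
    proof (rule coverable_mono)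
      have "(3::real) ^ m * 3 ^ m = 9 ^ m"
        by (simp flip: power_mult_distrib)
      then have "real (card (D \<times> D)) * C ^ (m + 1) = (9 * C) ^ m * C"
        by (simp add: card_cartesian_product D(2) power_mult_distrib)
      also have "\<dots> = exp (real m * ln (9 * C)) * exp (ln C)"
        using C(1) by (simp add: exp_of_nat_mult)
      also have "\<dots> \<le> exp (\<gamma> * real l / 2) * exp (\<gamma> * real l / 2)"
      proof (intro mult_mono)
        have "real m * ln (9 * C) \<le> real m * (real S * \<gamma> / 2)"
          using S assms(2) by (intro mult_left_mono) (auto simp: field_simps)
        also have "\<dots> = real (m * S) * (\<gamma> / 2)"
          by simp
        also have "\<dots> \<le> real l * (\<gamma> / 2)"
        proof (rule mult_right_mono)
          show "real (m * S) \<le> real l"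
            unfolding of_nat_le_iff by (simp add: m_def)
        qed (use assms(2) in simp)
        finally show "exp (real m * ln (9 * C)) \<le> exp (\<gamma> * real l / 2)"
          by (simp add: mult.commute)
        have "2 * ln C / \<gamma> \<le> real l"
          using l0 l by linarith
        then show "exp (ln C) \<le> exp (\<gamma> * real l / 2)"
          unfolding exp_le_cancel_iff using assms(2) by (simp add: field_simps)
      qed auto
      also have "\<dots> = exp (\<gamma> * real l)"
        by (simp flip: exp_add)
      finally show "real (card (D \<times> D)) * C ^ (m + 1) \<le> exp (\<gamma> * real l)" .
    qed auto
  qed
qed

end

section \<open>Openness of the balls and inclusions between them\<close>

context compact_metric_flow
begin

text \<open>On the compact interval the strict inequality holds with a margin, so one and the same
  time change serves all nearby pairs. Centre and point are moved together because openness is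
  wanted in both variables.\<close>

lemma rep_ball_perturb:
  assumes "y \<in> rep_ball \<phi> x t \<epsilon>"
  shows "\<exists>\<delta>>0. \<forall>x' y'. dist x' x < \<delta> \<longrightarrow> dist y' y < \<delta> \<longrightarrow> y' \<in> rep_ball \<phi> x' t \<epsilon>"
proof (cases "0 \<le> t")
  case False
  \<comment> \<open>For negative \<open>t\<close> the interval \<open>{0..t}\<close> is empty and
    the tracking condition is vacuous.\<close>
  then have "y' \<in> rep_ball \<phi> x' t \<epsilon>" for x' y'
    using assms by (auto simp: rep_ball_def)
  then show ?thesis
    by (intro exI[of _ 1]) simp
next
  case True
  obtain \<alpha> where \<alpha>: "\<alpha> \<in> Rep {0..t}" "\<forall>s\<in>{0..t}. dist (\<phi> (\<alpha> s) x) (\<phi> s y) < \<epsilon>"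
    using assms by (auto simp: rep_ball_def)
  have cont: "continuous_on {0..t} \<alpha>"
    using \<alpha>(1) by (simp add: Rep_Icc)
  have "continuous_on {0..t} (\<lambda>s. dist (\<phi> (\<alpha> s) x) (\<phi> s y))"
    by (intro continuous_intros continuous_on_compose2[OF continuous_on_orbit cont]
        continuous_on_subset[OF continuous_on_orbit]) auto
  then obtain r where r: "r \<in> {0..t}" "\<forall>s\<in>{0..t}. dist (\<phi> (\<alpha> s) x) (\<phi> s y) \<le> dist (\<phi> (\<alpha> r) x) (\<phi> r y)"
    using continuous_attains_sup[of "{0..t}" "\<lambda>s. dist (\<phi> (\<alpha> s) x) (\<phi> s y)"] True by auto
  define \<rho> where "\<rho> = (\<epsilon> - dist (\<phi> (\<alpha> r) x) (\<phi> r y)) / 2"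
  have "0 < \<rho>"
    using \<alpha>(2) r(1) by (simp add: \<rho>_def)
  have "bounded (\<alpha> ` {0..t})"
    by (intro compact_imp_bounded compact_continuous_image cont compact_Icc)
  then obtain A where A: "\<forall>s\<in>{0..t}. \<bar>\<alpha> s\<bar> \<le> A"
    by (auto simp: bounded_iff)
  obtain \<delta> where \<delta>: "0 < \<delta>" "\<And>x y s t'. \<bar>s\<bar> \<le> max A t \<Longrightarrow> \<bar>t'\<bar> \<le> max A t \<Longrightarrow> dist x y < \<delta> \<Longrightarrow>
      \<bar>s - t'\<bar> < \<delta> \<Longrightarrow> dist (\<phi> s x) (\<phi> t' y) < \<rho>"
    using flow_uniformly_continuous[OF \<open>0 < \<rho>\<close>, of "max A t"] by metis
  show ?thesis
  proof (intro exI[of _ \<delta>] conjI allI impI \<delta>(1))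
    fix x' y' assume d: "dist x' x < \<delta>" "dist y' y < \<delta>"
    have "dist (\<phi> (\<alpha> s) x') (\<phi> s y') < \<epsilon>" if s: "s \<in> {0..t}" for s
    proof -
      have "dist (\<phi> (\<alpha> s) x') (\<phi> (\<alpha> s) x) < \<rho>"
        using A s \<delta>(1) d by (intro \<delta>(2)) (auto simp: le_max_iff_disj)
      moreover have "dist (\<phi> s y') (\<phi> s y) < \<rho>"
        using s \<delta>(1) d by (intro \<delta>(2)) auto
      moreover have "dist (\<phi> (\<alpha> s) x) (\<phi> s y) + 2 * \<rho> \<le> \<epsilon>"
        using r(2)[rule_format, OF s] by (simp add: \<rho>_def field_simps)
      moreover have "dist (\<phi> (\<alpha> s) x') (\<phi> s y') \<le> dist (\<phi> (\<alpha> s) x') (\<phi> (\<alpha> s) x) + dist (\<phi> (\<alpha> s) x) (\<phi> s y')"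
        by (rule dist_triangle)
      moreover have "dist (\<phi> (\<alpha> s) x) (\<phi> s y') \<le> dist (\<phi> (\<alpha> s) x) (\<phi> s y) + dist (\<phi> s y') (\<phi> s y)"
        by (rule dist_triangle2)
      ultimately show ?thesis
        by linarith
    qed
    then have "\<forall>s\<in>{0..t}. dist (\<phi> (\<alpha> s) x') (\<phi> s y') < \<epsilon>"
      by simp
    then show "y' \<in> rep_ball \<phi> x' t \<epsilon>"
      unfolding rep_ball_def by (intro CollectI bexI[of _ \<alpha>] \<alpha>(1))
  qed
qed

lemma open_rep_ball: "open (rep_ball \<phi> x t \<epsilon>)"
  unfolding open_dist
proof
  fix y assume "y \<in> rep_ball \<phi> x t \<epsilon>"
  then obtain \<delta> where "0 < \<delta>"
    "\<forall>x' y'. dist x' x < \<delta> \<longrightarrow> dist y' y < \<delta> \<longrightarrow> y' \<in> rep_ball \<phi> x' t \<epsilon>"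
    using rep_ball_perturb by metis
  then show "\<exists>e>0. \<forall>y'. dist y' y < e \<longrightarrow> y' \<in> rep_ball \<phi> x t \<epsilon>"
    by (intro exI[of _ \<delta>]) auto
qed

lemma open_rep_ball_centres: "open {x. y \<in> rep_ball \<phi> x t \<epsilon>}"
  unfolding open_dist
proof
  fix x assume "x \<in> {x. y \<in> rep_ball \<phi> x t \<epsilon>}"
  then have "y \<in> rep_ball \<phi> x t \<epsilon>" by simp
  then obtain \<delta> where "0 < \<delta>"
    "\<forall>x' y'. dist x' x < \<delta> \<longrightarrow> dist y' y < \<delta> \<longrightarrow> y' \<in> rep_ball \<phi> x' t \<epsilon>"
    using rep_ball_perturb by metis
  then show "\<exists>e>0. \<forall>x'. dist x' x < e \<longrightarrow> x' \<in> {x. y \<in> rep_ball \<phi> x t \<epsilon>}"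
    by (intro exI[of _ \<delta>]) auto
qed

lemma continuous_on_iterate: "continuous_on UNIV (\<phi> 1 ^^ i)"
proof -
  have "\<phi> 1 ^^ i = \<phi> (real i)"
    by (rule ext) (rule flow_iterate)
  then show ?thesis
    using continuous_on_flow_map by simp
qed

lemma open_bowen_ball: "open (bowen_ball (\<phi> 1) x n \<epsilon>)"
proof -
  have "bowen_ball (\<phi> 1) x n \<epsilon> = (\<Inter>i\<in>{..<n}. {y. dist ((\<phi> 1 ^^ i) x) ((\<phi> 1 ^^ i) y) < \<epsilon>})"
    by (auto simp: bowen_ball_def)
  then show ?thesis
    by (simp only:) (intro open_INT finite_lessThan ballI open_Collect_less continuous_intros continuous_on_iterate)
qed

lemma open_bowen_ball_centres: "open {x. y \<in> bowen_ball (\<phi> 1) x n \<epsilon>}"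
proof -
  have "{x. y \<in> bowen_ball (\<phi> 1) x n \<epsilon>} = bowen_ball (\<phi> 1) y n \<epsilon>"
    by (simp add: bowen_ball_def dist_commute)
  then show ?thesis
    using open_bowen_ball by simp
qed

text \<open>The identity is an admissible time change, and uniform continuity over one time unit
  fills in the times between integers. The condition \<open>t < real n\<close> puts the integer part
  of every \<open>s \<le> t\<close> below \<open>n\<close>.\<close>

lemma bowen_ball_subset_rep_ball:
  assumes "0 < \<epsilon>"
  obtains \<epsilon>' where "0 < \<epsilon>'"
    "\<And>x t n. t < real n \<Longrightarrow> bowen_ball (\<phi> 1) x n \<epsilon>' \<subseteq> rep_ball \<phi> x t \<epsilon>"
proof -
  obtain \<delta> where \<delta>: "0 < \<delta>"
    "\<And>x y s t. \<bar>s\<bar> \<le> 1 \<Longrightarrow> \<bar>t\<bar> \<le> 1 \<Longrightarrow> dist x y < \<delta> \<Longrightarrow> \<bar>s - t\<bar> < \<delta> \<Longrightarrow> dist (\<phi> s x) (\<phi> t y) < \<epsilon>"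
    using flow_uniformly_continuous[OF assms, of 1] by metis
  show thesis
  proof (rule that[OF \<delta>(1)], rule subsetI)
    fix x t y and n :: nat assume t: "t < real n" and y: "y \<in> bowen_ball (\<phi> 1) x n \<delta>"
    have "dist (\<phi> s x) (\<phi> s y) < \<epsilon>" if s: "s \<in> {0..t}" for s
    proof -
      define i where "i = nat \<lfloor>s\<rfloor>"
      have i: "real i \<le> s" "s \<le> real i + 1"
        using s of_nat_floor[of s] unfolding i_def by auto
      then have "i < n"
        using s t by auto
      then have "dist (\<phi> (real i) x) (\<phi> (real i) y) < \<delta>"
        using y by (simp add: bowen_ball_def flow_iterate)
      then have "dist (\<phi> (s - real i) (\<phi> (real i) x)) (\<phi> (s - real i) (\<phi> (real i) y)) < \<epsilon>"
        using i \<delta>(1) by (intro \<delta>(2)) auto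
      then show ?thesis
        by (simp add: flow_flow)
    qed
    then show "y \<in> rep_ball \<phi> x t \<epsilon>"
      unfolding rep_ball_def by (intro CollectI bexI[of _ "\<lambda>s. s"]) (auto simp: Rep_Icc)
  qed
qed

end

context fixed_point_free_flow
begin

text \<open>Restarting the clock at time \<open>1\<close> moves the centre to
  \<open>\<phi> (\<alpha> 1) x\<close> instead of \<open>\<phi> 1 x\<close>. The drift estimate
  bounds this constant time error \<open>\<alpha> 1 - 1\<close>, which
  \<open>flow_near_identity\<close> makes harmless at all later times.\<close>

lemma rep_ball_shift:
  assumes "0 < \<epsilon>'"
  obtains \<epsilon> where "0 < \<epsilon>"
    "\<And>x y t. 0 \<le> t \<Longrightarrow> y \<in> rep_ball \<phi> x (1 + t) \<epsilon> \<Longrightarrow> \<phi> 1 y \<in> rep_ball \<phi> (\<phi> 1 x) t \<epsilon>'"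
proof -
  obtain \<eta> where \<eta>: "0 < \<eta>" "\<And>x s t. \<bar>s - t\<bar> \<le> \<eta> \<Longrightarrow> dist (\<phi> s x) (\<phi> t x) < \<epsilon>' / 2"
    using flow_near_identity[of "\<epsilon>' / 2"] assms by auto
  obtain \<epsilon> where "0 < \<epsilon>" "\<forall>x y \<alpha> t r s. continuous_on {0..t} \<alpha> \<longrightarrow> \<alpha> 0 = 0 \<longrightarrow>
      (\<forall>s\<in>{0..t}. dist (\<phi> (\<alpha> s) x) (\<phi> s y) < \<epsilon>) \<longrightarrow>
      0 \<le> r \<longrightarrow> r \<le> s \<longrightarrow> s \<le> t \<longrightarrow> s \<le> r + 1 \<longrightarrow> \<bar>(\<alpha> s - \<alpha> r) - (s - r)\<bar> < \<eta>"
    using tracking_drift[OF \<eta>(1), of "1"] by (elim exE conjE)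
  note \<epsilon> = this(1) this(2)[rule_format]
  show thesis
  proof (rule that[of "min \<epsilon> (\<epsilon>' / 2)"])
    fix x y :: 'a and t :: real
    assume t: "0 \<le> t" and "y \<in> rep_ball \<phi> x (1 + t) (min \<epsilon> (\<epsilon>' / 2))"
    then obtain \<alpha> where \<alpha>: "\<alpha> \<in> Rep {0..1 + t}"
      "\<forall>s\<in>{0..1 + t}. dist (\<phi> (\<alpha> s) x) (\<phi> s y) < min \<epsilon> (\<epsilon>' / 2)"
      by (auto simp: rep_ball_def)
    have cont: "continuous_on {0..1 + t} \<alpha>" and inj: "inj_on \<alpha> {0..1 + t}" and "\<alpha> 0 = 0"
      using \<alpha>(1) by (auto simp: Rep_Icc)
    have "dist (\<phi> (\<alpha> s) x) (\<phi> s y) < \<epsilon>" if "s \<in> {0..1 + t}" for s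
      using \<alpha>(2) that by simp
    from \<epsilon>(2)[OF cont \<open>\<alpha> 0 = 0\<close> this, of 0 1] have \<alpha>1: "\<bar>\<alpha> 1 - 1\<bar> \<le> \<eta>"
      using \<open>\<alpha> 0 = 0\<close> t by simp
    define \<beta> where "\<beta> s = \<alpha> (1 + s) - \<alpha> 1" for s
    have "\<beta> \<in> Rep {0..t}"
      unfolding Rep_Icc
    proof (intro conjI)
      show "continuous_on {0..t} \<beta>"
        unfolding \<beta>_def by (intro continuous_intros continuous_on_compose2[OF cont]) auto
      show "inj_on \<beta> {0..t}"
      proof (rule inj_onI)
        fix u v assume "u \<in> {0..t}" "v \<in> {0..t}" "\<beta> u = \<beta> v"
        then show "u = v"
          using inj_onD[OF inj, of "1 + u" "1 + v"] by (simp add: \<beta>_def)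
      qed
    qed (simp add: \<beta>_def)
    moreover have "\<forall>s\<in>{0..t}. dist (\<phi> (\<beta> s) (\<phi> 1 x)) (\<phi> s (\<phi> 1 y)) < \<epsilon>'"
    proof
      fix s assume s: "s \<in> {0..t}"
      have "dist (\<phi> (1 + \<beta> s) x) (\<phi> (\<alpha> (1 + s)) x) < \<epsilon>' / 2"
      proof (rule \<eta>(2))
        have "1 + \<beta> s - \<alpha> (1 + s) = - (\<alpha> 1 - 1)"
          by (simp add: \<beta>_def)
        then show "\<bar>1 + \<beta> s - \<alpha> (1 + s)\<bar> \<le> \<eta>"
          using \<alpha>1 by (simp only: abs_minus_cancel)
      qed
      moreover have "dist (\<phi> (\<alpha> (1 + s)) x) (\<phi> (1 + s) y) < \<epsilon>' / 2"
        using \<alpha>(2) s by auto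
      ultimately have "dist (\<phi> (1 + \<beta> s) x) (\<phi> (1 + s) y) < \<epsilon>'"
        using dist_triangle[of "\<phi> (1 + \<beta> s) x" "\<phi> (1 + s) y" "\<phi> (\<alpha> (1 + s)) x"] by linarith
      then show "dist (\<phi> (\<beta> s) (\<phi> 1 x)) (\<phi> s (\<phi> 1 y)) < \<epsilon>'"
        by (simp add: flow_flow)
    qed
    ultimately show "\<phi> 1 y \<in> rep_ball \<phi> (\<phi> 1 x) t \<epsilon>'"
      unfolding rep_ball_def by (intro CollectI bexI[of _ \<beta>])
  qed (use \<epsilon>(1) assms in auto)
qed

end

section \<open>The maximal ergodic inequality\<close>

context prob_space
begin

text \<open>The maximum of the Birkhoff sums of \<open>f\<close> over the lengths \<open>0\<close>
  to \<open>n\<close>, in the recursive form that relates the values at \<open>x\<close> and at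
  \<open>T x\<close>.\<close>

fun max_sum :: "('a \<Rightarrow> 'a) \<Rightarrow> ('a \<Rightarrow> real) \<Rightarrow> nat \<Rightarrow> 'a \<Rightarrow> real" where
  "max_sum T f 0 x = 0"
| "max_sum T f (Suc n) x = max 0 (f x + max_sum T f n (T x))"

lemma max_sum_nonneg: "0 \<le> max_sum T f n x"
  by (cases n) auto

lemma max_sum_Suc: "max_sum T f n x \<le> max_sum T f (Suc n) x"
proof (induction n arbitrary: x)
  case (Suc n)
  show ?case
    using Suc[of "T x"] by (simp only: max_sum.simps)
qed (simp add: max_sum_nonneg)

lemma sum_le_max_sum: "(\<Sum>i<n. f ((T ^^ i) x)) \<le> max_sum T f n x"
proof (induction n arbitrary: x)
  case (Suc n)
  have "(\<Sum>i<Suc n. f ((T ^^ i) x)) = f x + (\<Sum>i<n. f ((T ^^ i) (T x)))"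
    by (simp only: sum.lessThan_Suc_shift) (simp add: funpow_swap1)
  then show ?case
    using Suc[of "T x"] by simp
qed simp

lemma max_sum_le: "(\<And>x. f x \<le> 1) \<Longrightarrow> max_sum T f n x \<le> real n"
proof (induction n arbitrary: x)
  case (Suc n)
  then have "f x \<le> 1" "max_sum T f n (T x) \<le> real n"
    by auto
  then show ?case by simp
qed simp

lemma measurable_max_sum:
  assumes "T \<in> measurable M M" "f \<in> borel_measurable M"
  shows "max_sum T f n \<in> borel_measurable M"
proof (induction n)
  case 0
  have "max_sum T f 0 = (\<lambda>_. 0)"
    by (rule ext) simp
  then show ?case by simp
next
  case (Suc n)
  have "max_sum T f (Suc n) = (\<lambda>x. max 0 (f x + max_sum T f n (T x)))"
    by (rule ext) simp
  moreover have "(\<lambda>x. max 0 (f x + max_sum T f n (T x))) \<in> borel_measurable M"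
    using assms Suc by measurable
  ultimately show ?case
    by simp
qed

text \<open>Garsia's argument for \<open>f = indicator B - c\<close>. Where the maximum is positive,
  it exceeds its value at \<open>T x\<close> by at most \<open>f x\<close>; elsewhere it is zero and
  does not exceed it. The difference of the two has integral zero, so \<open>f\<close> has
  nonnegative integral over \<open>G n\<close>. The set \<open>D\<close> collects the points at
  which some Birkhoff sum is positive.\<close>

lemma maximal_frequency:
  assumes T: "T \<in> measurable M M" "distr M M T = M" and B: "B \<in> sets M" and c: "0 < c"
  shows "\<exists>D\<in>sets M. measure M D \<le> measure M B / c \<and>
    (\<forall>x\<in>space M - D. \<forall>n. real (card {i\<in>{..<n}. (T ^^ i) x \<in> B}) \<le> c * real n)"
proof -
  define f where "f x = indicator B x - c" for x
  have f[measurable]: "f \<in> borel_measurable M"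
    unfolding f_def using B by measurable
  have f1: "f x \<le> 1" for x
    using c by (simp add: f_def indicator_def)
  note [measurable] = T(1) measurable_max_sum[OF T(1) f]
  define G where "G n = {x \<in> space M. 0 < max_sum T f n x}" for n
  have G[measurable]: "G n \<in> sets M" for n
    unfolding G_def by measurable
  have int: "integrable M (max_sum T f n)" for n
    using max_sum_nonneg max_sum_le[OF f1]
    by (intro integrable_const_bound[where B = "real n"]) (auto simp: abs_of_nonneg)
  have "measure M (G n) \<le> measure M B / c" for n
  proof -
    have le: "max_sum T f n x - max_sum T f n (T x) \<le> indicator (G n \<inter> B) x - c * indicator (G n) x"
      if x: "x \<in> space M" for x
    proof (cases n)
      case (Suc k)
      show ?thesis
      proof (cases "x \<in> G n")
        case True
        then have "max_sum T f n x = f x + max_sum T f k (T x)"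
          using Suc by (auto simp: G_def)
        also have "\<dots> \<le> f x + max_sum T f n (T x)"
          using max_sum_Suc[of T f k "T x"] Suc by simp
        finally show ?thesis
          using True by (simp add: f_def indicator_def split: if_splits)
      next
        case False
        then have "max_sum T f n x = 0"
          using max_sum_nonneg[of T f n x] x by (simp add: G_def)
        then show ?thesis
          using False max_sum_nonneg[of T f n "T x"] by simp
      qed
    qed (simp add: G_def)
    have "integrable (distr M M T) (max_sum T f n)"
      using int T(2) by simp
    then have int': "integrable M (\<lambda>x. max_sum T f n (T x))"
      by (rule integrable_distr[OF T(1)])
    have "(\<integral>x. max_sum T f n (T x) \<partial>M) = (\<integral>x. max_sum T f n x \<partial>M)"
      using integral_distr[OF T(1) measurable_max_sum[OF T(1) f], of n] T(2) by simp
    then have "0 = (\<integral>x. max_sum T f n x - max_sum T f n (T x) \<partial>M)"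
      using int int' by simp
    also have "\<dots> \<le> (\<integral>x. indicator (G n \<inter> B) x - c * indicator (G n) x \<partial>M)"
      using int int' B le by (intro integral_mono) (auto intro!: Bochner_Integration.integrable_diff integrable_mult_right integrable_real_indicator simp: less_top[symmetric])
    also have "\<dots> = measure M (G n \<inter> B) - c * measure M (G n)"
      using B by (subst Bochner_Integration.integral_diff)
        (auto intro!: integrable_mult_right integrable_real_indicator simp: less_top[symmetric])
    also have "\<dots> \<le> measure M B - c * measure M (G n)"
      using B by (simp add: finite_measure_mono)
    finally show ?thesis
      using c by (simp add: field_simps)
  qed
  moreover have "incseq G"
    unfolding incseq_Suc_iff G_def using max_sum_Suc by (auto intro: less_le_trans)
  then have "(\<lambda>n. measure M (G n)) \<longlonglongrightarrow> measure M (\<Union>n. G n)"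
    by (intro finite_Lim_measure_incseq) auto
  ultimately have "measure M (\<Union>n. G n) \<le> measure M B / c"
    by (intro LIMSEQ_le_const2) auto
  moreover have "real (card {i\<in>{..<n}. (T ^^ i) x \<in> B}) \<le> c * real n" if "x \<in> space M - (\<Union>n. G n)" for x n
  proof -
    have "(\<Sum>i<n. f ((T ^^ i) x)) \<le> 0"
    proof -
      have "max_sum T f n x \<le> 0"
        using that by (auto simp: G_def not_less)
      then show ?thesis
        using sum_le_max_sum[of f T x n] by linarith
    qed
    moreover have "(\<Sum>i<n. indicator B ((T ^^ i) x)) = real (card {i\<in>{..<n}. (T ^^ i) x \<in> B})"
      by (simp add: indicator_def sum.If_cases Int_def)
    ultimately show ?thesis
      by (simp add: f_def sum_subtractf mult.commute)
  qed
  ultimately show ?thesis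
    by (intro bexI[of _ "\<Union>n. G n"] conjI ballI allI) auto
qed

end

section \<open>Measurable dependence on the centre, and orbits packed by blocks\<close>

text \<open>Lower semicontinuity: if \<open>x n\<close> tends to \<open>l\<close>, openness in the
  centre puts each point of \<open>R l\<close> into \<open>R (x n)\<close> for all large
  \<open>n\<close>. So \<open>R l\<close> is an increasing union of sets \<open>A k\<close>
  contained in \<open>R (x k)\<close>, and the sublevel sets are closed.\<close>

lemma measurable_measure_open_relation:
  fixes R :: "'a::metric_space \<Rightarrow> 'a set"
  assumes "finite_measure M" and M: "sets M = sets borel" and "\<And>x. open (R x)" "\<And>y. open {x. y \<in> R x}"
  shows "(\<lambda>x. measure M (R x)) \<in> borel_measurable borel"
proof (rule borel_measurableI_greater)
  interpret finite_measure M by fact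
  fix a :: real
  have R: "R x \<in> sets M" for x
    using assms(3) by (simp add: M)
  have "closed {x. measure M (R x) \<le> a}"
    unfolding closed_sequential_limits
  proof (intro allI impI)
    fix x l assume "(\<forall>n. x n \<in> {x. measure M (R x) \<le> a}) \<and> x \<longlonglongrightarrow> l"
    then have x: "\<And>n. measure M (R (x n)) \<le> a" and lim: "x \<longlonglongrightarrow> l"
      by auto
    define A where "A k = (\<Inter>n\<in>{k..}. R (x n)) \<inter> R l" for k
    have A: "A k \<in> sets M" for k
      unfolding A_def by (intro sets.Int sets.countable_INT' R) (auto intro: R)
    have "(\<Union>k. A k) = R l"
    proof (intro equalityI subsetI)
      fix y assume y: "y \<in> R l"
      then have "eventually (\<lambda>n. x n \<in> {x. y \<in> R x}) sequentially"
        using topological_tendstoD[OF lim assms(4)] by simp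
      then obtain k where "\<And>n. k \<le> n \<Longrightarrow> y \<in> R (x n)"
        by (auto simp: eventually_sequentially)
      then show "y \<in> (\<Union>k. A k)"
        using y by (auto simp: A_def)
    qed (auto simp: A_def)
    moreover have "(\<lambda>k. measure M (A k)) \<longlonglongrightarrow> measure M (\<Union>k. A k)"
      by (intro finite_Lim_measure_incseq) (use A in \<open>auto simp: incseq_def A_def\<close>)
    moreover have "measure M (A k) \<le> a" for k
      using finite_measure_mono[of "A k" "R (x k)"] R x[of k] by (force simp: A_def)
    ultimately have "measure M (R l) \<le> a"
      by (intro LIMSEQ_le_const2[of "\<lambda>k. measure M (A k)"]) auto
    then show "l \<in> {x. measure M (R x) \<le> a}"
      by simp
  qed
  then have "open (- {x. measure M (R x) \<le> a})"
    by (rule open_Compl)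
  also have "- {x. measure M (R x) \<le> a} = {x \<in> space borel. a < measure M (R x)}"
    by auto
  finally show "{x \<in> space borel. a < measure M (R x)} \<in> sets borel"
    by simp
qed

text \<open>
  Induction on the length \<open>n\<close>: an orbit segment starts either with a block, and the blocks of length
  \<open>l\<close> contribute a factor \<open>exp (- \<gamma> * l)\<close>, or with a gap, which costs the factor \<open>C\<close>.
\<close>

lemma coverable_blocks:
  fixes T :: "'a::metric_space \<Rightarrow> 'a"
  assumes C: "1 \<le> C" "coverable T UNIV 1 \<epsilon> C" and \<beta>: "0 \<le> \<beta>" and m: "1 \<le> m"
    and G: "\<And>l. m \<le> l \<Longrightarrow> l \<le> M \<Longrightarrow> coverable T (G l) l \<epsilon> (exp ((\<beta> - \<gamma>) * real l))"
    and sum: "(\<Sum>l\<in>{m..M}. exp (- \<gamma> * real l)) \<le> 1 / 2"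
  shows "coverable T {x. card {i\<in>{..<n}. (T ^^ i) x \<notin> (\<Union>l\<in>{m..M}. G l)} \<le> g} n \<epsilon>
    (exp (\<beta> * (real n + real M)) * (2 * C) ^ g)"
proof -
  define A where "A = (\<Union>l\<in>{m..M}. G l)"
  define b where "b n x = card {i\<in>{..<n}. (T ^^ i) x \<notin> A}" for n x
  define Z where "Z n g = {x. b n x \<le> g}" for n g
  have "coverable T (Z n g) n \<epsilon> (exp (\<beta> * (real n + real M)) * (2 * C) ^ g)"
  proof (induction n arbitrary: g rule: less_induct)
    case (less n)
    define K where "K = exp (\<beta> * (real n + real M)) * (2 * C) ^ g"
    have K1: "1 \<le> K"
      using C(1) \<beta> unfolding K_def by (intro mult_ge1_I one_le_power) auto
    show ?case
    proof (cases "n = 0")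
      case True
      then show ?thesis
        using K1 coverable_mono[OF coverable_0, of "Z n g" UNIV 0 K] by (simp add: K_def)
    next
      case False
      \<comment> \<open>Once no gap is allowed any more, a segment that starts with a gap cannot
        occur; the case distinction also avoids the truncated \<open>g - 1\<close>.\<close>
      define Y where "Y = (if g = 0 then {} else Z (n - 1) (g - 1))"
      have Y: "coverable T (UNIV \<inter> (T ^^ 1) -` Y) (1 + (n - 1)) \<epsilon> (C * (K / (2 * C)))"
      proof (rule coverable_concat[OF C(2)])
        show "coverable T Y (n - 1) \<epsilon> (K / (2 * C))"
        proof (cases "g = 0")
          case True
          have "0 \<le> K / (2 * C)" using K1 C(1) by simp
          with True show ?thesis
            by (intro coverableI[of "{}"]) (auto simp: Y_def)
        next
          case False
          have "coverable T (Z (n - 1) (g - 1)) (n - 1) \<epsilon> (exp (\<beta> * (real (n - 1) + real M)) * (2 * C) ^ (g - 1))"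
            using \<open>n \<noteq> 0\<close> by (intro less) simp
          then show ?thesis
          proof (rule coverable_mono)
            have "exp (\<beta> * (real (n - 1) + real M)) * (2 * C) ^ (g - 1) \<le> exp (\<beta> * (real n + real M)) * (2 * C) ^ (g - 1)"
              using C(1) \<beta> by (intro mult_right_mono) (auto intro!: mult_left_mono)
            also have "\<dots> = K / (2 * C)"
              using False C(1) by (simp add: K_def power_eq_if)
            finally show "exp (\<beta> * (real (n - 1) + real M)) * (2 * C) ^ (g - 1) \<le> K / (2 * C)" .
          qed (use False in \<open>auto simp: Y_def\<close>)
        qed
      qed
      have X: "coverable T (\<Union>l\<in>{m..M}. G l \<inter> (T ^^ l) -` Z (n - l) g) n \<epsilon> (\<Sum>l\<in>{m..M}. exp (- \<gamma> * real l) * K)"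
      proof (rule coverable_UN)
        fix l assume l: "l \<in> {m..M}"
        \<comment> \<open>The real difference is negative when the last block overruns the segment.
          The reserve \<open>real M\<close> in the exponent keeps \<open>K'\<close> at least
          \<open>1\<close> in that case.\<close>
        define K' where "K' = exp (\<beta> * (real n - real l + real M)) * (2 * C) ^ g"
        have K': "exp ((\<beta> - \<gamma>) * real l) * K' = exp (- \<gamma> * real l) * K"
          unfolding K_def K'_def by (simp add: algebra_simps flip: exp_add)
        have "coverable T (Z (n - l) g) (n - l) \<epsilon> K'"
        proof (cases "l < n")
          case True
          then have "coverable T (Z (n - l) g) (n - l) \<epsilon> (exp (\<beta> * (real (n - l) + real M)) * (2 * C) ^ g)"
            using l m by (intro less) auto
          then show ?thesis
            using True by (simp add: K'_def of_nat_diff)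
        next
          case False
          have "1 \<le> K'"
            using C(1) \<beta> l unfolding K'_def by (intro mult_ge1_I one_le_power) auto
          then show ?thesis
            using False coverable_mono[OF coverable_0, of "Z (n - l) g" UNIV 0 K'] by simp
        qed
        then have "coverable T (G l \<inter> (T ^^ l) -` Z (n - l) g) (l + (n - l)) \<epsilon> (exp ((\<beta> - \<gamma>) * real l) * K')"
          using l by (intro coverable_concat G) auto
        then show "coverable T (G l \<inter> (T ^^ l) -` Z (n - l) g) n \<epsilon> (exp (- \<gamma> * real l) * K)"
          unfolding K' by (rule coverable_mono) auto
      qed simp
      have "coverable T ((UNIV \<inter> (T ^^ 1) -` Y) \<union> (\<Union>l\<in>{m..M}. G l \<inter> (T ^^ l) -` Z (n - l) g)) n \<epsilon>
          (C * (K / (2 * C)) + (\<Sum>l\<in>{m..M}. exp (- \<gamma> * real l) * K))"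
        using False by (intro coverable_Un X coverable_mono[OF Y]) auto
      then show ?thesis
        unfolding K_def[symmetric]
      proof (rule coverable_mono)
        \<comment> \<open>Starting with a gap costs \<open>C * (K / (2 * C))\<close>, that is half
          of \<open>K\<close>; the blocks of all lengths together cost at most the other half. This
          is the origin of the factor \<open>2\<close> in \<open>2 * C\<close>.\<close>
        have "(\<Sum>l\<in>{m..M}. exp (- \<gamma> * real l) * K) \<le> 1 / 2 * K"
          unfolding sum_distrib_right[symmetric] using sum K1 by (intro mult_right_mono) auto
        then show "C * (K / (2 * C)) + (\<Sum>l\<in>{m..M}. exp (- \<gamma> * real l) * K) \<le> K"
          using C(1) by simp
        show "Z n g \<subseteq> (UNIV \<inter> (T ^^ 1) -` Y) \<union> (\<Union>l\<in>{m..M}. G l \<inter> (T ^^ l) -` Z (n - l) g)"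
        proof
          fix x assume x: "x \<in> Z n g"
          show "x \<in> (UNIV \<inter> (T ^^ 1) -` Y) \<union> (\<Union>l\<in>{m..M}. G l \<inter> (T ^^ l) -` Z (n - l) g)"
          proof (cases "x \<in> A")
            case True
            then obtain l where l: "l \<in> {m..M}" "x \<in> G l"
              by (auto simp: A_def)
            have "b (n - l) ((T ^^ l) x) \<le> b n x"
              unfolding b_def
              by (rule card_inj_on_le[of "\<lambda>i. i + l"]) (auto simp: funpow_add)
            then show ?thesis
              using x l by (auto simp: Z_def)
          next
            case False
            have "insert 0 ((\<lambda>i. i + 1) ` {i\<in>{..<n - 1}. (T ^^ i) (T x) \<notin> A}) \<subseteq> {i\<in>{..<n}. (T ^^ i) x \<notin> A}"
              using False \<open>n \<noteq> 0\<close> by (auto simp: funpow_swap1)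
            then have "card (insert 0 ((\<lambda>i. i + 1) ` {i\<in>{..<n - 1}. (T ^^ i) (T x) \<notin> A})) \<le> b n x"
              unfolding b_def by (intro card_mono) auto
            moreover have "card (insert 0 ((\<lambda>i. i + 1) ` {i\<in>{..<n - 1}. (T ^^ i) (T x) \<notin> A})) = Suc (b (n - 1) (T x))"
              unfolding b_def by (subst card_insert_disjoint) (auto intro!: card_image)
            ultimately show ?thesis
              using x by (auto simp: Z_def Y_def)
          qed
        qed
      qed simp
    qed
  qed
  then show ?thesis
    by (simp add: Z_def b_def A_def)
qed

section \<open>Heavy and light balls of an invariant measure\<close>

locale invariant_flow = fixed_point_free_flow \<phi> for \<phi> :: "real \<Rightarrow> 'a::metric_space \<Rightarrow> 'a" +
  fixes \<mu> :: "'a measure"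
  assumes invariant: "\<mu> \<in> invariant_measures \<phi>"
begin

sublocale prob_space \<mu>
  using invariant by (simp add: invariant_measures_def)

lemma sets_eq [simp, measurable_cong]: "sets \<mu> = sets borel"
  using invariant by (simp add: invariant_measures_def)

lemma space_eq [simp]: "space \<mu> = UNIV"
  using sets_eq_imp_space_eq[OF sets_eq] by simp

lemma measurable_flow: "\<phi> t \<in> measurable \<mu> \<mu>"
  unfolding measurable_cong_sets[OF sets_eq sets_eq]
  by (rule borel_measurable_continuous_onI[OF continuous_on_flow_map])

text \<open>Invariance is stated through images, push-forwards work with preimages; surjectivity of
  \<open>\<phi> t\<close> links the two.\<close>

lemma distr_flow: "distr \<mu> \<mu> (\<phi> t) = \<mu>"
proof (rule measure_eqI)
  fix B assume "B \<in> sets (distr \<mu> \<mu> (\<phi> t))"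
  then have B: "B \<in> sets \<mu>" by simp
  obtain g where "homeomorphism UNIV UNIV (\<phi> t) g"
    using homeo by blast
  then have "surj (\<phi> t)"
    by (simp add: homeomorphism_def)
  then have "\<phi> t ` (\<phi> t -` B) = B"
    by (rule surj_image_vimage_eq)
  moreover have "\<phi> t -` B \<in> sets borel"
    using measurable_sets[OF measurable_flow B, of t] by simp
  then have "emeasure \<mu> (\<phi> t ` (\<phi> t -` B)) = emeasure \<mu> (\<phi> t -` B)"
    using invariant by (simp add: invariant_measures_def del: image_vimage_eq)
  ultimately have "emeasure \<mu> (\<phi> t -` B) = emeasure \<mu> B"
    by (simp del: image_vimage_eq)
  then show "emeasure (distr \<mu> \<mu> (\<phi> t)) B = emeasure \<mu> B"
    using B by (simp add: emeasure_distr measurable_flow)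
qed simp

lemma measure_vimage_flow:
  assumes "B \<in> sets borel"
  shows "prob (\<phi> t -` B) = prob B"
  using measure_distr[OF measurable_flow, of B t] assms by (simp add: distr_flow)

lemma sets_rep_ball [measurable]: "rep_ball \<phi> x t \<epsilon> \<in> sets borel"
  by (simp add: open_rep_ball)

lemma sets_bowen_ball [measurable]: "bowen_ball (\<phi> 1) x n \<epsilon> \<in> sets borel"
  by (simp add: open_bowen_ball)

lemma measurable_measure_rep_ball [measurable]: "(\<lambda>x. prob (rep_ball \<phi> x t \<epsilon>)) \<in> borel_measurable borel"
  by (intro measurable_measure_open_relation finite_measure_axioms sets_eq open_rep_ball open_rep_ball_centres)

lemma measurable_measure_bowen_ball [measurable]: "(\<lambda>x. prob (bowen_ball (\<phi> 1) x n \<epsilon>)) \<in> borel_measurable borel"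
  by (intro measurable_measure_open_relation finite_measure_axioms sets_eq open_bowen_ball open_bowen_ball_centres)

text \<open>
  A maximal disjoint family of balls of measure at least \<open>exp (- b * l)\<close> has at most
  \<open>exp (b * l)\<close> members, and every such ball meets one of them.
\<close>

lemma heavy_centres_coverable:
  assumes "0 < \<epsilon>'" "0 < \<gamma>"
  shows "\<exists>\<epsilon>>0. \<exists>l0. \<forall>l\<ge>l0. \<forall>b.
    coverable (\<phi> 1) {x. exp (- b * real l) \<le> prob (rep_ball \<phi> x (real l) \<epsilon>)} l \<epsilon>' (exp ((b + \<gamma>) * real l))"
proof -
  obtain \<epsilon> l0 where \<epsilon>: "0 < \<epsilon>" "\<And>l z. l0 \<le> l \<Longrightarrow>
    coverable (\<phi> 1) {x. rep_ball \<phi> x (real l) \<epsilon> \<inter> rep_ball \<phi> z (real l) \<epsilon> \<noteq> {}} l \<epsilon>' (exp (\<gamma> * real l))"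
    using rep_ball_overlap_coverable[OF assms] by metis
  show ?thesis
  proof (intro exI[of _ \<epsilon>] exI[of _ l0] conjI allI impI \<epsilon>(1))
    fix l :: nat and b :: real
    assume l: "l0 \<le> l"
    let ?R = "\<lambda>x. rep_ball \<phi> x (real l) \<epsilon>"
    define G where "G = {x. exp (- b * real l) \<le> prob (?R x)}"
    define P where "P Z \<longleftrightarrow> finite Z \<and> Z \<subseteq> G \<and> disjoint_family_on ?R Z" for Z
    have card_le: "real (card Z) \<le> exp (b * real l)" if "P Z" for Z
    proof -
      have "real (card Z) * exp (- b * real l) = (\<Sum>z\<in>Z. exp (- b * real l))"
        by simp
      also have "\<dots> \<le> (\<Sum>z\<in>Z. prob (?R z))"
        using that by (intro sum_mono) (auto simp: P_def G_def)
      also have "\<dots> = prob (\<Union>z\<in>Z. ?R z)"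
        using that by (intro finite_measure_finite_Union[symmetric]) (auto simp: P_def)
      also have "\<dots> \<le> 1"
        by (rule prob_le_1)
      finally show ?thesis
        by (simp add: exp_minus field_simps)
    qed
    have "\<exists>Z. P Z \<and> (\<forall>Y. P Y \<longrightarrow> card Y \<le> card Z)"
    proof (rule ex_has_greatest_nat)
      show "P {}"
        by (simp add: P_def disjoint_family_on_def)
      show "\<forall>Y. P Y \<longrightarrow> card Y < Suc (nat \<lfloor>exp (b * real l)\<rfloor>)"
        using card_le by (auto simp: less_Suc_eq_le le_nat_floor)
    qed
    then obtain Z where Z: "P Z" "\<And>Y. P Y \<Longrightarrow> card Y \<le> card Z"
      by auto
    have "G \<subseteq> (\<Union>z\<in>Z. {x. ?R x \<inter> ?R z \<noteq> {}})"
    proof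
      fix x assume x: "x \<in> G"
      show "x \<in> (\<Union>z\<in>Z. {x. ?R x \<inter> ?R z \<noteq> {}})"
      proof (rule ccontr)
        assume *: "x \<notin> (\<Union>z\<in>Z. {x. ?R x \<inter> ?R z \<noteq> {}})"
        have "0 < prob (?R x)"
          using x exp_gt_zero[of "- b * real l"] unfolding G_def by (metis (no_types) less_le_trans mem_Collect_eq)
        then have "?R x \<noteq> {}"
          by auto
        with * have "x \<notin> Z"
          by auto
        moreover have "P (insert x Z)"
          using Z(1) x * \<open>x \<notin> Z\<close> unfolding P_def by (auto simp: disjoint_family_on_insert)
        ultimately show False
          using Z(2)[of "insert x Z"] Z(1) by (simp add: P_def)
      qed
    qed
    moreover have "coverable (\<phi> 1) (\<Union>z\<in>Z. {x. ?R x \<inter> ?R z \<noteq> {}}) l \<epsilon>' (\<Sum>z\<in>Z. exp (\<gamma> * real l))"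
      using Z(1) by (intro coverable_UN \<epsilon>(2) l) (simp add: P_def)
    moreover have "(\<Sum>z\<in>Z. exp (\<gamma> * real l)) \<le> exp ((b + \<gamma>) * real l)"
      using card_le[OF Z(1)] by (simp add: distrib_right exp_add)
    ultimately show "coverable (\<phi> 1) {x. exp (- b * real l) \<le> prob (?R x)} l \<epsilon>' (exp ((b + \<gamma>) * real l))"
      unfolding G_def[symmetric] using coverable_mono by blast
  qed
qed

text \<open>In each piece that contains a light centre choose one, \<open>p F\<close>. Its Bowen
  ball contains the whole piece, hence all light centres there, and has measure below \<theta>. The
  union \<open>V\<close> of these open balls is measurable whatever the pieces are.\<close>

lemma light_centres:
  assumes "coverable (\<phi> 1) Y n \<epsilon> c" "0 \<le> \<theta>"
  shows "\<exists>V\<in>sets \<mu>. prob V \<le> c * \<theta> \<and>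
    (\<forall>y\<in>Y. prob (bowen_ball (\<phi> 1) y n \<epsilon>) < \<theta> \<longrightarrow> y \<in> V)"
proof -
  let ?B = "\<lambda>y. bowen_ball (\<phi> 1) y n \<epsilon>"
  obtain \<C> where \<C>: "finite \<C>" "real (card \<C>) \<le> c" "Y \<subseteq> \<Union>\<C>"
    "\<forall>F\<in>\<C>. \<forall>y\<in>F. \<forall>y'\<in>F. \<forall>i<n. dist ((\<phi> 1 ^^ i) y) ((\<phi> 1 ^^ i) y') < \<epsilon>"
    using assms(1) unfolding coverable_def by auto
  define \<D> where "\<D> = {F \<in> \<C>. \<exists>y\<in>F. prob (?B y) < \<theta>}"
  have "\<forall>F\<in>\<D>. \<exists>y. y \<in> F \<and> prob (?B y) < \<theta>"
    by (auto simp: \<D>_def)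
  then obtain p where p: "\<forall>F\<in>\<D>. p F \<in> F \<and> prob (?B (p F)) < \<theta>"
    unfolding bchoice_iff by (elim exE)
  have fin: "finite \<D>"
    using \<C>(1) by (simp add: \<D>_def)
  show ?thesis
  proof (intro bexI[of _ "\<Union>F\<in>\<D>. ?B (p F)"] conjI ballI impI)
    show "(\<Union>F\<in>\<D>. ?B (p F)) \<in> sets \<mu>"
      using fin by (intro sets.finite_UN) auto
    have "prob (\<Union>F\<in>\<D>. ?B (p F)) \<le> (\<Sum>F\<in>\<D>. prob (?B (p F)))"
      using fin by (intro finite_measure_subadditive_finite) auto
    also have "\<dots> \<le> (\<Sum>F\<in>\<D>. \<theta>)"
      using p by (intro sum_mono) (auto intro: less_imp_le)
    also have "\<dots> \<le> real (card \<C>) * \<theta>"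
      using \<C>(1) assms(2) by (simp add: \<D>_def mult_right_mono card_mono)
    also have "\<dots> \<le> c * \<theta>"
      using \<C>(2) assms(2) by (rule mult_right_mono)
    finally show "prob (\<Union>F\<in>\<D>. ?B (p F)) \<le> c * \<theta>" .
    fix y assume y: "y \<in> Y" "prob (?B y) < \<theta>"
    then obtain F where F: "F \<in> \<C>" "y \<in> F"
      using \<C>(3) by auto
    then have "F \<in> \<D>"
      using y by (auto simp: \<D>_def)
    moreover have "y \<in> ?B (p F)"
      using \<C>(4) F p \<open>F \<in> \<D>\<close> by (auto simp: bowen_ball_def)
    ultimately show "y \<in> (\<Union>F\<in>\<D>. ?B (p F))"
      by blast
  qed
qed

end

lemma geometric_tail_sum:
  fixes \<gamma> :: real
  assumes "0 < \<gamma>"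
  shows "\<exists>m\<ge>k. \<forall>M. (\<Sum>l\<in>{m..M}. exp (- \<gamma> * real l)) \<le> 1 / 2"
proof -
  have "summable (\<lambda>l. exp (- \<gamma>) ^ l)"
    using assms by (intro summable_geometric) simp
  then have "summable (\<lambda>l. exp (- \<gamma> * real l))"
    by (simp add: exp_of_nat2_mult[symmetric] mult.commute)
  then obtain N where N: "\<And>m n. N \<le> m \<Longrightarrow> norm (\<Sum>l\<in>{m..<n}. exp (- \<gamma> * real l)) < 1 / 2"
    unfolding summable_Cauchy by (metis half_gt_zero zero_less_one)
  show ?thesis
  proof (intro exI[of _ "max k N"] conjI allI)
    fix M
    have "(\<Sum>l\<in>{max k N..M}. exp (- \<gamma> * real l)) \<le> norm (\<Sum>l\<in>{max k N..<Suc M}. exp (- \<gamma> * real l))"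
      by (simp only: atLeastLessThanSuc_atLeastAtMost real_norm_def abs_ge_self)
    also have "\<dots> < 1 / 2"
      by (intro N) simp
    finally show "(\<Sum>l\<in>{max k N..M}. exp (- \<gamma> * real l)) \<le> 1 / 2"
      by simp
  qed simp
qed

section \<open>Bowen balls at points of bounded lower rate\<close>

context invariant_flow
begin

text \<open>The points at which the lower rate of reparametrization balls along integer lengths is
  at most \<open>a\<close>, written with countable quantifiers to make the set Borel.\<close>

definition slow :: "real \<Rightarrow> 'a set" where
  "slow a = {x. \<forall>j k m. \<exists>n\<ge>m.
     exp (- (a + 1 / real (Suc j)) * real n) \<le> prob (rep_ball \<phi> x (real n) (1 / real (Suc k)))}"

lemma slowD:
  assumes "x \<in> slow a" "0 < \<gamma>" "0 < \<epsilon>"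
  shows "\<exists>n\<ge>m. exp (- (a + \<gamma>) * real n) \<le> prob (rep_ball \<phi> x (real n) \<epsilon>)"
proof -
  obtain j where j: "1 / real (Suc j) < \<gamma>"
    using assms(2) nat_approx_posE by metis
  obtain k where k: "1 / real (Suc k) < \<epsilon>"
    using assms(3) nat_approx_posE by metis
  obtain n where n: "m \<le> n"
    "exp (- (a + 1 / real (Suc j)) * real n) \<le> prob (rep_ball \<phi> x (real n) (1 / real (Suc k)))"
    using assms(1) unfolding slow_def by blast
  have "exp (- (a + \<gamma>) * real n) \<le> exp (- (a + 1 / real (Suc j)) * real n)"
    using j by (simp add: mult_right_mono)
  also note n(2)
  also have "prob (rep_ball \<phi> x (real n) (1 / real (Suc k))) \<le> prob (rep_ball \<phi> x (real n) \<epsilon>)"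
    using k by (intro finite_measure_mono rep_ball_mono) auto
  finally show ?thesis
    using n(1) by blast
qed

lemma slowI:
  assumes "\<And>\<gamma> \<epsilon> m. 0 < \<gamma> \<Longrightarrow> 0 < \<epsilon> \<Longrightarrow>
    \<exists>n\<ge>m. exp (- (a + \<gamma>) * real n) \<le> prob (rep_ball \<phi> x (real n) \<epsilon>)"
  shows "x \<in> slow a"
  unfolding slow_def using assms by simp

lemma sets_slow [measurable]: "slow a \<in> sets borel"
proof -
  have "slow a = {x \<in> space borel. \<forall>j k m. \<exists>n. m \<le> n \<and>
     exp (- (a + 1 / real (Suc j)) * real n) \<le> prob (rep_ball \<phi> x (real n) (1 / real (Suc k)))}"
    by (auto simp: slow_def)
  also have "\<dots> \<in> sets borel"
    by measurable
  finally show ?thesis .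
qed

text \<open>By \<open>rep_ball_shift\<close> and invariance, a ball of length \<open>n - 1\<close>
  about \<open>\<phi> 1 x\<close> weighs at least as much as one of length \<open>n\<close> and
  suitable radius about \<open>x\<close>; the lost unit of length does not affect the rate.\<close>

lemma flow_slow:
  assumes x: "x \<in> slow a" and a: "0 \<le> a"
  shows "\<phi> 1 x \<in> slow a"
proof (rule slowI)
  fix \<gamma> \<epsilon>' :: real and m :: nat
  assume \<gamma>: "0 < \<gamma>" and "0 < \<epsilon>'"
  obtain \<epsilon> where \<epsilon>: "0 < \<epsilon>"
    "\<And>x y t. 0 \<le> t \<Longrightarrow> y \<in> rep_ball \<phi> x (1 + t) \<epsilon> \<Longrightarrow> \<phi> 1 y \<in> rep_ball \<phi> (\<phi> 1 x) t \<epsilon>'"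
    using rep_ball_shift[OF \<open>0 < \<epsilon>'\<close>] by metis
  \<comment> \<open>From \<open>2 * (a + \<gamma>) \<le> n * \<gamma>\<close> on, the spare half of
    \<gamma> pays for the lost unit:
    \<open>(a + \<gamma> / 2) * n \<le> (a + \<gamma>) * (n - 1)\<close>.\<close>
  obtain N :: nat where N: "2 * (a + \<gamma>) / \<gamma> \<le> real N"
    using real_arch_simple by blast
  obtain n where n: "max 1 (max (Suc m) N) \<le> n"
    "exp (- (a + \<gamma> / 2) * real n) \<le> prob (rep_ball \<phi> x (real n) \<epsilon>)"
    using slowD[OF x half_gt_zero[OF \<gamma>] \<epsilon>(1)] by blast
  have "2 * (a + \<gamma>) / \<gamma> \<le> real n"
    using N n(1) by simp
  then have "2 * (a + \<gamma>) \<le> real n * \<gamma>"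
    using \<gamma> by (simp add: field_simps)
  then have "(a + \<gamma> / 2) * real n \<le> (a + \<gamma>) * real (n - 1)"
    using n(1) by (simp add: of_nat_diff algebra_simps)
  then have "exp (- (a + \<gamma>) * real (n - 1)) \<le> exp (- (a + \<gamma> / 2) * real n)"
    by (simp only: exp_le_cancel_iff mult_minus_left neg_le_iff_le)
  also note n(2)
  also have "prob (rep_ball \<phi> x (real n) \<epsilon>) \<le> prob (\<phi> 1 -` rep_ball \<phi> (\<phi> 1 x) (real (n - 1)) \<epsilon>')"
  proof (rule finite_measure_mono)
    have "1 + real (n - 1) = real n"
      using n(1) by (simp add: of_nat_diff)
    then show "rep_ball \<phi> x (real n) \<epsilon> \<subseteq> \<phi> 1 -` rep_ball \<phi> (\<phi> 1 x) (real (n - 1)) \<epsilon>'"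
      using \<epsilon>(2)[of "real (n - 1)" _ x] by auto
    show "\<phi> 1 -` rep_ball \<phi> (\<phi> 1 x) (real (n - 1)) \<epsilon>' \<in> sets \<mu>"
      using measurable_sets[OF measurable_flow, of "rep_ball \<phi> (\<phi> 1 x) (real (n - 1)) \<epsilon>'" 1] by simp
  qed
  also have "\<dots> = prob (rep_ball \<phi> (\<phi> 1 x) (real (n - 1)) \<epsilon>')"
    by (intro measure_vimage_flow sets_rep_ball)
  finally show "\<exists>n\<ge>m. exp (- (a + \<gamma>) * real n) \<le> prob (rep_ball \<phi> (\<phi> 1 x) (real n) \<epsilon>')"
    using n(1) by (intro exI[of _ "n - 1"]) auto
qed

lemma iterate_slow: "x \<in> slow a \<Longrightarrow> 0 \<le> a \<Longrightarrow> (\<phi> 1 ^^ i) x \<in> slow a"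
  by (induction i) (auto intro: flow_slow)

text \<open>The set \<open>D\<close> comes from \<open>maximal_frequency\<close>. Outside it the
  gaps have small frequency in the segments of every length at once, so one exceptional set serves
  all \<open>n\<close>.\<close>

lemma AE_slow_bowen_ball_outside:
  assumes a: "0 \<le> a" and "0 < \<epsilon>'" "0 < \<gamma>" "0 < \<delta>"
  obtains D where "D \<in> sets \<mu>" "prob D \<le> \<delta>"
    "AE x in \<mu>. x \<in> slow a \<longrightarrow> x \<notin> D \<longrightarrow>
       (\<forall>\<^sub>F n in sequentially. exp (- (a + \<gamma>) * real n) \<le> prob (bowen_ball (\<phi> 1) x n \<epsilon>'))"
proof -
  \<comment> \<open>The cover of \<open>Z n\<close> will have rate
    \<open>\<beta> + g = a + 4 * g\<close>, while light means below the rate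
    \<open>a + 10 * g\<close>. The surplus makes the measures of the sets \<open>V n\<close>
    summable.\<close>
  define g where "g = \<gamma> / 10"
  have g: "0 < g"
    using assms by (simp add: g_def)
  define b where "b = a + g"
  define \<beta> where "\<beta> = b + 2 * g"
  have \<beta>: "0 \<le> \<beta>" "\<beta> - g = b + g"
    using a g by (auto simp: \<beta>_def b_def)
  obtain C where C: "1 \<le> C" "coverable (\<phi> 1) UNIV 1 \<epsilon>' C"
    using coverable_compact[OF compact_space assms(2)] by metis
  obtain \<epsilon> l0 where \<epsilon>: "0 < \<epsilon>" "\<forall>l\<ge>l0. \<forall>b.
    coverable (\<phi> 1) {x. exp (- b * real l) \<le> prob (rep_ball \<phi> x (real l) \<epsilon>)} l \<epsilon>' (exp ((b + g) * real l))"
    using heavy_centres_coverable[OF assms(2) g] by (elim exE conjE)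
  obtain m where m: "max 1 l0 \<le> m" "\<forall>M. (\<Sum>l\<in>{m..M}. exp (- g * real l)) \<le> 1 / 2"
    using geometric_tail_sum[OF g, of "max 1 l0"] by (elim exE conjE)
  define G where "G l = {x. exp (- b * real l) \<le> prob (rep_ball \<phi> x (real l) \<epsilon>)}" for l
  have G[measurable]: "G l \<in> sets borel" for l
    unfolding G_def by measurable
  \<comment> \<open>With gap frequency \<open>c\<close> the factor \<open>2 * C\<close> per gap
    amounts to at most \<open>exp (g * n)\<close>.\<close>
  define c where "c = g / ln (2 * C)"
  have c: "0 < c"
    using g C(1) by (simp add: c_def)
  define B where "B M = slow a - (\<Union>l\<in>{m..M}. G l)" for M
  have B: "B M \<in> sets \<mu>" for M
    unfolding B_def by simp
  have "(\<lambda>M. prob (B M)) \<longlonglongrightarrow> prob (\<Inter>M. B M)"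
  proof (rule finite_Lim_measure_decseq)
    show "decseq B"
      unfolding decseq_def B_def by (auto simp: subset_eq)
  qed (use B in auto)
  \<comment> \<open>Every point of \<open>slow a\<close> starts a block of some length at least
    \<open>m\<close>, so it leaves \<open>B M\<close> as soon as \<open>M\<close> reaches that
    length.\<close>
  moreover have "(\<Inter>M. B M) = {}"
  proof -
    have "\<exists>M. x \<notin> B M" if x: "x \<in> slow a" for x
    proof -
      obtain n where "m \<le> n" "exp (- (a + g) * real n) \<le> prob (rep_ball \<phi> x (real n) \<epsilon>)"
        using slowD[OF x g \<epsilon>(1), of m] by (elim exE conjE)
      then have "m \<le> n" "x \<in> G n"
        by (simp_all add: G_def b_def)
      then show ?thesis
        by (intro exI[of _ n]) (auto simp: B_def)
    qed
    then show ?thesis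
      by (auto simp: B_def)
  qed
  ultimately have "(\<lambda>M. prob (B M)) \<longlonglongrightarrow> 0"
    by simp
  then have "eventually (\<lambda>M. prob (B M) < \<delta> * c) sequentially"
    using assms(4) c by (intro order_tendstoD(2)[of _ 0]) auto
  then obtain M where M: "prob (B M) < \<delta> * c"
    by (auto dest!: eventually_happens)
  obtain D where D: "D \<in> sets \<mu>" "prob D \<le> prob (B M) / c"
    "\<forall>x\<in>space \<mu> - D. \<forall>n. real (card {i\<in>{..<n}. (\<phi> 1 ^^ i) x \<in> B M}) \<le> c * real n"
    using maximal_frequency[OF measurable_flow distr_flow B c, of M 1] by (elim bexE conjE)
  define Z where "Z n = {x. card {i\<in>{..<n}. (\<phi> 1 ^^ i) x \<notin> (\<Union>l\<in>{m..M}. G l)} \<le> nat \<lfloor>c * real n\<rfloor>}" for n :: nat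
  define \<theta> where "\<theta> n = exp (- (a + \<gamma>) * real n)" for n :: nat
  define K where "K = exp (\<beta> * real M)"
  have Z: "coverable (\<phi> 1) (Z n) n \<epsilon>' (K * exp ((\<beta> + g) * real n))" for n
  proof -
    have "coverable (\<phi> 1) (Z n) n \<epsilon>' (exp (\<beta> * (real n + real M)) * (2 * C) ^ nat \<lfloor>c * real n\<rfloor>)"
      unfolding Z_def
    proof (rule coverable_blocks[OF C \<beta>(1) _ _ m(2)[rule_format]])
      show "coverable (\<phi> 1) (G l) l \<epsilon>' (exp ((\<beta> - g) * real l))" if "m \<le> l" for l
        unfolding \<beta>(2) G_def using that m(1) by (intro \<epsilon>(2)[rule_format]) simp
    qed (use m(1) in simp)
    then show ?thesis
    proof (rule coverable_mono)
      have "(2 * C) ^ nat \<lfloor>c * real n\<rfloor> = exp (real (nat \<lfloor>c * real n\<rfloor>) * ln (2 * C))"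
        using C(1) by (simp add: exp_of_nat_mult)
      also have "\<dots> \<le> exp ((c * real n) * ln (2 * C))"
        using C(1) c by (intro iffD2[OF exp_le_cancel_iff] mult_right_mono) auto
      also have "(c * real n) * ln (2 * C) = g * real n"
        using C(1) by (simp add: c_def)
      finally have "exp (\<beta> * (real n + real M)) * (2 * C) ^ nat \<lfloor>c * real n\<rfloor> \<le>
          exp (\<beta> * (real n + real M)) * exp (g * real n)"
        by (rule mult_left_mono) simp
      also have "\<dots> = K * exp ((\<beta> + g) * real n)"
        unfolding K_def by (simp add: algebra_simps flip: exp_add)
      finally show "exp (\<beta> * (real n + real M)) * (2 * C) ^ nat \<lfloor>c * real n\<rfloor> \<le> K * exp ((\<beta> + g) * real n)" .
    qed auto
  qed
  have "\<forall>n. \<exists>V. V \<in> sets \<mu> \<and> prob V \<le> K * exp ((\<beta> + g) * real n) * \<theta> n \<and>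
      (\<forall>y\<in>Z n. prob (bowen_ball (\<phi> 1) y n \<epsilon>') < \<theta> n \<longrightarrow> y \<in> V)"
    using light_centres[OF Z] by (simp add: \<theta>_def Bex_def)
  then obtain V where "\<forall>n. V n \<in> sets \<mu> \<and> prob (V n) \<le> K * exp ((\<beta> + g) * real n) * \<theta> n \<and>
      (\<forall>y\<in>Z n. prob (bowen_ball (\<phi> 1) y n \<epsilon>') < \<theta> n \<longrightarrow> y \<in> V n)"
    unfolding choice_iff by (elim exE)
  then have V: "\<And>n. V n \<in> sets \<mu>" "\<And>n. prob (V n) \<le> K * exp ((\<beta> + g) * real n) * \<theta> n"
    "\<And>n y. y \<in> Z n \<Longrightarrow> prob (bowen_ball (\<phi> 1) y n \<epsilon>') < \<theta> n \<Longrightarrow> y \<in> V n"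
    by simp_all
  have "K * exp ((\<beta> + g) * real n) * \<theta> n \<le> K * exp (- g) ^ n" for n
  proof -
    have "exp ((\<beta> + g) * real n) * \<theta> n = exp ((\<beta> + g - a - \<gamma>) * real n)"
      unfolding \<theta>_def by (simp add: algebra_simps flip: exp_add)
    also have "\<dots> \<le> exp (- g * real n)"
      using g by (intro iffD2[OF exp_le_cancel_iff] mult_right_mono) (auto simp: \<beta>_def b_def g_def)
    also have "\<dots> = exp (- g) ^ n"
      by (rule exp_of_nat2_mult)
    finally show ?thesis
      by (simp add: K_def)
  qed
  then have V': "prob (V n) \<le> K * exp (- g) ^ n" for n
    using V(2)[of n] order_trans by blast
  have "summable (\<lambda>n. K * exp (- g) ^ n)"
    using g by (intro summable_mult summable_geometric) simp
  then have "summable (\<lambda>n. prob (V n))"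
    by (rule summable_comparison_test'[where N = 0]) (use V' in simp)
  then have "AE x in \<mu>. eventually (\<lambda>n. x \<in> space \<mu> - V n) sequentially"
    by (intro borel_cantelli_AE1 V) (auto simp: less_top[symmetric])
  then have "AE x in \<mu>. x \<in> slow a \<longrightarrow> x \<notin> D \<longrightarrow>
       (\<forall>\<^sub>F n in sequentially. exp (- (a + \<gamma>) * real n) \<le> prob (bowen_ball (\<phi> 1) x n \<epsilon>'))"
  proof (rule AE_mp, intro AE_I2 impI)
    fix x assume ev: "eventually (\<lambda>n. x \<in> space \<mu> - V n) sequentially" and x: "x \<in> slow a" "x \<notin> D"
    have "x \<in> Z n" for n
    proof -
      \<comment> \<open>Here forward invariance of \<open>slow a\<close> enters: along such an orbit
        the gaps are exactly the visits to \<open>B M\<close>.\<close>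
      have "{i\<in>{..<n}. (\<phi> 1 ^^ i) x \<notin> (\<Union>l\<in>{m..M}. G l)} = {i\<in>{..<n}. (\<phi> 1 ^^ i) x \<in> B M}"
        using iterate_slow[OF x(1) a] by (auto simp: B_def)
      then show ?thesis
        using D(3)[rule_format, of x n] x(2) by (simp add: Z_def le_nat_floor)
    qed
    then have "x \<in> space \<mu> - V n \<Longrightarrow> \<theta> n \<le> prob (bowen_ball (\<phi> 1) x n \<epsilon>')" for n
      using V(3)[of x n] by force
    then show "\<forall>\<^sub>F n in sequentially. exp (- (a + \<gamma>) * real n) \<le> prob (bowen_ball (\<phi> 1) x n \<epsilon>')"
      using ev unfolding \<theta>_def by (rule eventually_mono[rotated])
  qed
  moreover have "prob (B M) / c \<le> \<delta>"
    using M c by (simp add: field_simps)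
  ultimately show thesis
    using that[OF D(1)] D(2) by simp
qed

text \<open>The bad set \<open>W\<close> does not depend on \<delta>, and up to a null set it lies
  in the exceptional set for every \<delta>.\<close>

lemma AE_slow_bowen_ball:
  assumes "0 \<le> a" and "0 < \<epsilon>'" "0 < \<gamma>"
  shows "AE x in \<mu>. x \<in> slow a \<longrightarrow>
    (\<forall>\<^sub>F n in sequentially. exp (- (a + \<gamma>) * real n) \<le> prob (bowen_ball (\<phi> 1) x n \<epsilon>'))"
proof -
  define W where "W = {x \<in> space borel. x \<in> slow a \<and> \<not> (\<exists>N. \<forall>n. N \<le> n \<longrightarrow>
    exp (- (a + \<gamma>) * real n) \<le> prob (bowen_ball (\<phi> 1) x n \<epsilon>'))}"
  have W: "W \<in> sets borel"
    unfolding W_def by measurable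
  have "prob W \<le> 0 + \<delta>" if \<delta>: "0 < \<delta>" for \<delta>
  proof -
    obtain D where D: "D \<in> sets \<mu>" "prob D \<le> \<delta>" "AE x in \<mu>. x \<in> slow a \<longrightarrow> x \<notin> D \<longrightarrow>
       (\<forall>\<^sub>F n in sequentially. exp (- (a + \<gamma>) * real n) \<le> prob (bowen_ball (\<phi> 1) x n \<epsilon>'))"
      by (rule AE_slow_bowen_ball_outside[OF assms \<delta>]) (rule that)
    have "prob W \<le> prob D"
    proof (rule finite_measure_mono_AE)
      show "AE x in \<mu>. x \<in> W \<longrightarrow> x \<in> D"
        using D(3) by eventually_elim (auto simp: W_def eventually_sequentially)
    qed (use D in auto)
    then show ?thesis
      using D(2) by simp
  qed
  then have "prob W \<le> 0"
    by (rule field_le_epsilon)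
  then have "emeasure \<mu> W = 0"
    by (simp add: emeasure_eq_measure measure_le_0_iff)
  then have "AE x in \<mu>. x \<notin> W"
    using W by (intro AE_not_in) (simp add: null_sets_def)
  then show ?thesis
    by eventually_elim (auto simp: W_def eventually_sequentially)
qed

end

section \<open>Entropy of finite partitions\<close>

text \<open>Fekete's lemma: division of \<open>n\<close> by a nearly optimal \<open>N\<close> with
  remainder shows that the quotients tend to their infimum.\<close>

lemma subadditive_convergent:
  fixes a :: "nat \<Rightarrow> real"
  assumes nonneg: "\<And>n. 0 \<le> a n" and sub: "\<And>m n. a (m + n) \<le> a m + a n"
  shows "convergent (\<lambda>n. a n / real n)"
proof -
  define L where "L = (INF n\<in>{1..}. a n / real n)"
  have bdd: "bdd_below ((\<lambda>n. a n / real n) ` {1..})"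
    using nonneg by (intro bdd_belowI[of _ 0]) auto
  have mult: "a (q * N + r) \<le> real q * a N + a r" for q N r
  proof (induction q)
    case (Suc q)
    have "a (Suc q * N + r) \<le> a N + a (q * N + r)"
      using sub[of N "q * N + r"] by (simp add: add.assoc)
    then show ?case
      using Suc by (simp add: algebra_simps)
  qed simp
  have "(\<lambda>n. a n / real n) \<longlonglongrightarrow> L"
  proof (rule order_tendstoI)
    fix l assume "l < L"
    have "L \<le> a n / real n" if "1 \<le> n" for n
      unfolding L_def using that bdd by (intro cINF_lower) auto
    then show "eventually (\<lambda>n. l < a n / real n) sequentially"
      using \<open>l < L\<close> unfolding eventually_sequentially by (intro exI[of _ 1]) force
  next
    fix u assume "L < u"
    then obtain N where N: "1 \<le> N" "a N / real N < u"
      unfolding L_def by (subst (asm) cINF_less_iff[OF _ bdd]) auto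
    define R where "R = Max (a ` {..<N})"
    have R: "a r \<le> R" if "r < N" for r
      unfolding R_def using that by (intro Max_ge) auto
    have "(\<lambda>n. a N / real N + R / real n) \<longlonglongrightarrow> a N / real N + 0"
      by (intro tendsto_add tendsto_const lim_const_over_n)
    then have "eventually (\<lambda>n. a N / real N + R / real n < u) sequentially"
      using N(2) by (intro order_tendstoD(2)[of _ "a N / real N"]) auto
    then show "eventually (\<lambda>n. a n / real n < u) sequentially"
      using eventually_gt_at_top[of 0]
    proof eventually_elim
      case (elim n)
      have "a n \<le> real (n div N) * a N + a (n mod N)"
        using mult[of "n div N" N "n mod N"] by simp
      also have "\<dots> \<le> real (n div N) * a N + R"
        using R[of "n mod N"] N(1) by simp
      also have "\<dots> \<le> (real n / real N) * a N + R"
        using nonneg[of N] N(1) by (intro add_right_mono mult_right_mono)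
          (simp_all add: le_divide_eq flip: of_nat_mult)
      finally have "a n / real n \<le> a N / real N + R / real n"
        using elim(2) by (simp add: field_simps)
      then show ?case
        using elim(1) by simp
    qed
  qed
  then show ?thesis
    by (rule convergentI)
qed

text \<open>\<open>Lim\<close> carries information only when the limit exists; monotonicity in the
  radius provides existence and turns the local entropies into suprema.\<close>

lemma Lim_at_right_antimono:
  fixes F :: "real \<Rightarrow> ennreal"
  assumes "\<And>x y. 0 < x \<Longrightarrow> x \<le> y \<Longrightarrow> F y \<le> F x"
  shows "Lim (at_right 0) F = (SUP x\<in>{0<..}. F x)"
proof (rule tendsto_Lim)
  show "(F \<longlongrightarrow> (SUP x\<in>{0<..}. F x)) (at_right 0)"
  proof (rule order_tendstoI)
    fix l assume "l < (SUP x\<in>{0<..}. F x)"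
    then obtain x where x: "0 < x" "l < F x"
      by (auto simp: less_SUP_iff)
    have "eventually (\<lambda>y. y \<in> {0<..<x}) (at_right 0)"
      using x(1) by (rule eventually_at_right_real)
    then show "eventually (\<lambda>y. l < F y) (at_right 0)"
      by eventually_elim (use x assms in \<open>auto intro: less_le_trans\<close>)
  next
    fix u assume u: "(SUP x\<in>{0<..}. F x) < u"
    have "eventually (\<lambda>y::real. y \<in> {0<..<1}) (at_right 0)"
      by (rule eventually_at_right_real) simp
    then show "eventually (\<lambda>y. F y < u) (at_right 0)"
      by eventually_elim (use u in \<open>auto intro: le_less_trans[OF SUP_upper]\<close>)
  qed
qed simp

text \<open>The sets with such approximations form a sigma-algebra. It contains the closed sets,
  because a nonempty closed set is the intersection of its open neighbourhoods
  \<open>U n\<close>.\<close>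

lemma borel_regular:
  fixes M :: "'a::metric_space measure"
  assumes "finite_measure M" and M: "sets M = sets borel" and "B \<in> sets borel" and "0 < \<delta>"
  shows "\<exists>F U. closed F \<and> open U \<and> F \<subseteq> B \<and> B \<subseteq> U \<and> measure M (U - F) < \<delta>"
proof -
  interpret finite_measure M by fact
  have space: "space M = UNIV"
    using sets_eq_imp_space_eq[OF M] by simp
  have oc: "A \<in> sets M" if "open A \<or> closed A" for A
    using that by (auto simp: M)
  have "B \<in> sigma_sets UNIV (Collect closed)"
    using assms(3) by (simp add: borel_eq_closed)
  then have "\<forall>\<delta>>0. \<exists>F U. closed F \<and> open U \<and> F \<subseteq> B \<and> B \<subseteq> U \<and> measure M (U - F) < \<delta>"
  proof (induction B)
    case (Basic B)
    then have B: "closed B" by simp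
    show ?case
    proof (cases "B = {}")
      case True
      then show ?thesis
        by (intro allI impI exI[of _ "{}"]) auto
    next
      case False
      define U where "U n = {x. infdist x B < 1 / real (Suc n)}" for n
      have U: "open (U n)" for n
        unfolding U_def by (intro open_Collect_less continuous_intros)
      have "(\<lambda>n. measure M (U n)) \<longlonglongrightarrow> measure M (\<Inter>n. U n)"
      proof (rule finite_Lim_measure_decseq)
        show "decseq U"
          unfolding decseq_Suc_iff U_def by (auto intro: less_le_trans simp: frac_le)
      qed (use U oc in auto)
      moreover have "(\<Inter>n. U n) = B"
      proof (intro equalityI subsetI)
        fix x assume "x \<in> (\<Inter>n. U n)"
        then have "infdist x B \<le> 1 / real (Suc n)" for n
          by (auto simp: U_def intro: less_imp_le)
        then have "infdist x B \<le> 0"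
          using LIMSEQ_le_const[OF LIMSEQ_inverse_real_of_nat, of "infdist x B"] by (auto simp: inverse_eq_divide)
        then show "x \<in> B"
          using in_closed_iff_infdist_zero[OF B False] infdist_nonneg[of x B] by simp
      qed (auto simp: U_def)
      ultimately have lim: "(\<lambda>n. measure M (U n)) \<longlonglongrightarrow> measure M B"
        by simp
      show ?thesis
      proof (intro allI impI)
        fix \<delta> :: real assume "0 < \<delta>"
        then have "eventually (\<lambda>n. measure M (U n) < measure M B + \<delta>) sequentially"
          by (intro order_tendstoD(2)[OF lim]) simp
        then obtain n where "measure M (U n) < measure M B + \<delta>"
          by (auto dest!: eventually_happens)
        moreover have "B \<subseteq> U n"
          by (auto simp: U_def)
        ultimately show "\<exists>F U. closed F \<and> open U \<and> F \<subseteq> B \<and> B \<subseteq> U \<and> measure M (U - F) < \<delta>"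
          using B U oc by (intro exI[of _ B] exI[of _ "U n"]) (auto simp: finite_measure_Diff)
      qed
    qed
  next
    case Empty
    then show ?case
      by (intro allI impI exI[of _ "{}"]) auto
  next
    case (Compl B)
    show ?case
    proof (intro allI impI)
      fix \<delta> :: real assume "0 < \<delta>"
      then obtain F U where FU: "closed F" "open U" "F \<subseteq> B" "B \<subseteq> U" "measure M (U - F) < \<delta>"
        using Compl.IH by meson
      moreover have "- F - (- U) = U - F"
        by auto
      ultimately show "\<exists>F U. closed F \<and> open U \<and> F \<subseteq> UNIV - B \<and> UNIV - B \<subseteq> U \<and> measure M (U - F) < \<delta>"
        by (intro exI[of _ "- U"] exI[of _ "- F"]) auto
    qed
  next
    case (Union B)
    show ?case
    proof (intro allI impI)
      fix \<delta> :: real assume "0 < \<delta>"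
      \<comment> \<open>The errors add up to \<open>\<delta> / 2\<close>. The other half is spent on
        replacing the countable union of the closed sets \<open>F i\<close>, which need not be
        closed, by a finite one.\<close>
      define e where "e i = \<delta> / 4 * (1 / 2) ^ i" for i :: nat
      have e: "0 < e i" for i
        using \<open>0 < \<delta>\<close> by (simp add: e_def)
      have "\<forall>i. \<exists>F U. closed F \<and> open U \<and> F \<subseteq> B i \<and> B i \<subseteq> U \<and> measure M (U - F) < e i"
        using Union.IH e by simp
      then obtain F U where "\<forall>i. closed (F i) \<and> open (U i) \<and> F i \<subseteq> B i \<and> B i \<subseteq> U i \<and> measure M (U i - F i) < e i"
        unfolding choice_iff by (elim exE)
      then have FU: "\<And>i. closed (F i)" "\<And>i. open (U i)" "\<And>i. F i \<subseteq> B i" "\<And>i. B i \<subseteq> U i"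
        "\<And>i. measure M (U i - F i) < e i"
        by simp_all
      have "(\<lambda>n. measure M (\<Union>i\<in>{..<n}. F i)) \<longlonglongrightarrow> measure M (\<Union>n. \<Union>i\<in>{..<n}. F i)"
      proof (rule finite_Lim_measure_incseq)
        show "incseq (\<lambda>n. \<Union>i\<in>{..<n}. F i)"
          unfolding incseq_def by (intro allI impI UN_mono) auto
      qed (use FU oc in \<open>auto intro!: sets.finite_UN\<close>)
      also have "(\<Union>n. \<Union>i\<in>{..<n}. F i) = (\<Union>i. F i)"
        by auto
      finally have "eventually (\<lambda>n. measure M (\<Union>i. F i) - \<delta> / 2 < measure M (\<Union>i\<in>{..<n}. F i)) sequentially"
        using \<open>0 < \<delta>\<close> by (intro order_tendstoD(1)) auto
      then obtain n where n: "measure M (\<Union>i. F i) - \<delta> / 2 < measure M (\<Union>i\<in>{..<n}. F i)"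
        by (auto dest!: eventually_happens)
      have sF: "(\<Union>i. F i) \<in> sets M" "(\<Union>i\<in>{..<n}. F i) \<in> sets M" "(\<Union>i. U i) \<in> sets M" "\<And>i. U i - F i \<in> sets M"
        using FU oc by (auto intro!: sets.countable_UN sets.finite_UN)
      have sum_e: "e sums (\<delta> / 2)"
        using sums_mult[OF geometric_sums[of "1 / 2 :: real"], of "\<delta> / 4"] unfolding e_def by simp
      have summable: "summable (\<lambda>i. measure M (U i - F i))"
        by (rule summable_comparison_test'[OF sums_summable[OF sum_e], where N = 0])
           (use FU(5) in \<open>auto intro: less_imp_le\<close>)
      have "measure M ((\<Union>i. U i) - (\<Union>i. F i)) \<le> measure M (\<Union>i. U i - F i)"
        using sF by (intro finite_measure_mono) (auto intro!: sets.countable_UN)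
      also have "\<dots> \<le> (\<Sum>i. measure M (U i - F i))"
        using sF summable by (intro finite_measure_subadditive_countably) auto
      also have "\<dots> \<le> (\<Sum>i. e i)"
        using FU(5) by (intro suminf_le summable sums_summable[OF sum_e] less_imp_le)
      also have "\<dots> = \<delta> / 2"
        using sum_e by (rule sums_unique[symmetric])
      finally have 1: "measure M ((\<Union>i. U i) - (\<Union>i. F i)) \<le> \<delta> / 2" .
      have 2: "measure M ((\<Union>i. F i) - (\<Union>i\<in>{..<n}. F i)) < \<delta> / 2"
        using n sF by (subst finite_measure_Diff) auto
      have "measure M ((\<Union>i. U i) - (\<Union>i\<in>{..<n}. F i)) \<le>
          measure M (((\<Union>i. U i) - (\<Union>i. F i)) \<union> ((\<Union>i. F i) - (\<Union>i\<in>{..<n}. F i)))"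
        using sF by (intro finite_measure_mono) auto
      also have "\<dots> \<le> measure M ((\<Union>i. U i) - (\<Union>i. F i)) + measure M ((\<Union>i. F i) - (\<Union>i\<in>{..<n}. F i))"
        using sF by (intro measure_Un_le) auto
      finally have "measure M ((\<Union>i. U i) - (\<Union>i\<in>{..<n}. F i)) < \<delta>"
        using 1 2 by simp
      then show "\<exists>F U. closed F \<and> open U \<and> F \<subseteq> (\<Union>i. B i) \<and> (\<Union>i. B i) \<subseteq> U \<and> measure M (U - F) < \<delta>"
        using FU by (intro exI[of _ "\<Union>i\<in>{..<n}. F i"] exI[of _ "\<Union>i. U i"]) (auto, blast+)
    qed
  qed
  then show ?thesis
    using assms(4) by simp
qed

section \<open>The Gibbs inequality for simple functions\<close>

context prob_space
begin

lemma integral_simple_comp: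
  fixes F :: "'b \<Rightarrow> real"
  assumes "simple_function M f"
  shows "integrable M (\<lambda>x. F (f x))"
    "(\<integral>x. F (f x) \<partial>M) = (\<Sum>w\<in>f ` space M. prob (f -` {w} \<inter> space M) * F w)"
proof -
  have fin: "finite (f ` space M)" and sets: "w \<in> f ` space M \<Longrightarrow> f -` {w} \<inter> space M \<in> events" for w
    using assms by (auto simp: simple_function_def)
  let ?G = "\<lambda>x. \<Sum>w\<in>f ` space M. F w * indicator (f -` {w} \<inter> space M) x"
  have eq: "F (f x) = ?G x" if "x \<in> space M" for x
  proof -
    have "?G x = (\<Sum>w\<in>f ` space M. if w = f x then F w else 0)"
      using that by (intro sum.cong) (auto simp: indicator_def)
    then show ?thesis
      using that fin by simp
  qed
  have int: "integrable M (\<lambda>x. F w * indicator (f -` {w} \<inter> space M) x)" if "w \<in> f ` space M" for w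
    using sets[OF that] by (intro integrable_mult_right integrable_real_indicator) (auto simp: less_top[symmetric])
  show "integrable M (\<lambda>x. F (f x))"
    using int by (subst Bochner_Integration.integrable_cong[OF refl eq]) (auto intro!: Bochner_Integration.integrable_sum)
  have "(\<integral>x. F (f x) \<partial>M) = (\<integral>x. ?G x \<partial>M)"
    by (intro Bochner_Integration.integral_cong refl eq)
  also have "\<dots> = (\<Sum>w\<in>f ` space M. \<integral>x. F w * indicator (f -` {w} \<inter> space M) x \<partial>M)"
    by (rule Bochner_Integration.integral_sum) (rule int)
  also have "\<dots> = (\<Sum>w\<in>f ` space M. prob (f -` {w} \<inter> space M) * F w)"
    using sets by (intro sum.cong) (auto simp: mult.commute)
  finally show "(\<integral>x. F (f x) \<partial>M) = (\<Sum>w\<in>f ` space M. prob (f -` {w} \<inter> space M) * F w)" .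
qed

lemma sum_prob_simple:
  assumes "simple_function M f"
  shows "(\<Sum>w\<in>f ` space M. prob (f -` {w} \<inter> space M)) = 1"
  using integral_simple_comp(2)[OF assms, of "\<lambda>_. 1"] by (simp add: prob_space)

lemma AE_simple_pos:
  assumes "simple_function M f"
  shows "AE x in M. 0 < prob (f -` {f x} \<inter> space M)"
proof -
  define W where "W = {w \<in> f ` space M. prob (f -` {w} \<inter> space M) = 0}"
  have "finite W" and null: "w \<in> W \<Longrightarrow> f -` {w} \<inter> space M \<in> null_sets M" for w
    using assms by (auto simp: W_def simple_function_def null_sets_def emeasure_eq_measure)
  then have "(\<Union>w\<in>W. f -` {w} \<inter> space M) \<in> null_sets M"
    by (intro null_sets_UN') (auto intro: countable_finite)
  then show ?thesis
    by (rule AE_I') (auto simp: W_def zero_less_measure_iff)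
qed

text \<open>Nonnegativity of relative entropy, from \<open>ln t \<le> t - 1\<close> at the ratio of
  \<open>q w\<close> to the probability of \<open>w\<close>. It turns any explicit weight on names
  into an upper bound for entropy.\<close>

lemma gibbs_inequality:
  assumes f: "simple_function M f" and q: "\<And>w. w \<in> f ` space M \<Longrightarrow> 0 \<le> q w"
    "\<And>w. w \<in> f ` space M \<Longrightarrow> 0 < prob (f -` {w} \<inter> space M) \<Longrightarrow> 0 < q w"
    "(\<Sum>w\<in>f ` space M. q w) \<le> 1"
  shows "(\<integral>x. - ln (prob (f -` {f x} \<inter> space M)) \<partial>M) \<le> (\<integral>x. - ln (q (f x)) \<partial>M)"
proof -
  let ?p = "\<lambda>w. prob (f -` {w} \<inter> space M)"
  have "?p w * - ln (?p w) \<le> ?p w * - ln (q w) + (q w - ?p w)" if w: "w \<in> f ` space M" for w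
  proof (cases "?p w = 0")
    case False
    then have p: "0 < ?p w"
      by (simp add: zero_less_measure_iff)
    then have "0 < q w"
      using q(2) w by simp
    then have "ln (q w / ?p w) \<le> q w / ?p w - 1"
      using p by (intro ln_le_minus_one) simp
    then have "?p w * ln (q w / ?p w) \<le> ?p w * (q w / ?p w - 1)"
      using p by (intro mult_left_mono) auto
    also have "\<dots> = q w - ?p w"
      using p by (simp add: right_diff_distrib)
    finally show ?thesis
      using p \<open>0 < q w\<close> by (simp add: ln_div right_diff_distrib)
  qed (use q w in simp)
  then have "(\<Sum>w\<in>f ` space M. ?p w * - ln (?p w)) \<le> (\<Sum>w\<in>f ` space M. ?p w * - ln (q w) + (q w - ?p w))"
    by (rule sum_mono)
  also have "\<dots> \<le> (\<Sum>w\<in>f ` space M. ?p w * - ln (q w))"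
    using q(3) sum_prob_simple[OF f] by (simp add: sum.distrib sum_subtractf sum_negf)
  finally show ?thesis
    unfolding integral_simple_comp(2)[OF f, of "\<lambda>w. - ln (?p w)"] integral_simple_comp(2)[OF f, of "\<lambda>w. - ln (q w)"] .
qed

end

section \<open>Names, cells and block entropies\<close>

text \<open>The atom at \<open>x\<close> of the join of the first \<open>n\<close> pullbacks of the
  partition into fibres of \<open>N\<close>.\<close>

definition cell :: "('a \<Rightarrow> 'a) \<Rightarrow> ('a \<Rightarrow> 'b) \<Rightarrow> nat \<Rightarrow> 'a \<Rightarrow> 'a set" where
  "cell T N n x = {y. \<forall>i<n. N ((T ^^ i) y) = N ((T ^^ i) x)}"

text \<open>The restriction to \<open>{..<n}\<close> puts names into the finite set of extensional
  functions, where words can be counted and summed over.\<close>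

definition name :: "('a \<Rightarrow> 'a) \<Rightarrow> ('a \<Rightarrow> 'b) \<Rightarrow> nat \<Rightarrow> 'a \<Rightarrow> nat \<Rightarrow> 'b" where
  "name T N n x = (\<lambda>i\<in>{..<n}. N ((T ^^ i) x))"

lemma name_eq_iff: "name T N n y = name T N n x \<longleftrightarrow> y \<in> cell T N n x"
  unfolding name_def cell_def by (auto simp: restrict_def fun_eq_iff)

lemma vimage_name: "name T N n -` {name T N n x} = cell T N n x"
  by (auto simp: name_eq_iff)

lemma name_in_PiE: "name T N n x \<in> {..<n} \<rightarrow>\<^sub>E range N"
  by (auto simp: name_def)

lemma cell_add: "cell T N (m + n) x = cell T N m x \<inter> (T ^^ m) -` cell T N n ((T ^^ m) x)"
proof -
  have "(\<forall>i<m + n. N ((T ^^ i) y) = N ((T ^^ i) x)) \<longleftrightarrow>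
      (\<forall>i<m. N ((T ^^ i) y) = N ((T ^^ i) x)) \<and> (\<forall>i<n. N ((T ^^ (i + m)) y) = N ((T ^^ (i + m)) x))" for y
  proof
    assume *: "\<forall>i<m + n. N ((T ^^ i) y) = N ((T ^^ i) x)"
    show "(\<forall>i<m. N ((T ^^ i) y) = N ((T ^^ i) x)) \<and>
      (\<forall>i<n. N ((T ^^ (i + m)) y) = N ((T ^^ (i + m)) x))"
      by (intro conjI allI impI *[rule_format]) simp_all
  next
    assume *: "(\<forall>i<m. N ((T ^^ i) y) = N ((T ^^ i) x)) \<and>
      (\<forall>i<n. N ((T ^^ (i + m)) y) = N ((T ^^ (i + m)) x))"
    show "\<forall>i<m + n. N ((T ^^ i) y) = N ((T ^^ i) x)"
    proof (intro allI impI)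
      fix i assume i: "i < m + n"
      show "N ((T ^^ i) y) = N ((T ^^ i) x)"
      proof (cases "i < m")
        case False
        then have "i - m < n" "i - m + m = i"
          using i by auto
        then show ?thesis
          using conjunct2[OF *, rule_format, of "i - m"] by simp
      qed (use * in simp)
    qed
  qed
  then show ?thesis
    by (auto simp: cell_def funpow_add)
qed

context invariant_flow
begin

abbreviation "T \<equiv> \<phi> 1"

lemma measurable_iterate: "T ^^ i \<in> measurable \<mu> \<mu>"
proof -
  have "T ^^ i = \<phi> (real i)"
    by (rule ext) (rule flow_iterate)
  then show ?thesis
    using measurable_flow by simp
qed

lemma distr_iterate: "distr \<mu> \<mu> (T ^^ i) = \<mu>"
proof -
  have "T ^^ i = \<phi> (real i)"
    by (rule ext) (rule flow_iterate)
  then show ?thesis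
    using distr_flow by simp
qed

lemma simple_function_compose:
  assumes "simple_function \<mu> N" "g \<in> measurable \<mu> \<mu>"
  shows "simple_function \<mu> (\<lambda>x. N (g x))"
  unfolding simple_function_def
proof (intro conjI ballI)
  show "finite ((\<lambda>x. N (g x)) ` space \<mu>)"
    using assms(1) by (auto simp: simple_function_def elim: finite_subset[rotated])
  fix w assume "w \<in> (\<lambda>x. N (g x)) ` space \<mu>"
  then have "N -` {w} \<in> sets \<mu>"
    using assms(1) by (auto simp: simple_function_def)
  then show "(\<lambda>x. N (g x)) -` {w} \<inter> space \<mu> \<in> sets \<mu>"
    using measurable_sets[OF assms(2), of "N -` {w}"] by (simp add: vimage_def)
qed

lemma simple_function_name:
  assumes "simple_function \<mu> N"
  shows "simple_function \<mu> (name T N n)"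
  unfolding simple_function_def
proof (intro conjI ballI)
  have fin: "finite (range N)"
    using assms by (simp add: simple_function_def)
  show "finite (name T N n ` space \<mu>)"
  proof (rule finite_subset)
    show "name T N n ` space \<mu> \<subseteq> {..<n} \<rightarrow>\<^sub>E range N"
      by (rule image_subsetI) (rule name_in_PiE)
    show "finite ({..<n} \<rightarrow>\<^sub>E range N)"
      using fin by (intro finite_PiE) simp_all
  qed
  fix w assume "w \<in> name T N n ` space \<mu>"
  then obtain x where x: "w = name T N n x"
    by auto
  have meas: "{y \<in> space \<mu>. N ((T ^^ i) y) = N ((T ^^ i) x)} \<in> sets \<mu>" for i
    using simple_functionD(2)[OF simple_function_compose[OF assms measurable_iterate], of i "{N ((T ^^ i) x)}"]
    by (simp add: vimage_def)
  have "name T N n -` {w} \<inter> space \<mu> = {y \<in> space \<mu>. \<forall>i\<in>{..<n}. N ((T ^^ i) y) = N ((T ^^ i) x)}"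
    unfolding x vimage_name by (auto simp: cell_def)
  also have "\<dots> \<in> sets \<mu>"
    by (rule sets.sets_Collect_finite_All) (rule meas, simp)
  finally show "name T N n -` {w} \<inter> space \<mu> \<in> sets \<mu>" .
qed

lemma sets_cell:
  assumes "simple_function \<mu> N"
  shows "cell T N n x \<in> sets borel"
  using simple_functionD(2)[OF simple_function_name[OF assms], of n "{name T N n x}"] by (simp add: vimage_name)

text \<open>The entropy of the join as the integral of its information function, a form suited to
  pointwise estimates and to Fatou's lemma.\<close>

definition block_entropy :: "('a \<Rightarrow> 'b) \<Rightarrow> nat \<Rightarrow> real" where
  "block_entropy N n = (\<integral>x. - ln (prob (cell T N n x)) \<partial>\<mu>)"

lemma integrable_ln_cell:
  assumes "simple_function \<mu> N"
  shows "integrable \<mu> (\<lambda>x. - ln (prob (cell T N n x)))"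
  using integral_simple_comp(1)[OF simple_function_name[OF assms], of "\<lambda>w. - ln (prob (name T N n -` {w}))" n]
  by (simp add: vimage_name)

lemma AE_cell_pos:
  assumes "simple_function \<mu> N"
  shows "AE x in \<mu>. 0 < prob (cell T N n x)"
  using AE_simple_pos[OF simple_function_name[OF assms], of n] by (simp add: vimage_name)

lemma block_entropy_nonneg: "0 \<le> block_entropy N n"
proof -
  have "ln (prob (cell T N n x)) \<le> 0" for x
    using ln_le_zero_iff[of "prob (cell T N n x)"] prob_le_1
    by (cases "prob (cell T N n x) = 0") (auto simp: zero_less_measure_iff)
  then show ?thesis
    unfolding block_entropy_def by (intro Bochner_Integration.integral_nonneg) simp
qed

text \<open>
  The product of the distributions of the first \<open>m\<close> and of the following \<open>n\<close> symbols is an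
  admissible weight in the Gibbs inequality.
\<close>

lemma block_entropy_subadditive:
  assumes N: "simple_function \<mu> N"
  shows "block_entropy N (m + n) \<le> block_entropy N m + block_entropy N n"
proof -
  define f where "f x = (name T N m x, name T N n ((T ^^ m) x))" for x
  define p where "p k w = prob (name T N k -` {w})" for k w
  define q where "q u = p m (fst u) * p n (snd u)" for u
  note sm = simple_function_name[OF N, of m]
  note sn = simple_function_name[OF N, of n]
  note sn' = simple_function_compose[OF sn measurable_iterate[of m]]
  have f: "simple_function \<mu> f"
    unfolding f_def by (rule simple_function_Pair[OF sm sn'])
  have level: "f -` {f x} = cell T N (m + n) x" for x
    by (auto simp: f_def name_eq_iff cell_add)
  have sum_p: "(\<Sum>w\<in>range (name T N k). p k w) = 1" for k
    using sum_prob_simple[OF simple_function_name[OF N, of k]] by (simp add: p_def)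
  have fin: "finite (range (name T N k))" for k
    using simple_function_name[OF N, of k] by (simp add: simple_function_def)
  have "block_entropy N (m + n) = (\<integral>x. - ln (prob (f -` {f x} \<inter> space \<mu>)) \<partial>\<mu>)"
    by (simp add: block_entropy_def level)
  also have "\<dots> \<le> (\<integral>x. - ln (q (f x)) \<partial>\<mu>)"
  proof (rule gibbs_inequality[OF f])
    show "0 \<le> q w" for w
      by (simp add: q_def p_def)
    show "0 < q w" if w: "w \<in> f ` space \<mu>" "0 < prob (f -` {w} \<inter> space \<mu>)" for w
    proof -
      obtain x where x: "w = f x"
        using w(1) by auto
      have pos: "0 < prob (cell T N (m + n) x)"
        using w(2) by (simp add: x level)
      have "prob (cell T N (m + n) x) \<le> prob (cell T N m x)"
        by (intro finite_measure_mono) (auto simp: cell_add sets_cell[OF N])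
      moreover have "prob (cell T N (m + n) x) \<le> prob ((T ^^ m) -` cell T N n ((T ^^ m) x))"
        using measurable_sets[OF measurable_iterate[of m], of "cell T N n ((T ^^ m) x)"]
        by (intro finite_measure_mono) (auto simp: cell_add sets_cell[OF N])
      moreover have "prob ((T ^^ m) -` cell T N n ((T ^^ m) x)) = prob (cell T N n ((T ^^ m) x))"
        using measure_distr[OF measurable_iterate[of m], of "cell T N n ((T ^^ m) x)"]
        by (simp add: distr_iterate sets_cell[OF N])
      ultimately show ?thesis
        using pos by (simp add: q_def p_def x f_def vimage_name)
    qed
    have "(\<Sum>w\<in>f ` space \<mu>. q w) \<le> (\<Sum>w\<in>range (name T N m) \<times> range (name T N n). q w)"
      using fin by (intro sum_mono2) (auto simp: f_def q_def p_def)
    also have "\<dots> = (\<Sum>u\<in>range (name T N m). p m u) * (\<Sum>v\<in>range (name T N n). p n v)"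
      by (simp add: q_def sum_product sum.cartesian_product case_prod_beta)
    also have "\<dots> = 1"
      by (simp add: sum_p)
    finally show "(\<Sum>w\<in>f ` space \<mu>. q w) \<le> 1" .
  qed
  \<comment> \<open>As \<open>ln 0 = 0\<close>, the logarithm of a product does not split at null
    cells; hence the equality is only almost everywhere.\<close>
  also have "\<dots> = (\<integral>x. - ln (prob (cell T N m x)) + - ln (prob (cell T N n ((T ^^ m) x))) \<partial>\<mu>)"
  proof (rule integral_cong_AE)
    show "(\<lambda>x. - ln (q (f x))) \<in> borel_measurable \<mu>"
      using integral_simple_comp(1)[OF f, of "\<lambda>w. - ln (q w)"] by (rule borel_measurable_integrable)
    show "(\<lambda>x. - ln (prob (cell T N m x)) + - ln (prob (cell T N n ((T ^^ m) x)))) \<in> borel_measurable \<mu>"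
      using measurable_compose[OF measurable_iterate borel_measurable_integrable[OF integrable_ln_cell[OF N, of n]], of m]
      by (intro borel_measurable_add borel_measurable_integrable[OF integrable_ln_cell[OF N, of m]])
    have "AE x in distr \<mu> \<mu> (T ^^ m). 0 < prob (cell T N n x)"
      using AE_cell_pos[OF N, of n] unfolding distr_iterate .
    then have "AE x in \<mu>. 0 < prob (cell T N n ((T ^^ m) x))"
      by (rule AE_distrD[OF measurable_iterate])
    then show "AE x in \<mu>. - ln (q (f x)) = - ln (prob (cell T N m x)) + - ln (prob (cell T N n ((T ^^ m) x)))"
      using AE_cell_pos[OF N, of m]
      by eventually_elim (simp add: q_def p_def f_def vimage_name ln_mult_pos)
  qed
  also have "\<dots> = block_entropy N m + (\<integral>x. - ln (prob (cell T N n ((T ^^ m) x))) \<partial>\<mu>)"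
  proof -
    have "integrable (distr \<mu> \<mu> (T ^^ m)) (\<lambda>x. - ln (prob (cell T N n x)))"
      using integrable_ln_cell[OF N, of n] by (simp only: distr_iterate)
    then have "integrable \<mu> (\<lambda>x. - ln (prob (cell T N n ((T ^^ m) x))))"
      by (rule integrable_distr[OF measurable_iterate])
    then show ?thesis
      unfolding block_entropy_def by (rule Bochner_Integration.integral_add[OF integrable_ln_cell[OF N]])
  qed
  also have "(\<integral>x. - ln (prob (cell T N n ((T ^^ m) x))) \<partial>\<mu>) = block_entropy N n"
    using integral_distr[OF measurable_iterate borel_measurable_integrable[OF integrable_ln_cell[OF N, of n]], of m]
    by (simp only: distr_iterate block_entropy_def)
  finally show ?thesis .
qed

text \<open>The labelling by cells turns a partition into a simple function, to which names and
  block entropies apply.\<close>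

definition symbol :: "'a set set \<Rightarrow> 'a \<Rightarrow> 'a set" where
  "symbol P x = (THE A. A \<in> P \<and> x \<in> A)"

lemma symbol_eq:
  assumes "finite_measurable_partition \<mu> P" "A \<in> P" "x \<in> A"
  shows "symbol P x = A"
proof -
  have "disjoint P"
    using assms(1) by (simp add: finite_measurable_partition_def partition_on_def)
  then show ?thesis
    unfolding symbol_def using assms(2,3) by (intro the_equality) (auto simp: disjoint_def)
qed

lemma symbol_in:
  assumes "finite_measurable_partition \<mu> P"
  shows "symbol P x \<in> P" "x \<in> symbol P x"
proof -
  have "\<Union>P = UNIV"
    using assms by (simp add: finite_measurable_partition_def partition_on_def)
  then obtain A where "A \<in> P" "x \<in> A"
    by auto
  then show "symbol P x \<in> P" "x \<in> symbol P x"
    using symbol_eq[OF assms] by auto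
qed

lemma vimage_symbol:
  assumes "finite_measurable_partition \<mu> P" "A \<in> P"
  shows "symbol P -` {A} = A"
  using symbol_eq[OF assms] symbol_in(2)[OF assms(1)] by auto

lemma simple_function_symbol:
  assumes "finite_measurable_partition \<mu> P"
  shows "simple_function \<mu> (symbol P)"
  unfolding simple_function_def
proof (intro conjI ballI)
  show "finite (symbol P ` space \<mu>)"
    by (rule finite_subset[of _ P])
       (use symbol_in(1)[OF assms] assms in \<open>auto simp: finite_measurable_partition_def\<close>)
  fix A assume "A \<in> symbol P ` space \<mu>"
  then have "A \<in> P"
    using symbol_in(1)[OF assms] by auto
  then show "symbol P -` {A} \<inter> space \<mu> \<in> sets \<mu>"
    using assms vimage_symbol[OF assms] by (auto simp: finite_measurable_partition_def)
qed

text \<open>\<open>common_refinement\<close> takes a set of partitions, so equal pullbacks at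
  different times occur once and choices are indexed by partitions instead of times. The
  descriptions agree because a choice with nonempty intersection is determined by any point of
  it.\<close>

lemma dynamical_join_eq:
  assumes P: "finite_measurable_partition \<mu> P"
  shows "dynamical_join \<mu> T n P = range (cell T (symbol P) n)"
proof -
  let ?Q = "\<lambda>i. pullback_partition \<mu> (T ^^ i) P"
  have pull: "X \<in> ?Q i \<longleftrightarrow> (\<exists>x. X = {y. symbol P ((T ^^ i) y) = symbol P ((T ^^ i) x)})" for X i
  proof
    assume "X \<in> ?Q i"
    then obtain A where A: "A \<in> P" "X = (T ^^ i) -` A" "X \<noteq> {}"
      by (auto simp: pullback_partition_def)
    then obtain x where x: "(T ^^ i) x \<in> A"
      by auto
    then have "symbol P ((T ^^ i) x) = A"
      using symbol_eq[OF P A(1)] by simp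
    then have "X = {y. symbol P ((T ^^ i) y) = symbol P ((T ^^ i) x)}"
      using A vimage_symbol[OF P A(1)] by auto
    then show "\<exists>x. X = {y. symbol P ((T ^^ i) y) = symbol P ((T ^^ i) x)}" ..
  next
    assume "\<exists>x. X = {y. symbol P ((T ^^ i) y) = symbol P ((T ^^ i) x)}"
    then obtain x where x: "X = {y. symbol P ((T ^^ i) y) = symbol P ((T ^^ i) x)}" ..
    then have "X = (T ^^ i) -` symbol P ((T ^^ i) x)"
      using vimage_symbol[OF P symbol_in(1)[OF P, of "(T ^^ i) x"]] by auto
    moreover have "X \<noteq> {}"
      using x by auto
    ultimately show "X \<in> ?Q i"
      using symbol_in(1)[OF P] by (auto simp: pullback_partition_def)
  qed
  have sel: "X = {y. symbol P ((T ^^ i) y) = symbol P ((T ^^ i) x)}" if "X \<in> ?Q i" "x \<in> X" for X i x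
    using that unfolding pull by auto
  have inter: "\<Inter>(f ` ?Q ` {..<n}) = cell T (symbol P) n x"
    if f: "\<And>i. i < n \<Longrightarrow> f (?Q i) \<in> ?Q i" and x: "x \<in> \<Inter>(f ` ?Q ` {..<n})" for f x
  proof -
    have "f (?Q i) = {y. symbol P ((T ^^ i) y) = symbol P ((T ^^ i) x)}" if "i < n" for i
      using sel[OF f[OF that]] x that by auto
    then show ?thesis
      by (auto simp: cell_def)
  qed
  show ?thesis
    unfolding dynamical_join_def common_refinement
  proof (intro equalityI subsetI)
    fix X assume "X \<in> (\<Union>f\<in>\<Pi> P\<in>?Q ` {..<n}. P. {\<Inter>(f ` ?Q ` {..<n})}) - {{}}"
    then obtain f where f: "f \<in> (\<Pi> P\<in>?Q ` {..<n}. P)" "X = \<Inter>(f ` ?Q ` {..<n})" "X \<noteq> {}"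
      by auto
    then obtain x where "x \<in> X"
      by auto
    then have "X = cell T (symbol P) n x"
      unfolding f(2) using f(1) by (intro inter) auto
    then show "X \<in> range (cell T (symbol P) n)"
      by simp
  next
    fix X assume "X \<in> range (cell T (symbol P) n)"
    then obtain x where X: "X = cell T (symbol P) n x"
      by auto
    define f where "f R = (THE Y. Y \<in> R \<and> x \<in> Y)" for R :: "'a set set"
    have fQ: "f (?Q i) = {y. symbol P ((T ^^ i) y) = symbol P ((T ^^ i) x)}" for i
      unfolding f_def
    proof (rule the_equality)
      show "{y. symbol P ((T ^^ i) y) = symbol P ((T ^^ i) x)} \<in> ?Q i \<and>
          x \<in> {y. symbol P ((T ^^ i) y) = symbol P ((T ^^ i) x)}"
        unfolding pull by auto
    qed (use sel in blast)
    have f: "f (?Q i) \<in> ?Q i" for i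
      unfolding fQ pull by auto
    have "x \<in> \<Inter>(f ` ?Q ` {..<n})"
      by (auto simp: fQ)
    then have "\<Inter>(f ` ?Q ` {..<n}) = X"
      unfolding X using f by (intro inter) auto
    moreover have "x \<in> X"
      by (simp add: X cell_def)
    moreover have "f \<in> (\<Pi> P\<in>?Q ` {..<n}. P)"
      using f by auto
    ultimately show "X \<in> (\<Union>f\<in>\<Pi> P\<in>?Q ` {..<n}. P. {\<Inter>(f ` ?Q ` {..<n})}) - {{}}"
      by blast
  qed
qed

lemma partition_entropy_join:
  assumes P: "finite_measurable_partition \<mu> P"
  shows "partition_entropy \<mu> (dynamical_join \<mu> T n P) = block_entropy (symbol P) n"
proof -
  let ?w = "name T (symbol P) n"
  note s = simple_function_name[OF simple_function_symbol[OF P], of n]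
  have "inj_on (\<lambda>w. ?w -` {w}) (range ?w)"
    by (rule inj_onI) auto
  moreover have "range (cell T (symbol P) n) = (\<lambda>w. ?w -` {w}) ` range ?w"
    by (auto simp: vimage_name image_image)
  ultimately have "partition_entropy \<mu> (dynamical_join \<mu> T n P) =
      (\<Sum>w\<in>range ?w. prob (?w -` {w}) * - ln (prob (?w -` {w})))"
    by (simp add: partition_entropy_def dynamical_join_eq[OF P] sum.reindex)
  also have "\<dots> = block_entropy (symbol P) n"
    using integral_simple_comp(2)[OF s, of "\<lambda>w. - ln (prob (?w -` {w}))"]
    by (simp add: block_entropy_def vimage_name)
  finally show ?thesis .
qed

text \<open>The \<open>lim\<close> in the definition of the entropy is a genuine limit, by
  subadditivity of the block entropies.\<close>

lemma ks_entropy_partition_tendsto: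
  assumes P: "finite_measurable_partition \<mu> P"
  shows "(\<lambda>n. block_entropy (symbol P) n / real n) \<longlonglongrightarrow> ks_entropy_partition \<mu> T P"
  unfolding ks_entropy_partition_def partition_entropy_join[OF P]
  using subadditive_convergent[OF block_entropy_nonneg block_entropy_subadditive[OF simple_function_symbol[OF P]]]
  by (simp add: convergent_LIMSEQ_iff)

end

section \<open>Local entropies and generic points\<close>

text \<open>Reduces inequalities between local rates to real numbers: \<open>b - a\<close> is the
  slack of the estimates, and for infinite \<open>A\<close> the premise is vacuous.\<close>

lemma ennreal_le_dense_real:
  fixes A B :: ennreal
  assumes "\<And>a b. A < ennreal a \<Longrightarrow> a < b \<Longrightarrow> B \<le> ennreal b"
  shows "B \<le> A"
proof (rule ccontr)
  assume "\<not> B \<le> A"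
  then obtain z where z: "A < z" "z < B"
    using dense[of A B] by (auto simp: not_le)
  obtain z' where z': "z < z'" "z' < B"
    using dense[OF z(2)] by auto
  obtain a where a: "z = ennreal a" "0 \<le> a"
    using z(2) by (cases z) auto
  obtain b where b: "z' = ennreal b" "0 \<le> b"
    using z'(2) by (cases z') auto
  have "a < b"
    using z'(1) a b by (simp add: ennreal_less_iff)
  moreover have "A < ennreal a"
    using z(1) a(1) by simp
  ultimately have "B \<le> z'"
    unfolding b(1) by (intro assms)
  then show False
    using z'(2) by simp
qed

context invariant_flow
begin

lemma neg_log_measure_antimono:
  assumes "A \<subseteq> B" "B \<in> sets borel"
  shows "neg_log_measure \<mu> B \<le> neg_log_measure \<mu> A"
proof (cases "prob A = 0")
  case False
  then have "0 < prob A"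
    by (simp add: zero_less_measure_iff)
  moreover have "prob A \<le> prob B"
    using assms by (intro finite_measure_mono) auto
  ultimately show ?thesis
    by (auto simp: neg_log_measure_def intro!: ennreal_leI)
qed (simp add: neg_log_measure_def)

text \<open>The exponent \<open>r\<close> is kept apart from \<open>b * t\<close> so that rounding
  between real times and integer lengths can be absorbed in \<open>r \<le> b * t\<close>.\<close>

lemma neg_log_measure_rate:
  assumes "exp (- r) \<le> prob A" "0 < t" "r \<le> b * t"
  shows "neg_log_measure \<mu> A / ennreal t \<le> ennreal b"
proof -
  have pos: "0 < prob A"
    using assms(1) by (rule less_le_trans[OF exp_gt_zero])
  have "exp (- r) \<le> 1"
    using assms(1) prob_le_1 by (rule order_trans)
  then have r: "0 \<le> r"
    by simp
  have "- ln (prob A) \<le> r"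
    using assms(1) pos by (simp add: ln_ge_iff[symmetric] minus_le_iff)
  then have "neg_log_measure \<mu> A \<le> ennreal r"
    using pos by (auto simp: neg_log_measure_def intro!: ennreal_leI)
  then have "neg_log_measure \<mu> A / ennreal t \<le> ennreal r / ennreal t"
    by (rule divide_right_mono_ennreal)
  also have "\<dots> = ennreal (r / t)"
    using r assms(2) by (rule divide_ennreal)
  also have "\<dots> \<le> ennreal b"
    using assms(2,3) by (intro ennreal_leI) (simp add: field_simps)
  finally show ?thesis .
qed

lemma lower_local_entropy_SUP:
  "lower_local_entropy \<mu> \<phi> x =
    (SUP \<epsilon>\<in>{0<..}. Liminf at_top (\<lambda>t. neg_log_measure \<mu> (rep_ball \<phi> x t \<epsilon>) / ennreal t))"
  unfolding lower_local_entropy_def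
proof (rule Lim_at_right_antimono)
  fix \<epsilon> \<epsilon>' :: real assume "\<epsilon> \<le> \<epsilon>'"
  then show "Liminf at_top (\<lambda>t. neg_log_measure \<mu> (rep_ball \<phi> x t \<epsilon>') / ennreal t) \<le>
      Liminf at_top (\<lambda>t. neg_log_measure \<mu> (rep_ball \<phi> x t \<epsilon>) / ennreal t)"
    by (intro Liminf_mono always_eventually allI divide_right_mono_ennreal
        neg_log_measure_antimono[OF rep_ball_mono sets_rep_ball] order_refl)
qed

lemma upper_local_entropy_SUP:
  "upper_local_entropy \<mu> \<phi> x =
    (SUP \<epsilon>\<in>{0<..}. Limsup at_top (\<lambda>t. neg_log_measure \<mu> (rep_ball \<phi> x t \<epsilon>) / ennreal t))"
  unfolding upper_local_entropy_def
proof (rule Lim_at_right_antimono)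
  fix \<epsilon> \<epsilon>' :: real assume "\<epsilon> \<le> \<epsilon>'"
  then show "Limsup at_top (\<lambda>t. neg_log_measure \<mu> (rep_ball \<phi> x t \<epsilon>') / ennreal t) \<le>
      Limsup at_top (\<lambda>t. neg_log_measure \<mu> (rep_ball \<phi> x t \<epsilon>) / ennreal t)"
    by (intro Limsup_mono always_eventually allI divide_right_mono_ennreal
        neg_log_measure_antimono[OF rep_ball_mono sets_rep_ball] order_refl)
qed

lemma lower_le_upper_local_entropy: "lower_local_entropy \<mu> \<phi> x \<le> upper_local_entropy \<mu> \<phi> x"
  unfolding lower_local_entropy_SUP upper_local_entropy_SUP
proof (rule SUP_mono)
  fix \<epsilon> :: real assume "\<epsilon> \<in> {0<..}"
  then show "\<exists>\<epsilon>'\<in>{0<..}. Liminf at_top (\<lambda>t. neg_log_measure \<mu> (rep_ball \<phi> x t \<epsilon>) / ennreal t) \<le>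
      Limsup at_top (\<lambda>t. neg_log_measure \<mu> (rep_ball \<phi> x t \<epsilon>') / ennreal t)"
    by (intro bexI[of _ \<epsilon>] Liminf_le_Limsup) simp
qed

text \<open>A lower limit below \<open>a\<close> gives arbitrarily large real times with heavy
  balls. Rounding the time down enlarges the ball, and \<gamma> pays for the change of the
  exponent.\<close>

lemma lower_local_entropy_slow:
  assumes less: "lower_local_entropy \<mu> \<phi> x < ennreal a"
  shows "x \<in> slow a"
proof (rule slowI)
  fix \<gamma> \<epsilon> :: real and m :: nat
  assume \<gamma>: "0 < \<gamma>" and \<epsilon>: "0 < \<epsilon>"
  have a: "0 < a"
    using less by (cases "0 < a") (auto simp: ennreal_neg)
  let ?F = "\<lambda>t. neg_log_measure \<mu> (rep_ball \<phi> x t \<epsilon>) / ennreal t"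
  have "Liminf at_top ?F \<le> lower_local_entropy \<mu> \<phi> x"
    unfolding lower_local_entropy_SUP using \<epsilon> by (intro SUP_upper) simp
  then have "\<not> ennreal a \<le> Liminf at_top ?F"
    using less by simp
  then have "\<not> eventually (\<lambda>t. ennreal a \<le> ?F t) at_top"
    by (rule contrapos_nn) (rule Liminf_bounded)
  \<comment> \<open>With \<open>n\<close> the integer part of \<open>t\<close>, the first bound
    gives \<open>m \<le> n\<close> and the second gives \<open>a \<le> \<gamma> * n\<close>, the
    price of rounding.\<close>
  then have "\<not> (\<forall>t\<ge>max (real m + 1) (a / \<gamma> + 1). ennreal a \<le> ?F t)"
    unfolding eventually_at_top_linorder not_ex by (rule spec)
  then obtain t where t: "max (real m + 1) (a / \<gamma> + 1) \<le> t" "?F t < ennreal a"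
    unfolding not_all not_imp not_le by (elim exE conjE)
  have t0: "0 < t"
    using t(1) by simp
  let ?p = "prob (rep_ball \<phi> x t \<epsilon>)"
  have "?p \<noteq> 0"
    using t(2) by (auto simp: neg_log_measure_def ennreal_top_divide)
  then have p: "0 < ?p"
    by (simp add: zero_less_measure_iff)
  have ln: "0 \<le> - ln ?p"
    using p prob_le_1[of "rep_ball \<phi> x t \<epsilon>"] by simp
  then have "ennreal (- ln ?p / t) < ennreal a"
    using t(2) t0 \<open>?p \<noteq> 0\<close> divide_ennreal[OF ln t0] by (simp add: neg_log_measure_def)
  then have "- ln ?p / t < a"
    using divide_nonneg_pos[OF ln t0] by (subst (asm) ennreal_less_iff)
  then have "- (a * t) < ln ?p"
    using t0 by (simp add: field_simps)
  then have low: "exp (- (a * t)) \<le> ?p"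
    using p by (simp add: ln_ge_iff[symmetric])
  define n where "n = nat \<lfloor>t\<rfloor>"
  have n: "real n \<le> t" "t \<le> real n + 1"
    using t0 of_nat_floor[of t] unfolding n_def by auto
  have "a / \<gamma> \<le> real n"
    using t(1) n(2) by simp
  then have "a \<le> \<gamma> * real n"
    using \<gamma> by (simp add: field_simps)
  moreover have "a * t \<le> a * (real n + 1)"
    using n(2) a by (intro mult_left_mono) auto
  ultimately have "a * t \<le> (a + \<gamma>) * real n"
    by (simp add: algebra_simps)
  then have "exp (- (a + \<gamma>) * real n) \<le> exp (- (a * t))"
    by (simp only: exp_le_cancel_iff mult_minus_left neg_le_iff_le)
  also note low
  also have "?p \<le> prob (rep_ball \<phi> x (real n) \<epsilon>)"
    using n(1) by (intro finite_measure_mono rep_ball_mono) auto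
  finally show "\<exists>n\<ge>m. exp (- (a + \<gamma>) * real n) \<le> prob (rep_ball \<phi> x (real n) \<epsilon>)"
    using t(1) n(2) by (intro exI[of _ n]) auto
qed

text \<open>One almost sure property for all real parameters, after which every comparison of rates
  is pointwise. Points of infinite lower entropy satisfy it vacuously.\<close>

definition generic :: "'a \<Rightarrow> bool" where
  "generic x \<longleftrightarrow> (\<forall>a \<gamma> \<epsilon>. 0 < \<gamma> \<longrightarrow> 0 < \<epsilon> \<longrightarrow> lower_local_entropy \<mu> \<phi> x < ennreal a \<longrightarrow>
     (\<forall>\<^sub>F n in sequentially. exp (- ((a + \<gamma>) * real n)) \<le> prob (bowen_ball T x n \<epsilon>)))"

lemma genericD:
  assumes "generic x" "0 < \<gamma>" "0 < \<epsilon>" "lower_local_entropy \<mu> \<phi> x < ennreal a"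
  shows "\<forall>\<^sub>F n in sequentially. exp (- ((a + \<gamma>) * real n)) \<le> prob (bowen_ball T x n \<epsilon>)"
  using assms by (simp add: generic_def)

text \<open>Countably many instances of \<open>AE_slow_bowen_ball\<close> suffice: a rational fits
  between the lower entropy and \<open>a\<close>, and both sides of the estimate are monotone in the
  slack and the radius.\<close>

lemma AE_generic: "AE x in \<mu>. generic x"
proof -
  let ?E = "\<lambda>x a j k. \<forall>\<^sub>F n in sequentially. exp (- (a + 1 / real (Suc j)) * real n) \<le>
    prob (bowen_ball T x n (1 / real (Suc k)))"
  have "AE x in \<mu>. 0 \<le> q \<longrightarrow> x \<in> slow (real_of_rat q) \<longrightarrow> ?E x (real_of_rat q) j k" for q j k
  proof (cases "0 \<le> q")
    case True
    then have "0 \<le> real_of_rat q"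
      by simp
    then show ?thesis
      using AE_slow_bowen_ball[of "real_of_rat q" "1 / real (Suc k)" "1 / real (Suc j)"] by simp
  qed simp
  then have "AE x in \<mu>. \<forall>q j k. 0 \<le> q \<longrightarrow> x \<in> slow (real_of_rat q) \<longrightarrow> ?E x (real_of_rat q) j k"
    unfolding AE_all_countable by (intro allI)
  then show ?thesis
  proof (rule AE_mp, intro AE_I2 impI)
    fix x assume E: "\<forall>q j k. 0 \<le> q \<longrightarrow> x \<in> slow (real_of_rat q) \<longrightarrow> ?E x (real_of_rat q) j k"
    show "generic x"
      unfolding generic_def
    proof (intro allI impI)
      fix a \<gamma> \<epsilon> :: real assume "0 < \<gamma>" "0 < \<epsilon>" and less: "lower_local_entropy \<mu> \<phi> x < ennreal a"
      obtain l where l: "lower_local_entropy \<mu> \<phi> x = ennreal l" "0 \<le> l"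
        using less by (cases "lower_local_entropy \<mu> \<phi> x") auto
      have "l < a"
        using less l by (simp add: ennreal_less_iff)
      then obtain q where q: "l < real_of_rat q" "real_of_rat q < a"
        using of_rat_dense by blast
      have "x \<in> slow (real_of_rat q)"
        using q l by (intro lower_local_entropy_slow) (simp add: ennreal_less_iff)
      moreover have "0 \<le> q"
      proof -
        have "0 < real_of_rat q"
          using l(2) q(1) by (rule le_less_trans)
        then show ?thesis
          by simp
      qed
      moreover obtain j where j: "1 / real (Suc j) < \<gamma>"
        using \<open>0 < \<gamma>\<close> nat_approx_posE by metis
      moreover obtain k where k: "1 / real (Suc k) < \<epsilon>"
        using \<open>0 < \<epsilon>\<close> nat_approx_posE by metis
      ultimately have "?E x (real_of_rat q) j k"
        using E by blast
      then show "\<forall>\<^sub>F n in sequentially. exp (- ((a + \<gamma>) * real n)) \<le> prob (bowen_ball T x n \<epsilon>)"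
      proof (rule eventually_mono)
        fix n assume *: "exp (- (real_of_rat q + 1 / real (Suc j)) * real n) \<le> prob (bowen_ball T x n (1 / real (Suc k)))"
        have "(real_of_rat q + 1 / real (Suc j)) * real n \<le> (a + \<gamma>) * real n"
          using q(2) j by (intro mult_right_mono) auto
        then have "exp (- ((a + \<gamma>) * real n)) \<le> exp (- (real_of_rat q + 1 / real (Suc j)) * real n)"
          by (simp only: exp_le_cancel_iff mult_minus_left neg_le_iff_le)
        also note *
        also have "prob (bowen_ball T x n (1 / real (Suc k))) \<le> prob (bowen_ball T x n \<epsilon>)"
          using k by (intro finite_measure_mono) (force simp: bowen_ball_def, simp add: open_bowen_ball)
        finally show "exp (- ((a + \<gamma>) * real n)) \<le> prob (bowen_ball T x n \<epsilon>)" .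
      qed
    qed
  qed
qed

lemma generic_upper_le_lower:
  assumes x: "generic x"
  shows "upper_local_entropy \<mu> \<phi> x \<le> lower_local_entropy \<mu> \<phi> x"
proof (rule ennreal_le_dense_real)
  fix a b assume a: "lower_local_entropy \<mu> \<phi> x < ennreal a" and b: "a < b"
  define \<gamma> where "\<gamma> = (b - a) / 2"
  have \<gamma>: "0 < \<gamma>" "b = a + 2 * \<gamma>"
    using b by (auto simp: \<gamma>_def field_simps)
  show "upper_local_entropy \<mu> \<phi> x \<le> ennreal b"
    unfolding upper_local_entropy_SUP
  proof (rule SUP_least)
    fix \<epsilon> :: real assume "\<epsilon> \<in> {0<..}"
    then have "0 < \<epsilon>" by simp
    obtain \<epsilon>' where \<epsilon>': "0 < \<epsilon>'" "\<And>x t n. t < real n \<Longrightarrow> bowen_ball T x n \<epsilon>' \<subseteq> rep_ball \<phi> x t \<epsilon>"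
      using bowen_ball_subset_rep_ball[OF \<open>0 < \<epsilon>\<close>] by metis
    obtain N where N: "\<And>n. N \<le> n \<Longrightarrow> exp (- ((a + \<gamma>) * real n)) \<le> prob (bowen_ball T x n \<epsilon>')"
      using genericD[OF x \<gamma>(1) \<epsilon>'(1) a] unfolding eventually_sequentially by metis
    \<comment> \<open>The bound \<open>(a + \<gamma>) / \<gamma>\<close> makes
      \<open>(a + \<gamma>) * (t + 1) \<le> (a + 2 * \<gamma>) * t\<close>, so the second \<gamma>
      in \<open>b\<close> pays for rounding \<open>t\<close> up to \<open>n\<close>.\<close>
    have "eventually (\<lambda>t. max 1 (max (real N) ((a + \<gamma>) / \<gamma>)) \<le> t) at_top"
      by (rule eventually_ge_at_top)
    then have "eventually (\<lambda>t. neg_log_measure \<mu> (rep_ball \<phi> x t \<epsilon>) / ennreal t \<le> ennreal b) at_top"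
    proof (rule eventually_mono)
      fix t assume t: "max 1 (max (real N) ((a + \<gamma>) / \<gamma>)) \<le> t"
      define n where "n = Suc (nat \<lfloor>t\<rfloor>)"
      have n: "t < real n" "real n \<le> t + 1"
        using t of_nat_floor[of t] unfolding n_def by (auto, linarith)
      have "N \<le> n"
        using n t by linarith
      have "(a + \<gamma>) / \<gamma> \<le> t"
        using t by simp
      then have *: "a + \<gamma> \<le> \<gamma> * t"
        using \<gamma>(1) by (simp add: field_simps)
      have "0 < a"
        using a by (cases "0 < a") (auto simp: ennreal_neg)
      then have "(a + \<gamma>) * real n \<le> (a + \<gamma>) * (t + 1)"
        using n(2) \<gamma>(1) by (intro mult_left_mono) auto
      also have "\<dots> \<le> b * t"
        using * by (simp add: \<gamma>(2) algebra_simps)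
      finally have le: "(a + \<gamma>) * real n \<le> b * t" .
      have "exp (- ((a + \<gamma>) * real n)) \<le> prob (bowen_ball T x n \<epsilon>')"
        by (rule N[OF \<open>N \<le> n\<close>])
      also have "\<dots> \<le> prob (rep_ball \<phi> x t \<epsilon>)"
        by (intro finite_measure_mono \<epsilon>'(2) n) simp
      finally show "neg_log_measure \<mu> (rep_ball \<phi> x t \<epsilon>) / ennreal t \<le> ennreal b"
        using t le by (intro neg_log_measure_rate) auto
    qed
    then show "Limsup at_top (\<lambda>t. neg_log_measure \<mu> (rep_ball \<phi> x t \<epsilon>) / ennreal t) \<le> ennreal b"
      by (rule Limsup_bounded)
  qed
qed

text \<open>
  A measurable version of the local entropy, computed from the Bowen balls of the time-one map.
\<close>

definition bowen_rate :: "nat \<Rightarrow> 'a \<Rightarrow> ennreal" where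
  "bowen_rate k x = liminf (\<lambda>n. neg_log_measure \<mu> (bowen_ball T x (Suc n) (1 / real (Suc k))) / ennreal (real n))"

definition bowen_entropy :: "'a \<Rightarrow> ennreal" where
  "bowen_entropy x = (SUP k. bowen_rate k x)"

lemma measurable_neg_log_bowen [measurable]:
  "(\<lambda>x. neg_log_measure \<mu> (bowen_ball T x n \<epsilon>)) \<in> borel_measurable borel"
  unfolding neg_log_measure_def by measurable

lemma measurable_bowen_rate [measurable]: "bowen_rate k \<in> borel_measurable borel"
  unfolding bowen_rate_def by measurable

lemma measurable_bowen_entropy [measurable]: "bowen_entropy \<in> borel_measurable borel"
  unfolding bowen_entropy_def by measurable

text \<open>At every point: Bowen balls lie in reparametrization balls, and the lower limit along
  integers is at least the one along reals.\<close>

lemma lower_le_bowen_entropy: "lower_local_entropy \<mu> \<phi> x \<le> bowen_entropy x"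
  unfolding lower_local_entropy_SUP
proof (rule SUP_least)
  fix \<epsilon> :: real assume "\<epsilon> \<in> {0<..}"
  then have "0 < \<epsilon>" by simp
  obtain \<epsilon>' where \<epsilon>': "0 < \<epsilon>'" "\<And>x t n. t < real n \<Longrightarrow> bowen_ball T x n \<epsilon>' \<subseteq> rep_ball \<phi> x t \<epsilon>"
    using bowen_ball_subset_rep_ball[OF \<open>0 < \<epsilon>\<close>] by metis
  obtain k where k: "1 / real (Suc k) < \<epsilon>'"
    using \<epsilon>'(1) nat_approx_posE by metis
  let ?F = "\<lambda>t. neg_log_measure \<mu> (rep_ball \<phi> x t \<epsilon>) / ennreal t"
  have "Liminf at_top ?F \<le> liminf (\<lambda>n. ?F (real n))"
    unfolding le_Liminf_iff
  proof (intro allI impI)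
    fix y assume "y < Liminf at_top ?F"
    then have "eventually (\<lambda>t. y < ?F t) at_top"
      by (rule less_LiminfD)
    then show "eventually (\<lambda>n. y < ?F (real n)) sequentially"
      using filterlim_real_sequentially unfolding filterlim_iff by blast
  qed
  also have "\<dots> \<le> bowen_rate k x"
    unfolding bowen_rate_def
  proof (intro Liminf_mono always_eventually allI divide_right_mono_ennreal neg_log_measure_antimono)
    fix n
    \<comment> \<open>The index \<open>Suc n\<close> in \<open>bowen_rate\<close> provides the
      strict inequality \<open>real n < real (Suc n)\<close> that the inclusion asks for.\<close>
    have "bowen_ball T x (Suc n) (1 / real (Suc k)) \<subseteq> bowen_ball T x (Suc n) \<epsilon>'"
      using k by (force simp: bowen_ball_def)
    also have "\<dots> \<subseteq> rep_ball \<phi> x (real n) \<epsilon>"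
      by (intro \<epsilon>'(2)) simp
    finally show "bowen_ball T x (Suc n) (1 / real (Suc k)) \<subseteq> rep_ball \<phi> x (real n) \<epsilon>" .
  qed simp
  also have "\<dots> \<le> bowen_entropy x"
    unfolding bowen_entropy_def by (intro SUP_upper) simp
  finally show "Liminf at_top ?F \<le> bowen_entropy x" .
qed

lemma generic_bowen_le_lower:
  assumes x: "generic x"
  shows "bowen_entropy x \<le> lower_local_entropy \<mu> \<phi> x"
  unfolding bowen_entropy_def
proof (rule SUP_least, rule ennreal_le_dense_real)
  fix k a b assume a: "lower_local_entropy \<mu> \<phi> x < ennreal a" and b: "a < b"
  define \<gamma> where "\<gamma> = (b - a) / 2"
  have \<gamma>: "0 < \<gamma>" "b = a + 2 * \<gamma>"
    using b by (auto simp: \<gamma>_def field_simps)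
  obtain N where N: "\<And>n. N \<le> n \<Longrightarrow> exp (- ((a + \<gamma>) * real n)) \<le> prob (bowen_ball T x n (1 / real (Suc k)))"
    using genericD[OF x \<gamma>(1) _ a, of "1 / real (Suc k)"] unfolding eventually_sequentially by auto
  obtain N' :: nat where N': "(a + \<gamma>) / \<gamma> \<le> real N'"
    using real_arch_simple by blast
  have "neg_log_measure \<mu> (bowen_ball T x (Suc n) (1 / real (Suc k))) / ennreal (real n) \<le> ennreal b"
    if n: "max 1 (max N N') \<le> n" for n
  proof (rule neg_log_measure_rate)
    show "exp (- ((a + \<gamma>) * real (Suc n))) \<le> prob (bowen_ball T x (Suc n) (1 / real (Suc k)))"
      using n by (intro N) simp
    have "(a + \<gamma>) / \<gamma> \<le> real n"
      using N' n by simp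
    then have "a + \<gamma> \<le> \<gamma> * real n"
      using \<gamma>(1) by (simp add: field_simps)
    then show "(a + \<gamma>) * real (Suc n) \<le> b * real n"
      by (simp add: \<gamma>(2) algebra_simps)
  qed (use n in simp)
  then have "eventually (\<lambda>n. neg_log_measure \<mu> (bowen_ball T x (Suc n) (1 / real (Suc k))) / ennreal (real n) \<le> ennreal b) sequentially"
    unfolding eventually_sequentially by blast
  then have "limsup (\<lambda>n. neg_log_measure \<mu> (bowen_ball T x (Suc n) (1 / real (Suc k))) / ennreal (real n)) \<le> ennreal b"
    by (rule Limsup_bounded)
  then show "bowen_rate k x \<le> ennreal b"
    unfolding bowen_rate_def using Liminf_le_Limsup[OF trivial_limit_sequentially] by (rule order_trans[rotated])
qed

section \<open>The integral of the local rate is at most the entropy\<close>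

text \<open>Points are classified by which of finitely many balls of radius
  \<open>\<epsilon> / 2\<close> contain them; the balls cover the space, so each class lies in one
  of them.\<close>

lemma small_partition:
  assumes "0 < \<epsilon>"
  shows "\<exists>P. finite_measurable_partition \<mu> P \<and> (\<forall>A\<in>P. \<forall>x\<in>A. \<forall>y\<in>A. dist x y < \<epsilon>)"
proof -
  obtain K where K: "finite K" "(UNIV :: 'a set) \<subseteq> (\<Union>x\<in>K. ball x (\<epsilon> / 2))"
  proof (rule compactE_image[OF compact_space, of UNIV "\<lambda>x. ball x (\<epsilon> / 2)"])
    show "(UNIV :: 'a set) \<subseteq> (\<Union>x\<in>UNIV. ball x (\<epsilon> / 2))"
    proof
      fix x show "x \<in> (\<Union>x\<in>UNIV. ball x (\<epsilon> / 2))"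
        using assms by (intro UN_I[of x]) simp_all
    qed
  qed auto
  define code where "code x = {k \<in> K. dist k x < \<epsilon> / 2}" for x
  define P where "P = range (\<lambda>x. {y. code y = code x})"
  have "P \<subseteq> (\<lambda>S. {y. code y = S}) ` Pow K"
    by (auto simp: P_def code_def)
  then have "finite P"
    by (rule finite_subset) (use K in simp)
  moreover have "partition_on (space \<mu>) P"
  proof (rule partition_onI)
    show "\<Union>P = space \<mu>"
      by (auto simp: P_def)
    show "disjnt A B" if "A \<in> P" "B \<in> P" "A \<noteq> B" for A B
      using that unfolding P_def disjnt_def by (elim imageE) auto
    show "{} \<notin> P"
      by (auto simp: P_def)
  qed
  moreover have "P \<subseteq> sets \<mu>"
  proof
    fix A assume "A \<in> P"
    then obtain x where A: "A = {y. code y = code x}"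
      by (auto simp: P_def)
    have "{y \<in> space \<mu>. (dist k y < \<epsilon> / 2) = (dist k x < \<epsilon> / 2)} \<in> sets \<mu>" for k
    proof (cases "dist k x < \<epsilon> / 2")
      case True
      have "open {y. dist k y < \<epsilon> / 2}"
        by (intro open_Collect_less continuous_intros)
      then show ?thesis
        using True by simp
    next
      case False
      have "closed {y. \<epsilon> / 2 \<le> dist k y}"
        by (intro closed_Collect_le continuous_intros)
      then show ?thesis
        using False by (simp add: not_less)
    qed
    then have "{y \<in> space \<mu>. \<forall>k\<in>K. (dist k y < \<epsilon> / 2) = (dist k x < \<epsilon> / 2)} \<in> sets \<mu>"
      by (rule sets.sets_Collect_finite_All[OF _ K(1)])
    also have "{y \<in> space \<mu>. \<forall>k\<in>K. (dist k y < \<epsilon> / 2) = (dist k x < \<epsilon> / 2)} = A"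
      unfolding A by (auto simp: code_def)
    finally show "A \<in> sets \<mu>" .
  qed
  moreover have "\<forall>A\<in>P. \<forall>x\<in>A. \<forall>y\<in>A. dist x y < \<epsilon>"
  proof (intro ballI)
    fix A x y assume A: "A \<in> P" and xy: "x \<in> A" "y \<in> A"
    have "code x = code y"
      using A xy by (auto simp: P_def)
    moreover obtain k where "k \<in> K" "dist k x < \<epsilon> / 2"
      using subsetD[OF K(2) UNIV_I[of x]] by (elim UN_E) simp
    ultimately have "dist k x < \<epsilon> / 2" "dist k y < \<epsilon> / 2"
      by (auto simp: code_def)
    then show "dist x y < \<epsilon>"
      by (rule dist_triangle_half_r)
  qed
  ultimately show ?thesis
    unfolding finite_measurable_partition_def by (intro exI[of _ P] conjI)
qed

text \<open>Cells of a partition finer than the radius lie in Bowen balls, so their information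
  function dominates the rate of the balls.\<close>

lemma nn_integral_bowen_rate_le: "(\<integral>\<^sup>+x. bowen_rate k x \<partial>\<mu>) \<le> ks_entropy \<mu> T"
proof -
  obtain P where P: "finite_measurable_partition \<mu> P" "\<forall>A\<in>P. \<forall>x\<in>A. \<forall>y\<in>A. dist x y < 1 / real (Suc k)"
  proof -
    have "0 < 1 / real (Suc k)"
      by simp
    from small_partition[OF this] show thesis
      using that by (elim exE conjE)
  qed
  note s = simple_function_symbol[OF P(1)]
  let ?H = "block_entropy (symbol P)"
  let ?u = "\<lambda>n x. neg_log_measure \<mu> (bowen_ball T x (Suc n) (1 / real (Suc k))) / ennreal (real n)"
  have sub: "cell T (symbol P) n x \<subseteq> bowen_ball T x n (1 / real (Suc k))" for n x
  proof
    fix y assume y: "y \<in> cell T (symbol P) n x"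
    have "dist ((T ^^ i) x) ((T ^^ i) y) < 1 / real (Suc k)" if "i < n" for i
    proof -
      have "symbol P ((T ^^ i) y) = symbol P ((T ^^ i) x)"
        using y that by (simp add: cell_def)
      then show ?thesis
        using P(2)[rule_format, OF symbol_in(1)[OF P(1)] symbol_in(2)[OF P(1)], of "(T ^^ i) y" "(T ^^ i) x"]
          symbol_in(2)[OF P(1), of "(T ^^ i) y"] by simp
    qed
    then show "y \<in> bowen_ball T x n (1 / real (Suc k))"
      by (simp add: bowen_ball_def)
  qed
  have "(\<integral>\<^sup>+x. ?u n x \<partial>\<mu>) \<le> ennreal (?H (Suc n) / real n)" if n: "1 \<le> n" for n
  proof -
    have "AE x in \<mu>. ?u n x \<le> ennreal (- ln (prob (cell T (symbol P) (Suc n) x)) / real n)"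
      using AE_cell_pos[OF s, of "Suc n"]
    proof (rule AE_mp, intro AE_I2 impI)
      fix x assume pos: "0 < prob (cell T (symbol P) (Suc n) x)"
      have "prob (cell T (symbol P) (Suc n) x) \<le> prob (bowen_ball T x (Suc n) (1 / real (Suc k)))"
        by (intro finite_measure_mono sub) simp
      then have "exp (- (- ln (prob (cell T (symbol P) (Suc n) x)))) \<le>
          prob (bowen_ball T x (Suc n) (1 / real (Suc k)))"
        using pos by simp
      then show "?u n x \<le> ennreal (- ln (prob (cell T (symbol P) (Suc n) x)) / real n)"
        using n by (intro neg_log_measure_rate) auto
    qed
    then have "(\<integral>\<^sup>+x. ?u n x \<partial>\<mu>) \<le> (\<integral>\<^sup>+x. ennreal (- ln (prob (cell T (symbol P) (Suc n) x)) / real n) \<partial>\<mu>)"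
      by (rule nn_integral_mono_AE)
    also have "\<dots> = ennreal (\<integral>x. - ln (prob (cell T (symbol P) (Suc n) x)) / real n \<partial>\<mu>)"
    proof (rule nn_integral_eq_integral)
      show "integrable \<mu> (\<lambda>x. - ln (prob (cell T (symbol P) (Suc n) x)) / real n)"
        using integrable_ln_cell[OF s, of "Suc n"] by (rule integrable_divide)
      show "AE x in \<mu>. 0 \<le> - ln (prob (cell T (symbol P) (Suc n) x)) / real n"
        using AE_cell_pos[OF s, of "Suc n"] by eventually_elim (simp add: divide_nonpos_nonneg)
    qed
    also have "(\<integral>x. - ln (prob (cell T (symbol P) (Suc n) x)) / real n \<partial>\<mu>) = ?H (Suc n) / real n"
      by (simp only: block_entropy_def integral_divide_zero)
    finally show ?thesis .
  qed
  then have le: "eventually (\<lambda>n. (\<integral>\<^sup>+x. ?u n x \<partial>\<mu>) \<le> ennreal (?H (Suc n) / real n)) sequentially"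
    unfolding eventually_sequentially by blast
  \<comment> \<open>The factor tending to \<open>1\<close> repairs the mismatch between
    \<open>Suc n\<close> letters and the normalization by \<open>n\<close>.\<close>
  have "(\<lambda>n. ?H (Suc n) / real (Suc n) * (real (Suc n) / real n)) \<longlonglongrightarrow> ks_entropy_partition \<mu> T P * 1"
  proof (rule tendsto_mult)
    show "(\<lambda>n. ?H (Suc n) / real (Suc n)) \<longlonglongrightarrow> ks_entropy_partition \<mu> T P"
      using LIMSEQ_Suc[OF ks_entropy_partition_tendsto[OF P(1)]] .
    show "(\<lambda>n. real (Suc n) / real n) \<longlonglongrightarrow> 1"
      by (rule LIMSEQ_Suc_n_over_n)
  qed
  then have "(\<lambda>n. ?H (Suc n) / real n) \<longlonglongrightarrow> ks_entropy_partition \<mu> T P"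
    by simp
  then have lim: "(\<lambda>n. ennreal (?H (Suc n) / real n)) \<longlonglongrightarrow> ennreal (ks_entropy_partition \<mu> T P)"
    by (rule tendsto_ennrealI)
  have "(\<integral>\<^sup>+x. bowen_rate k x \<partial>\<mu>) \<le> liminf (\<lambda>n. \<integral>\<^sup>+x. ?u n x \<partial>\<mu>)"
    unfolding bowen_rate_def by (rule nn_integral_liminf) simp
  also have "\<dots> \<le> liminf (\<lambda>n. ennreal (?H (Suc n) / real n))"
    by (rule Liminf_mono[OF le])
  also have "\<dots> = ennreal (ks_entropy_partition \<mu> T P)"
    using lim by (rule lim_imp_Liminf[OF trivial_limit_sequentially])
  also have "\<dots> \<le> ks_entropy \<mu> T"
    unfolding ks_entropy_def using P(1) by (intro SUP_upper) simp
  finally show ?thesis .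
qed

lemma nn_integral_bowen_entropy_le: "(\<integral>\<^sup>+x. bowen_entropy x \<partial>\<mu>) \<le> ks_entropy \<mu> T"
proof -
  have "incseq bowen_rate"
    unfolding incseq_def le_fun_def
  proof (intro allI impI)
    fix m n :: nat and x assume "m \<le> n"
    then have "1 / real (Suc n) \<le> 1 / real (Suc m)"
      by (simp add: frac_le)
    then have "bowen_ball T x j (1 / real (Suc n)) \<subseteq> bowen_ball T x j (1 / real (Suc m))" for j
      by (force simp: bowen_ball_def)
    then show "bowen_rate m x \<le> bowen_rate n x"
      unfolding bowen_rate_def
      by (intro Liminf_mono always_eventually allI divide_right_mono_ennreal neg_log_measure_antimono) auto
  qed
  then have "(\<integral>\<^sup>+x. bowen_entropy x \<partial>\<mu>) = (SUP k. \<integral>\<^sup>+x. bowen_rate k x \<partial>\<mu>)"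
    unfolding bowen_entropy_def by (intro nn_integral_monotone_convergence_SUP) auto
  also have "\<dots> \<le> ks_entropy \<mu> T"
    by (intro SUP_least nn_integral_bowen_rate_le)
  finally show ?thesis .
qed

end

section \<open>The entropy is at most the integral of the local rate\<close>

lemma separated_compact_closed:
  fixes A B :: "'a::metric_space set"
  assumes "compact A" "closed B" "A \<inter> B = {}"
  shows "\<exists>d>0. \<forall>x\<in>A. \<forall>y\<in>B. d \<le> dist x y"
proof (cases "A = {} \<or> B = {}")
  case True
  then show ?thesis
    by (intro exI[of _ 1]) auto
next
  case False
  have "continuous_on A (\<lambda>x. infdist x B)"
    by (intro continuous_intros)
  then obtain a where a: "a \<in> A" "\<forall>x\<in>A. infdist a B \<le> infdist x B"
    using continuous_attains_inf[OF assms(1)] False by blast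
  have "a \<notin> B"
    using a(1) assms(3) by auto
  then have "0 < infdist a B"
    using in_closed_iff_infdist_zero[OF assms(2), of a] False infdist_nonneg[of a B] by simp
  moreover have "infdist a B \<le> dist x y" if "x \<in> A" "y \<in> B" for x y
    using a(2) that(1) infdist_le[OF that(2), of x] by force
  ultimately show ?thesis
    by blast
qed

context invariant_flow
begin

lemma prob_UNIV [simp]: "prob UNIV = 1"
  using prob_space by simp

lemma emeasure_UNIV [simp]: "emeasure \<mu> UNIV = 1"
  using emeasure_space_1 by simp

text \<open>The uniform weight \<open>(1 / k) ^ n\<close> of a word over \<open>k\<close> letters
  bounds this by \<open>n * ln k\<close>. The cap supplies the integrable majorant for the reverse
  Fatou inequality.\<close>

definition capped_rate :: "real \<Rightarrow> real \<Rightarrow> nat \<Rightarrow> 'a \<Rightarrow> real" where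
  "capped_rate k \<epsilon> n x = - ln (max (prob (bowen_ball T x n \<epsilon>)) ((1 / k) ^ n))"

lemma measurable_capped_rate [measurable]: "capped_rate k \<epsilon> n \<in> borel_measurable borel"
  unfolding capped_rate_def by measurable

lemma capped_rate_bounds:
  assumes "1 \<le> k"
  shows "0 \<le> capped_rate k \<epsilon> n x" "capped_rate k \<epsilon> n x \<le> real n * ln k"
proof -
  let ?M = "max (prob (bowen_ball T x n \<epsilon>)) ((1 / k) ^ n)"
  have pos: "0 < (1 / k) ^ n"
    using assms by simp
  have "(1 / k) ^ n \<le> 1"
    using assms by (intro power_le_one) auto
  then have M: "(1 / k) ^ n \<le> ?M" "?M \<le> 1"
    using prob_le_1 by auto
  then show "0 \<le> capped_rate k \<epsilon> n x"
    using pos by (simp add: capped_rate_def)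
  have "ln ((1 / k) ^ n) \<le> ln ?M"
    using pos M(1) by (intro iffD2[OF ln_le_cancel_iff]) linarith+
  moreover have "ln ((1 / k) ^ n) = - (real n * ln k)"
    using assms by (simp add: ln_realpow ln_div)
  ultimately show "capped_rate k \<epsilon> n x \<le> real n * ln k"
    by (simp add: capped_rate_def)
qed

lemma integrable_capped_rate:
  assumes "1 \<le> k"
  shows "integrable \<mu> (capped_rate k \<epsilon> n)"
  using capped_rate_bounds[OF assms]
  by (intro integrable_const_bound[where B = "real n * ln k"]) (auto simp: abs_of_nonneg)

text \<open>
  A symbol is read off the orbit of \<open>y\<close> through a noisy channel: the letter \<open>w\<close> has weight
  \<open>1 - \<delta>\<close> if \<open>y \<in> U w\<close>, plus \<open>\<delta>\<close> spread evenly. Averaging over \<open>y\<close> gives weights on names, and the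
  name of \<open>x\<close> has weight at least \<open>\<mu> (bowen_ball T x n \<epsilon>)\<close> times one factor \<open>1 - \<delta>\<close> per letter and a
  further factor \<open>\<delta> / k\<close> per visit outside \<open>K\<close>. Mixing with the uniform distribution caps the rate.
\<close>

lemma block_entropy_le_capped_rate:
  fixes N :: "'a \<Rightarrow> 'b" and U :: "'b \<Rightarrow> 'a set"
  assumes N: "simple_function \<mu> N" and k: "k = real (card (range N))"
    and K: "K \<in> sets borel" and U: "\<And>w. U w \<in> sets borel"
    and near: "\<And>x y. x \<in> K \<Longrightarrow> dist x y < \<epsilon> \<Longrightarrow> y \<in> U (N x)"
    and disj: "\<And>y w w'. w \<in> range N \<Longrightarrow> w' \<in> range N \<Longrightarrow> y \<in> U w \<Longrightarrow> y \<in> U w' \<Longrightarrow> w = w'"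
    and \<delta>: "0 < \<delta>" "\<delta> < 1"
  shows "block_entropy N n \<le> ln 2 + real n * - ln (1 - \<delta>) + real n * prob (- K) * - ln (\<delta> / k) +
    (\<integral>x. capped_rate k \<epsilon> n x \<partial>\<mu>)"
proof -
  have fin: "finite (range N)"
    using N by (simp add: simple_function_def)
  have k1: "1 \<le> k"
    using fin unfolding k by (simp add: Suc_le_eq card_gt_0_iff)
  define p where "p = 1 - \<delta>"
  define r where "r = \<delta> / k"
  have "\<delta> / k \<le> \<delta> / 1"
    using k1 \<delta> by (intro divide_left_mono) auto
  then have pr: "0 < p" "p \<le> 1" "0 < r" "r \<le> 1" "p + r \<le> 1" "p + k * r = 1"
    using \<delta> k1 by (auto simp: p_def r_def)
  define \<kappa> where "\<kappa> w y = p * indicator (U w) y + r" for w y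
  have \<kappa>: "0 \<le> \<kappa> w y" "\<kappa> w y \<le> 1" "r \<le> \<kappa> w y" for w y
    using pr by (auto simp: \<kappa>_def indicator_def)
  have \<kappa>_sum: "(\<Sum>w\<in>range N. \<kappa> w y) \<le> 1" for y
  proof -
    have "card {w\<in>range N. y \<in> U w} \<le> Suc 0"
      using fin disj by (subst card_le_Suc0_iff_eq) auto
    moreover have "(\<Sum>w\<in>range N. indicator (U w) y :: real) = real (card {w\<in>range N. y \<in> U w})"
      using fin by (simp add: indicator_def sum.If_cases Int_def)
    ultimately have "(\<Sum>w\<in>range N. indicator (U w) y :: real) \<le> 1"
      by simp
    then have "p * (\<Sum>w\<in>range N. indicator (U w) y) + k * r \<le> p * 1 + k * r"
      using pr by (intro add_right_mono mult_left_mono) auto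
    then show ?thesis
      using pr by (simp add: \<kappa>_def sum.distrib sum_distrib_left k)
  qed
  define \<Psi> where "\<Psi> w y = (\<Prod>i<n. \<kappa> (w i) ((T ^^ i) y))" for w y
  have \<Psi>: "0 \<le> \<Psi> w y" "\<Psi> w y \<le> 1" for w y
    using \<kappa> by (auto simp: \<Psi>_def intro!: prod_nonneg prod_le_1)
  have \<Psi>_meas[measurable]: "\<Psi> w \<in> borel_measurable \<mu>" for w
  proof -
    have "\<kappa> a \<in> borel_measurable \<mu>" for a
      unfolding \<kappa>_def using U by simp
    then show ?thesis
      unfolding \<Psi>_def by (intro borel_measurable_prod measurable_compose[OF measurable_iterate])
  qed
  have \<Psi>_int: "integrable \<mu> (\<Psi> w)" for w
    using \<Psi> by (intro integrable_const_bound[where B = 1]) (auto simp: abs_of_nonneg)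
  define W where "W = {..<n} \<rightarrow>\<^sub>E range N"
  have W: "finite W" "real (card W) = k ^ n"
    using fin by (auto simp: W_def card_PiE k intro!: finite_PiE)
  define q where "q w = 1 / 2 * (\<integral>y. \<Psi> w y \<partial>\<mu>) + 1 / 2 * (1 / k) ^ n" for w
  have q_pos: "0 < q w" for w
    using k1 \<Psi> unfolding q_def by (intro add_nonneg_pos mult_nonneg_nonneg Bochner_Integration.integral_nonneg) auto
  have q_sum: "(\<Sum>w\<in>name T N n ` space \<mu>. q w) \<le> 1"
  proof -
    have "(\<Sum>w\<in>name T N n ` space \<mu>. q w) \<le> (\<Sum>w\<in>W. q w)"
    proof (rule sum_mono2[OF W(1)])
      show "name T N n ` space \<mu> \<subseteq> W"
        unfolding W_def by (rule image_subsetI) (rule name_in_PiE)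
    qed (use q_pos in \<open>auto intro: less_imp_le\<close>)
    also have "\<dots> = 1 / 2 * (\<Sum>w\<in>W. (\<integral>y. \<Psi> w y \<partial>\<mu>)) + 1 / 2 * (k ^ n * (1 / k) ^ n)"
      by (simp add: q_def sum.distrib sum_distrib_left W(2))
    also have "(\<Sum>w\<in>W. (\<integral>y. \<Psi> w y \<partial>\<mu>)) = (\<integral>y. (\<Sum>w\<in>W. \<Psi> w y) \<partial>\<mu>)"
      by (intro Bochner_Integration.integral_sum[symmetric] \<Psi>_int)
    also have "\<dots> \<le> (\<integral>y. 1 \<partial>\<mu>)"
    proof (rule integral_mono)
      show "integrable \<mu> (\<lambda>y. \<Sum>w\<in>W. \<Psi> w y)"
        by (intro Bochner_Integration.integrable_sum \<Psi>_int)
      fix y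
      \<comment> \<open>Summing a product weight over all words factorizes into the letter sums,
        each at most \<open>1\<close>.\<close>
      have "(\<Sum>w\<in>W. \<Psi> w y) = (\<Prod>i<n. \<Sum>a\<in>range N. \<kappa> a ((T ^^ i) y))"
        unfolding W_def \<Psi>_def using fin by (intro prod_sum_PiE[symmetric]) auto
      also have "\<dots> \<le> 1"
        using \<kappa> \<kappa>_sum by (intro prod_le_1) (auto intro!: sum_nonneg)
      finally show "(\<Sum>w\<in>W. \<Psi> w y) \<le> 1" .
    qed simp
    also have "\<dots> = 1"
      by (simp add: prob_space)
    finally show ?thesis
      using k1 by (simp add: power_one_over)
  qed
  \<comment> \<open>A lower bound for the weight of the letter of \<open>x\<close>, whichever
    \<epsilon>-close point is read. Off \<open>K\<close> the available bound \<open>r\<close> is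
    weakened to \<open>p * r\<close>, so that \<open>- ln (c x)\<close> splits into a constant per
    letter and a count of visits outside \<open>K\<close>.\<close>
  define f where "f x = p * (if x \<in> K then 1 else r)" for x
  have f: "0 < f x" "f x \<le> 1" for x
    using pr by (auto simp: f_def intro: mult_le_one)
  have f_neq: "f x \<noteq> 0" for x
    using f(1)[of x] by simp
  define c where "c x = (\<Prod>i<n. f ((T ^^ i) x))" for x
  have c: "0 < c x" "c x \<le> 1" for x
    using f by (auto simp: c_def intro!: prod_pos prod_le_1 less_imp_le[OF f(1)])
  have ln_c: "- ln (c x) = (\<Sum>i<n. - ln p + - ln r * indicator (- K) ((T ^^ i) x))" for x
  proof -
    have "ln (c x) = (\<Sum>i<n. ln (f ((T ^^ i) x)))"
      unfolding c_def using f_neq by (intro ln_prod) simp_all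
    also have "\<dots> = (\<Sum>i<n. ln p + ln r * indicator (- K) ((T ^^ i) x))"
      using pr by (intro sum.cong refl) (auto simp: f_def ln_mult_pos)
    finally show ?thesis
      by (simp add: sum_negf[symmetric] minus_add_distrib)
  qed
  have q_low: "- ln (q (name T N n x)) \<le> ln 2 + - ln (c x) + capped_rate k \<epsilon> n x" for x
  proof -
    let ?m = "prob (bowen_ball T x n \<epsilon>)" and ?u = "(1 / k) ^ n"
    have u: "0 < ?u"
      using k1 by simp
    have "c x * ?m = (\<integral>y. c x * indicator (bowen_ball T x n \<epsilon>) y \<partial>\<mu>)"
      by simp
    also have "\<dots> \<le> (\<integral>y. \<Psi> (name T N n x) y \<partial>\<mu>)"
    proof (rule integral_mono[OF _ \<Psi>_int])
      show "integrable \<mu> (\<lambda>y. c x * indicator (bowen_ball T x n \<epsilon>) y)"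
        by (intro integrable_mult_right integrable_real_indicator) (auto simp: less_top[symmetric])
      fix y
      show "c x * indicator (bowen_ball T x n \<epsilon>) y \<le> \<Psi> (name T N n x) y"
      proof (cases "y \<in> bowen_ball T x n \<epsilon>")
        case True
        have "c x \<le> \<Psi> (name T N n x) y"
          unfolding c_def \<Psi>_def
        proof (rule prod_mono)
          fix i assume i: "i \<in> {..<n}"
          have "f ((T ^^ i) x) \<le> \<kappa> (N ((T ^^ i) x)) ((T ^^ i) y)"
          proof (cases "(T ^^ i) x \<in> K")
            case inK: True
            have "(T ^^ i) y \<in> U (N ((T ^^ i) x))"
              using True i by (intro near inK) (simp add: bowen_ball_def)
            then show ?thesis
              using inK pr by (simp add: f_def \<kappa>_def)
          next
            case False
            have "p * r \<le> 1 * r"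
              using pr by (intro mult_right_mono) auto
            then show ?thesis
              using False \<kappa>(3)[of "N ((T ^^ i) x)" "(T ^^ i) y"] by (simp add: f_def)
          qed
          then show "0 \<le> f ((T ^^ i) x) \<and> f ((T ^^ i) x) \<le> \<kappa> (name T N n x i) ((T ^^ i) y)"
            using i f(1)[of "(T ^^ i) x"] by (simp add: name_def)
        qed
        then show ?thesis
          using True by simp
      qed (use \<Psi> in simp)
    qed
    finally have 1: "c x * ?m \<le> (\<integral>y. \<Psi> (name T N n x) y \<partial>\<mu>)" .
    have "c x * max ?m ?u = max (c x * ?m) (c x * ?u)"
      using c(1)[of x] by (simp add: max_mult_distrib_left)
    \<comment> \<open>As \<open>c x \<le> 1\<close>, the factor \<open>c x\<close> can also be
      attached to the uniform weight, and a maximum is below the sum. The halves in \<open>q\<close>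
      then leave the term \<open>ln 2\<close>.\<close>
    also have "\<dots> \<le> c x * ?m + ?u"
      using c[of x] u by (auto simp: mult_left_le_one_le add_increasing)
    finally have "1 / 2 * (c x * max ?m ?u) \<le> q (name T N n x)"
      using 1 by (simp add: q_def)
    moreover have M: "0 < max ?m ?u"
      using u by simp
    ultimately have "ln (1 / 2 * (c x * max ?m ?u)) \<le> ln (q (name T N n x))"
      using c(1)[of x] q_pos by (intro iffD2[OF ln_le_cancel_iff]) auto
    moreover have "ln (1 / 2 * (c x * max ?m ?u)) = - ln 2 + (ln (c x) + ln (max ?m ?u))"
      using c(1)[of x] M by (simp add: ln_mult_pos ln_div)
    ultimately show ?thesis
      by (simp add: capped_rate_def)
  qed
  have ind_int: "integrable \<mu> (\<lambda>x. - ln r * indicator (- K) ((T ^^ i) x))"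
    and ind_eq: "(\<integral>x. - ln r * indicator (- K) ((T ^^ i) x) \<partial>\<mu>) = - ln r * prob (- K)" for i
  proof -
    have nK: "- K \<in> sets \<mu>"
      using K by simp
    have meas: "(\<lambda>x. indicator (- K) ((T ^^ i) x) :: real) \<in> borel_measurable \<mu>"
      by (rule measurable_compose[OF measurable_iterate]) (rule borel_measurable_indicator[OF nK])
    show "integrable \<mu> (\<lambda>x. - ln r * indicator (- K) ((T ^^ i) x))"
      by (intro integrable_mult_right integrable_const_bound[where B = 1, OF _ meas]) (auto simp: indicator_def)
    have "indicat_real (- K) \<in> borel_measurable \<mu>"
      by (rule borel_measurable_indicator[OF nK])
    from integral_distr[OF measurable_iterate this, of i]
    have "(\<integral>x. indicat_real (- K) ((T ^^ i) x) \<partial>\<mu>) = (\<integral>x. indicat_real (- K) x \<partial>\<mu>)"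
      by (simp only: distr_iterate)
    then show "(\<integral>x. - ln r * indicator (- K) ((T ^^ i) x) \<partial>\<mu>) = - ln r * prob (- K)"
      by simp
  qed
  have c_int: "integrable \<mu> (\<lambda>x. - ln (c x))"
    unfolding ln_c by (intro Bochner_Integration.integrable_sum Bochner_Integration.integrable_add integrable_const ind_int)
  have c_eq: "(\<integral>x. - ln (c x) \<partial>\<mu>) = real n * - ln p + real n * prob (- K) * - ln r"
  proof -
    have "(\<integral>x. - ln (c x) \<partial>\<mu>) = (\<Sum>i<n. (\<integral>x. - ln p + - ln r * indicator (- K) ((T ^^ i) x) \<partial>\<mu>))"
      unfolding ln_c by (intro Bochner_Integration.integral_sum Bochner_Integration.integrable_add integrable_const ind_int)
    also have "\<dots> = (\<Sum>i<n. - ln p + - ln r * prob (- K))"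
      by (intro sum.cong refl) (subst Bochner_Integration.integral_add[OF integrable_const ind_int], simp only: ind_eq, simp add: prob_space)
    finally show ?thesis
      by (simp add: algebra_simps)
  qed
  have "block_entropy N n \<le> (\<integral>x. - ln (q (name T N n x)) \<partial>\<mu>)"
    using gibbs_inequality[OF simple_function_name[OF N, of n], of q] q_pos q_sum less_imp_le[OF q_pos]
    by (simp add: block_entropy_def vimage_name)
  also have "\<dots> \<le> (\<integral>x. ln 2 + - ln (c x) + capped_rate k \<epsilon> n x \<partial>\<mu>)"
    by (intro integral_mono q_low integral_simple_comp(1)[OF simple_function_name[OF N]]
        Bochner_Integration.integrable_add integrable_const c_int integrable_capped_rate k1)
  also have "\<dots> = ln 2 + (\<integral>x. - ln (c x) \<partial>\<mu>) + (\<integral>x. capped_rate k \<epsilon> n x \<partial>\<mu>)"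
    using Bochner_Integration.integral_add[OF Bochner_Integration.integrable_add[OF integrable_const c_int] integrable_capped_rate[OF k1], of "ln 2" \<epsilon> n]
      Bochner_Integration.integral_add[OF integrable_const c_int, of "ln 2"] by (simp add: prob_space)
  finally show ?thesis
    unfolding c_eq by (simp add: p_def r_def)
qed

text \<open>A Bowen ball, however small its radius, may meet several cells. Regularity replaces each
  cell by a closed core at the cost of little measure; compactness separates the cores, and their
  small neighbourhoods \<open>U w\<close> are disjoint.\<close>

lemma separated_cores:
  fixes N :: "'a \<Rightarrow> 'b"
  assumes N: "simple_function \<mu> N" and "0 < \<delta>"
  shows "\<exists>K U \<epsilon>. K \<in> sets borel \<and> prob (- K) \<le> \<delta> \<and> 0 < \<epsilon> \<and> (\<forall>w. U w \<in> sets borel) \<and>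
    (\<forall>x\<in>K. \<forall>y. dist x y < \<epsilon> \<longrightarrow> y \<in> U (N x)) \<and>
    (\<forall>w\<in>range N. \<forall>w'\<in>range N. \<forall>y. y \<in> U w \<longrightarrow> y \<in> U w' \<longrightarrow> w = w')"
proof -
  have fin: "finite (range N)" and meas: "\<And>w. w \<in> range N \<Longrightarrow> N -` {w} \<in> sets borel"
    using N by (auto simp: simple_function_def)
  define k where "k = real (card (range N))"
  have k1: "1 \<le> k"
    using fin unfolding k_def by (simp add: Suc_le_eq card_gt_0_iff)
  have "\<forall>w\<in>range N. \<exists>F. closed F \<and> F \<subseteq> N -` {w} \<and> prob (N -` {w} - F) < \<delta> / k"
  proof
    fix w assume w: "w \<in> range N"
    obtain F V where F: "closed F" "open V" "F \<subseteq> N -` {w}" "N -` {w} \<subseteq> V" "prob (V - F) < \<delta> / k"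
      using borel_regular[OF finite_measure_axioms sets_eq meas[OF w], of "\<delta> / k"] assms(2) k1 by auto
    have "prob (N -` {w} - F) \<le> prob (V - F)"
      using F by (intro finite_measure_mono) auto
    then show "\<exists>F. closed F \<and> F \<subseteq> N -` {w} \<and> prob (N -` {w} - F) < \<delta> / k"
      using F by (intro exI[of _ F]) simp
  qed
  then obtain F where F: "\<forall>w\<in>range N. closed (F w) \<and> F w \<subseteq> N -` {w} \<and> prob (N -` {w} - F w) < \<delta> / k"
    unfolding bchoice_iff by (elim exE)
  define K where "K = (\<Union>w\<in>range N. F w)"
  have K: "K \<in> sets borel"
    unfolding K_def using F fin by (intro sets.finite_UN) auto
  have "(\<Union>w\<in>range N. N -` {w} - F w) \<in> sets \<mu>"
  proof (rule sets.finite_UN[OF fin])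
    fix w assume w: "w \<in> range N"
    then have "F w \<in> sets borel"
      using bspec[OF F w] by (intro borel_closed) simp
    then show "N -` {w} - F w \<in> sets \<mu>"
      using meas[OF w] by (simp add: sets.Diff)
  qed
  moreover have "- K \<subseteq> (\<Union>w\<in>range N. N -` {w} - F w)"
    by (auto simp: K_def)
  ultimately have "prob (- K) \<le> prob (\<Union>w\<in>range N. N -` {w} - F w)"
    by (intro finite_measure_mono)
  also have "\<dots> \<le> (\<Sum>w\<in>range N. prob (N -` {w} - F w))"
    using F fin meas by (intro finite_measure_subadditive_finite) auto
  also have "\<dots> \<le> (\<Sum>w\<in>range N. \<delta> / k)"
    using F by (intro sum_mono) (auto intro: less_imp_le)
  also have "\<dots> = \<delta>"
    using k1 by (simp add: k_def)
  finally have mK: "prob (- K) \<le> \<delta>" .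
  have "\<forall>u\<in>range N \<times> range N. \<exists>d>0. fst u \<noteq> snd u \<longrightarrow> (\<forall>x\<in>F (fst u). \<forall>y\<in>F (snd u). d \<le> dist x y)"
  proof
    fix u assume u: "u \<in> range N \<times> range N"
    show "\<exists>d>0. fst u \<noteq> snd u \<longrightarrow> (\<forall>x\<in>F (fst u). \<forall>y\<in>F (snd u). d \<le> dist x y)"
    proof (cases "fst u = snd u")
      case True
      then show ?thesis
        by (intro exI[of _ 1]) simp
    next
      case False
      have uF: "closed (F (fst u))" "closed (F (snd u))" "F (fst u) \<subseteq> N -` {fst u}" "F (snd u) \<subseteq> N -` {snd u}"
      proof -
        have "fst u \<in> range N" "snd u \<in> range N"
          using u by auto
        then show "closed (F (fst u))" "closed (F (snd u))" "F (fst u) \<subseteq> N -` {fst u}" "F (snd u) \<subseteq> N -` {snd u}"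
          by (simp_all only: bspec[OF F])
      qed
      have "compact (F (fst u))"
        using compact_Int_closed[OF compact_space uF(1)] by simp
      moreover have "F (fst u) \<inter> F (snd u) = {}"
      proof (rule equals0I)
        fix x assume "x \<in> F (fst u) \<inter> F (snd u)"
        then have xF: "x \<in> F (fst u)" "x \<in> F (snd u)"
          by simp_all
        have "N x = fst u" "N x = snd u"
          using subsetD[OF uF(3) xF(1)] subsetD[OF uF(4) xF(2)] by simp_all
        then show "False"
          using False by simp
      qed
      ultimately show ?thesis
        using separated_compact_closed[of "F (fst u)" "F (snd u)"] uF(2) by (simp add: False)
    qed
  qed
  then obtain d where d: "\<forall>u\<in>range N \<times> range N. 0 < d u \<and> (fst u \<noteq> snd u \<longrightarrow> (\<forall>x\<in>F (fst u). \<forall>y\<in>F (snd u). d u \<le> dist x y))"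
    unfolding bchoice_iff by (elim exE)
  \<comment> \<open>Half the least distance between distinct cores keeps their
    \<epsilon>-neighbourhoods disjoint; the diagonal pairs only contribute some positive
    number.\<close>
  define \<epsilon> where "\<epsilon> = Min (d ` (range N \<times> range N)) / 2"
  have \<epsilon>: "0 < \<epsilon>" "\<And>u. u \<in> range N \<times> range N \<Longrightarrow> 2 * \<epsilon> \<le> d u"
    using d fin by (auto simp: \<epsilon>_def)
  define U where "U w = (\<Union>x\<in>F w. ball x \<epsilon>)" for w
  have "w = w'" if w: "w \<in> range N" "w' \<in> range N" and y: "y \<in> U w" "y \<in> U w'" for w w' y
  proof (rule ccontr)
    assume "w \<noteq> w'"
    obtain x x' where x: "x \<in> F w" "dist x y < \<epsilon>" "x' \<in> F w'" "dist x' y < \<epsilon>"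
      using y by (auto simp: U_def)
    have "2 * \<epsilon> \<le> d (w, w')"
      using w by (intro \<epsilon>(2)) simp
    also have "\<dots> \<le> dist x x'"
      using d w \<open>w \<noteq> w'\<close> x by force
    also have "\<dots> < 2 * \<epsilon>"
      using x dist_triangle2[of x x' y] by simp
    finally show False
      by simp
  qed
  moreover have "y \<in> U (N x)" if xK: "x \<in> K" and xy: "dist x y < \<epsilon>" for x y
  proof -
    obtain w where w: "w \<in> range N" "x \<in> F w"
      using xK by (auto simp: K_def)
    then have "N x = w"
      using F by auto
    then show ?thesis
      using w xy by (auto simp: U_def)
  qed
  moreover have "U w \<in> sets borel" for w
    unfolding U_def by (intro borel_open open_UN) simp
  ultimately show ?thesis
    using K mK \<epsilon>(1) by (intro exI[of _ K] exI[of _ U] exI[of _ \<epsilon>]) simp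
qed

text \<open>The cap only increases the argument of the logarithm, so upper bounds on the rate
  survive it. The constant \<open>c\<close> stays inside because the reverse Fatou inequality is
  applied to the whole integrand.\<close>

lemma generic_limsup_capped_rate:
  assumes x: "generic x" and "0 < \<epsilon>" "0 \<le> c" "1 \<le> k"
  shows "limsup (\<lambda>n. ennreal (c + capped_rate k \<epsilon> n x / real n)) \<le> ennreal c + lower_local_entropy \<mu> \<phi> x"
proof (rule ennreal_le_dense_real)
  fix a b assume a: "ennreal c + lower_local_entropy \<mu> \<phi> x < ennreal a" and b: "a < b"
  have "lower_local_entropy \<mu> \<phi> x \<noteq> \<infinity>"
    using a by auto
  then obtain l where l: "lower_local_entropy \<mu> \<phi> x = ennreal l" "0 \<le> l"
    by (cases "lower_local_entropy \<mu> \<phi> x") auto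
  have "ennreal (c + l) < ennreal a"
    using a unfolding l(1) ennreal_plus[OF assms(3) l(2), symmetric] .
  then have "c + l < a"
    using ennreal_less_iff[of "c + l" a] l assms(3) by (simp del: ennreal_plus)
  then have less: "lower_local_entropy \<mu> \<phi> x < ennreal (a - c)"
    using l by (simp add: ennreal_less_iff)
  have ba: "0 < b - a"
    using b by simp
  have "eventually (\<lambda>n. ennreal (c + capped_rate k \<epsilon> n x / real n) \<le> ennreal b) sequentially"
    using genericD[OF x ba assms(2) less] eventually_gt_at_top[of 0]
  proof eventually_elim
    case (elim n)
    then have "exp (- ((a - c + (b - a)) * real n)) \<le> max (prob (bowen_ball T x n \<epsilon>)) ((1 / k) ^ n)"
      using b by simp
    then have "- ((b - c) * real n) \<le> ln (max (prob (bowen_ball T x n \<epsilon>)) ((1 / k) ^ n))"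
    proof (subst ln_ge_iff)
      have "0 < (1 / k) ^ n"
        using assms(4) by simp
      then show "0 < max (prob (bowen_ball T x n \<epsilon>)) ((1 / k) ^ n)"
        by (simp add: less_max_iff_disj)
    qed simp
    then have "capped_rate k \<epsilon> n x \<le> (b - c) * real n"
      by (simp add: capped_rate_def)
    then have "capped_rate k \<epsilon> n x / real n \<le> b - c"
      using elim(2) by (simp add: field_simps)
    then show ?case
      by (intro ennreal_leI) simp
  qed
  then show "limsup (\<lambda>n. ennreal (c + capped_rate k \<epsilon> n x / real n)) \<le> ennreal b"
    by (rule Limsup_bounded)
qed

lemma ks_entropy_partition_le:
  assumes P: "finite_measurable_partition \<mu> P"
  shows "ennreal (ks_entropy_partition \<mu> T P) \<le> (\<integral>\<^sup>+x. bowen_entropy x \<partial>\<mu>)"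
proof (rule ennreal_le_epsilon)
  fix e :: real assume e: "0 < e"
  \<comment> \<open>Three errors share \<open>e\<close>: the term \<open>ln 2 / n\<close>, the loss
    \<open>- ln (1 - \<delta>)\<close> per letter, and the cost of the visits outside
    \<open>K\<close>.\<close>
  define \<eta> where "\<eta> = e / 3"
  have \<eta>: "0 < \<eta>"
    using e by (simp add: \<eta>_def)
  let ?N = "symbol P"
  note s = simple_function_symbol[OF P]
  define k where "k = real (card (range ?N))"
  have "finite (range ?N)"
    using s by (simp add: simple_function_def)
  then have k1: "1 \<le> k"
    unfolding k_def by (simp add: Suc_le_eq card_gt_0_iff)
  define \<delta> where "\<delta> = 1 - exp (- \<eta>)"
  have \<delta>: "0 < \<delta>" "\<delta> < 1" "- ln (1 - \<delta>) = \<eta>"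
    using \<eta> by (auto simp: \<delta>_def)
  define \<rho> where "\<rho> = - ln (\<delta> / k)"
  have "\<delta> / k \<le> 1"
    using \<delta> k1 by simp
  then have \<rho>: "0 \<le> \<rho>"
    using \<delta> k1 by (simp add: \<rho>_def)
  \<comment> \<open>A visit outside \<open>K\<close> costs \<rho>, which is fixed by \<delta>; so
    \<open>K\<close> is chosen after \<delta>. The summand \<open>1\<close> guards against
    \<open>\<rho> = 0\<close>.\<close>
  have "0 < \<eta> / (\<rho> + 1)"
    using \<eta> \<rho> by simp
  from separated_cores[OF s this] obtain K U \<epsilon> where K: "K \<in> sets borel" "prob (- K) \<le> \<eta> / (\<rho> + 1)" "0 < \<epsilon>"
    "\<forall>w. U w \<in> sets borel" "\<forall>x\<in>K. \<forall>y. dist x y < \<epsilon> \<longrightarrow> y \<in> U (?N x)"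
    "\<forall>w\<in>range ?N. \<forall>w'\<in>range ?N. \<forall>y. y \<in> U w \<longrightarrow> y \<in> U w' \<longrightarrow> w = w'"
    by (elim exE conjE)
  have "prob (- K) * \<rho> \<le> \<eta> / (\<rho> + 1) * \<rho>"
    using K(2) \<rho> by (rule mult_right_mono)
  also have "\<dots> \<le> \<eta>"
    using \<eta> \<rho> by (simp add: field_simps)
  finally have mK: "prob (- K) * \<rho> \<le> \<eta>" .
  let ?H = "block_entropy ?N"
  let ?u = "\<lambda>n x. ennreal (e + capped_rate k \<epsilon> n x / real n)"
  have "eventually (\<lambda>n. ln 2 / real n < \<eta>) sequentially"
    using \<eta> by (intro order_tendstoD(2)[OF lim_const_over_n])
  then have le: "eventually (\<lambda>n. ennreal (?H n / real n) \<le> (\<integral>\<^sup>+x. ?u n x \<partial>\<mu>)) sequentially"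
    using eventually_gt_at_top[of 0]
  proof eventually_elim
    case (elim n)
    have "?H n \<le> ln 2 + real n * - ln (1 - \<delta>) + real n * prob (- K) * - ln (\<delta> / k) +
        (\<integral>x. capped_rate k \<epsilon> n x \<partial>\<mu>)"
      by (rule block_entropy_le_capped_rate[where U = U and \<epsilon> = \<epsilon>, OF s k_def K(1) K(4)[rule_format] K(5)[rule_format]
            K(6)[rule_format] \<delta>(1,2)])
    also have "\<dots> = ln 2 + real n * \<eta> + real n * (prob (- K) * \<rho>) + (\<integral>x. capped_rate k \<epsilon> n x \<partial>\<mu>)"
      by (simp add: \<delta>(3) \<rho>_def)
    also have "\<dots> \<le> real n * \<eta> + real n * \<eta> + real n * \<eta> + (\<integral>x. capped_rate k \<epsilon> n x \<partial>\<mu>)"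
      using elim mK by (intro add_mono mult_left_mono) (auto simp: field_simps)
    finally have "?H n / real n \<le> e + (\<integral>x. capped_rate k \<epsilon> n x \<partial>\<mu>) / real n"
      using elim(2) by (simp add: \<eta>_def field_simps)
    also have "\<dots> = (\<integral>x. e + capped_rate k \<epsilon> n x / real n \<partial>\<mu>)"
      using Bochner_Integration.integral_add[OF integrable_const integrable_divide[OF integrable_capped_rate[OF k1]], of e \<epsilon> n "real n"]
      by (simp add: prob_space)
    finally have "ennreal (?H n / real n) \<le> ennreal (\<integral>x. e + capped_rate k \<epsilon> n x / real n \<partial>\<mu>)"
      by (rule ennreal_leI)
    also have "\<dots> = (\<integral>\<^sup>+x. ?u n x \<partial>\<mu>)"
      using e capped_rate_bounds(1)[OF k1]
      by (intro nn_integral_eq_integral[symmetric] Bochner_Integration.integrable_add integrable_const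
          integrable_divide integrable_capped_rate k1) (auto intro!: add_nonneg_nonneg)
    finally show ?case .
  qed
  have "ennreal (ks_entropy_partition \<mu> T P) = limsup (\<lambda>n. ennreal (?H n / real n))"
    using tendsto_ennrealI[OF ks_entropy_partition_tendsto[OF P]]
    by (rule lim_imp_Limsup[OF trivial_limit_sequentially, symmetric])
  also have "\<dots> \<le> limsup (\<lambda>n. \<integral>\<^sup>+x. ?u n x \<partial>\<mu>)"
    by (rule Limsup_mono[OF le])
  \<comment> \<open>The reverse Fatou inequality, with the constant \<open>e + ln k\<close> given by
    the cap as majorant.\<close>
  also have "\<dots> \<le> (\<integral>\<^sup>+x. limsup (\<lambda>n. ?u n x) \<partial>\<mu>)"
  proof (rule nn_integral_limsup[where w = "\<lambda>_. ennreal (e + ln k)"])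
    show "AE x in \<mu>. ?u n x \<le> ennreal (e + ln k)" for n
    proof (intro AE_I2 ennreal_leI add_left_mono)
      fix x
      show "capped_rate k \<epsilon> n x / real n \<le> ln k"
        using capped_rate_bounds(2)[OF k1, of \<epsilon> n x] k1 by (cases "n = 0") (auto simp: field_simps)
    qed
    show "(\<integral>\<^sup>+x. ennreal (e + ln k) \<partial>\<mu>) < \<infinity>"
      by (simp add: emeasure_space_1)
  qed simp_all
  also have "\<dots> \<le> (\<integral>\<^sup>+x. ennreal e + bowen_entropy x \<partial>\<mu>)"
  proof (rule nn_integral_mono_AE)
    show "AE x in \<mu>. limsup (\<lambda>n. ?u n x) \<le> ennreal e + bowen_entropy x"
      using AE_generic
    proof eventually_elim
      case (elim x)
      have "limsup (\<lambda>n. ?u n x) \<le> ennreal e + lower_local_entropy \<mu> \<phi> x"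
        using e by (intro generic_limsup_capped_rate elim K(3) k1) simp
      also have "\<dots> \<le> ennreal e + bowen_entropy x"
        by (intro add_left_mono lower_le_bowen_entropy)
      finally show ?case .
    qed
  qed
  also have "\<dots> = ennreal e + (\<integral>\<^sup>+x. bowen_entropy x \<partial>\<mu>)"
    by (subst nn_integral_add) (simp_all add: emeasure_space_1)
  finally show "ennreal (ks_entropy_partition \<mu> T P) \<le> (\<integral>\<^sup>+x. bowen_entropy x \<partial>\<mu>) + ennreal e"
    by (simp add: add.commute)
qed

lemma nn_integral_bowen_entropy: "(\<integral>\<^sup>+x. bowen_entropy x \<partial>\<mu>) = ks_entropy \<mu> T"
proof (rule antisym)
  show "ks_entropy \<mu> T \<le> (\<integral>\<^sup>+x. bowen_entropy x \<partial>\<mu>)"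
    unfolding ks_entropy_def by (rule SUP_least) (simp add: ks_entropy_partition_le)
qed (rule nn_integral_bowen_entropy_le)

end

theorem theorem3p1:
  fixes \<phi> :: "real \<Rightarrow> 'a::metric_space \<Rightarrow> 'a"
    and \<mu> :: "'a measure"
  assumes "compact_metric_flow \<phi>"
    and "no_fixed_points \<phi>"
    and "\<mu> \<in> invariant_measures \<phi>"
  shows "lower_flow_entropy \<mu> \<phi> = upper_flow_entropy \<mu> \<phi>
    \<and> upper_flow_entropy \<mu> \<phi> = ks_entropy \<mu> (\<phi> 1)
    \<and> (AE x in \<mu>. upper_local_entropy \<mu> \<phi> x = lower_local_entropy \<mu> \<phi> x)"
proof -
  interpret compact_metric_flow \<phi> by fact
  interpret invariant_flow \<phi> \<mu>
    by unfold_locales fact+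
  have eq: "AE x in \<mu>. upper_local_entropy \<mu> \<phi> x = lower_local_entropy \<mu> \<phi> x"
    using AE_generic by eventually_elim (intro antisym generic_upper_le_lower lower_le_upper_local_entropy)
  \<comment> \<open>Almost everywhere equality transfers the integral of the measurable
    \<open>bowen_entropy\<close> to the lower local entropy, and then to the upper one.\<close>
  have "AE x in \<mu>. lower_local_entropy \<mu> \<phi> x = bowen_entropy x"
    using AE_generic by eventually_elim (intro antisym generic_bowen_le_lower lower_le_bowen_entropy)
  then have "lower_flow_entropy \<mu> \<phi> = ks_entropy \<mu> (\<phi> 1)"
    unfolding lower_flow_entropy_def nn_integral_bowen_entropy[symmetric] by (rule nn_integral_cong_AE)
  moreover have "lower_flow_entropy \<mu> \<phi> = upper_flow_entropy \<mu> \<phi>"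
    unfolding lower_flow_entropy_def upper_flow_entropy_def
    using eq by (intro nn_integral_cong_AE) (auto elim: eventually_mono)
  ultimately show ?thesis
    using eq by simp
qed

end
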